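(* Let $M$ be a compact connected oriented 3-manifold with boundary such that $\mathcal{P}$ is regular, i.e. the complex $$0\to\mathcal{P}\xrightarrow{\ \epsilon\ }\mathcal{P}'\xrightarrow{\bmod \epsilon}\mathcal{P}\to0$$ is exact. Define $\Upsilon:\mathcal{P}\to\mathcal{S}(BM)/\mathcal{P}$ as follows: for $f\in\mathcal{P}$, choose $f'\in\mathcal{S}(BM)$ such that $f+\epsilon f'\in\mathcal{P}'$ and set $\Upsilon(f)=f'\bmod\mathcal{P}$. Then $\Upsilon$ is well defined and satisfies, for all $f\in\mathcal{P}$ and $g\in\mathcal{S}(BM)$, $$\Upsilon(gf)=g\,\Upsilon(f)+\tfrac12\{g,f\}\quad\text{in }\mathcal{S}(BM)/\mathcal{P}.$$
   Context: For a compact oriented 3-manifold $N$ (possibly with boundary), a commutative ring $R$ and an invertible $t\in R$, the Kauffman skein module $\mathcal{S}(N,R,t)$ is the free $R$-module on isotopy classes of banded links in $N$ (oriented submanifolds diffeomorphic to a disjoint union of annuli; the empty link is included) modulo the relations $[L_\times]=t[L_\infty]+t^{-1}[L_0]$ and $[L\cup O]=-(t^2+t^{-2})[L]$. Here $O$ is a trivial banded knot in a ball disjoint from $L$, and $L_\times,L_\infty,L_0$ coincide outside an oriented ball in which (with blackboard framing) $L_\times$ is a single crossing, $L_\infty$ is the smoothing joining the two regions swept when the over-strand is rotated counterclockwise to the under-strand, and $L_0$ is the other smoothing. Write $\mathcal{S}(N)=\mathcal{S}(N,\mathbb{C},-1)$, a commutative algebra under disjoint union, and $\mathcal{S}'(N)=\mathcal{S}(N,\mathbb{C}[\epsilon]/(\epsilon^2),-1+\epsilon)$.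 Let $BM\cong\partial M\times[0,1]$ be a collar of $\partial M$ in $M$. Multicurves (embedded closed 1-manifolds in $\partial M$ without component bounding a disc) form a basis of $\mathcal{S}(BM)$ over $\mathbb{C}$ and of $\mathcal{S}'(BM)$ over $\mathbb{C}[\epsilon]/(\epsilon^2)$, so every element of $\mathcal{S}'(BM)$ is uniquely $f+\epsilon f'$ with $f,f'\in\mathcal{S}(BM)$. Stacking makes $\mathcal{S}'(BM)$ an algebra; in a product $F\cdot G$ the link $F$ is placed nearer to $\partial M$ and $G$ deeper inside $M$. One has $$(f+\epsilon f')\cdot(g+\epsilon g')=fg+\epsilon\big(fg'+f'g+\tfrac12\{f,g\}\big),$$ where $\{\cdot,\cdot\}$ is the Goldman Poisson bracket on $\mathcal{S}(BM)$ (the algebra of regular functions on the $\mathrm{SL}_2(\mathbb{C})$-character variety of $\partial M$), with sign and normalization fixed by this formula (a known fact that may be used). Let $\mathcal{P}=\ker(\mathcal{S}(BM)\to\mathcal{S}(M))$ and $\mathcal{P}'=\ker(\mathcal{S}'(BM)\to\mathcal{S}'(M))$, the maps being induced by the inclusion $BM\subset M$. The map $\mathcal{P}\to\mathcal{P}'$ is $f\mapsto\epsilon f$ and $\mathcal{P}'\to\mathcal{P}$ is $f+\epsilon f'\mapsto f$. *)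

theory Defs
  imports
    "HOL-Analysis.Analysis"
    "HOL-Library.Poly_Mapping"
    "HOL-Algebra.AbelCoset"
    "HOL-Algebra.Module"
begin

section \<open>Dual numbers\<close>

text \<open>The ring \<open>\<complex>[\<epsilon>]/(\<epsilon>\<^sup>2)\<close>; \<^term>\<open>Dual a b\<close> stands for \<open>a + \<epsilon> b\<close>.\<close>

datatype dual = Dual (std_part: complex) (eps_part: complex)

instantiation dual :: comm_ring_1
begin

definition "0 = Dual 0 0"
definition "1 = Dual 1 0"
definition "x + y = Dual (std_part x + std_part y) (eps_part x + eps_part y)"
definition "- x = Dual (- std_part x) (- eps_part x)"
definition "x - y = Dual (std_part x - std_part y) (eps_part x - eps_part y)"
definition "x * y = Dual (std_part x * std_part y)
                         (std_part x * eps_part y + eps_part x * std_part y)"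

instance
  by standard
    (auto simp: zero_dual_def one_dual_def plus_dual_def uminus_dual_def minus_dual_def
      times_dual_def algebra_simps)

end

definition dual_eps :: dual where
  "dual_eps = Dual 0 1"

definition unit_inverse :: "'r::comm_ring_1 \<Rightarrow> 'r" where
  "unit_inverse t = (THE s. t * s = 1)"


section \<open>Smooth maps and oriented 3-manifolds\<close>

text \<open>Manifolds are embedded submanifolds of Euclidean spaces, and smoothness of a map on an arbitrary
  subset means that it has, near each point, a smooth extension to an open set. By
  Whitney's theorem every compact manifold is diffeomorphic to one of this form.\<close>

primrec Ck_on ::
  "nat \<Rightarrow> ('a::euclidean_space \<Rightarrow> 'b::euclidean_space) \<Rightarrow> 'a set \<Rightarrow> bool" where
  "Ck_on 0 f U = continuous_on U f"
| "Ck_on (Suc k) f U =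
     ((\<forall>x\<in>U. f differentiable (at x)) \<and> (\<forall>v. Ck_on k (\<lambda>x. frechet_derivative f (at x) v) U))"

definition smooth_map ::
  "'a::euclidean_space set \<Rightarrow> ('a \<Rightarrow> 'b::euclidean_space) \<Rightarrow> bool" where
  "smooth_map X f \<longleftrightarrow>
     (\<forall>x\<in>X. \<exists>U g. open U \<and> x \<in> U \<and> (\<forall>k. Ck_on k g U) \<and> (\<forall>y\<in>X \<inter> U. g y = f y))"

definition smooth_emb ::
  "'a::euclidean_space set \<Rightarrow> 'b::euclidean_space set \<Rightarrow> ('a \<Rightarrow> 'b) \<Rightarrow> bool" where
  "smooth_emb X Y f \<longleftrightarrow>
     smooth_map X f \<and> f ` X \<subseteq> Y \<and> inj_on f X \<and> smooth_map (f ` X) (inv_into X f)"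

definition orient_pres_at :: "(real^'n \<Rightarrow> real^'n) \<Rightarrow> real^'n \<Rightarrow> bool" where
  "orient_pres_at f x \<longleftrightarrow> f differentiable (at x) \<and> 0 < det (matrix (frechet_derivative f (at x)))"

type_synonym 'a chart = "(real^3) set \<times> (real^3 \<Rightarrow> 'a)"

definition is_chart :: "'a::euclidean_space set \<Rightarrow> 'a chart \<Rightarrow> bool" where
  "is_chart M = (\<lambda>(U, \<psi>).
     (\<exists>i. openin (top_of_set {x. 0 \<le> x $ i}) U) \<and>
     smooth_emb U M \<psi> \<and> openin (top_of_set M) (\<psi> ` U))"

text \<open>The orientation is given by an oriented atlas. At boundary points of a chart
  domain the Jacobian of a transition map is nonzero, so its sign there is determined by continuity.\<close>

definition oriented_3manifold :: "'a::euclidean_space set \<Rightarrow> 'a chart set \<Rightarrow> bool" where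
  "oriented_3manifold M A \<longleftrightarrow>
     (\<forall>C\<in>A. is_chart M C) \<and> M \<subseteq> (\<Union>(U, \<psi>)\<in>A. \<psi> ` U) \<and>
     (\<forall>(U, \<psi>)\<in>A. \<forall>(V, \<eta>)\<in>A. \<forall>x\<in>interior U.
        \<psi> x \<in> \<eta> ` V \<longrightarrow> orient_pres_at (inv_into V \<eta> \<circ> \<psi>) x)"

definition bdry :: "'a::euclidean_space set \<Rightarrow> 'a set" where
  "bdry M = {p \<in> M. \<not> (\<exists>U. \<exists>\<psi> :: real^3 \<Rightarrow> 'a. open U \<and> smooth_emb U M \<psi> \<and>
                             openin (top_of_set M) (\<psi> ` U) \<and> p \<in> \<psi> ` U)}"

definition collar :: "'a::euclidean_space set \<Rightarrow> ('a \<times> real \<Rightarrow> 'a) \<Rightarrow> bool" where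
  "collar M c \<longleftrightarrow>
     smooth_emb (bdry M \<times> {0..1}) M c \<and> (\<forall>x\<in>bdry M. c (x, 0) = x) \<and>
     openin (top_of_set M) (c ` (bdry M \<times> {0..<1}))"

definition BM :: "'a::euclidean_space set \<Rightarrow> ('a \<times> real \<Rightarrow> 'a) \<Rightarrow> 'a set" where
  "BM M c = c ` (bdry M \<times> {0..1})"

text \<open>A ball in a codimension-0 submanifold \<open>N\<close> of the manifold oriented by \<open>A\<close>.\<close>

definition oriented_ball ::
  "'a::euclidean_space set \<Rightarrow> 'a chart set \<Rightarrow> (real^3 \<Rightarrow> 'a) \<Rightarrow> bool" where
  "oriented_ball N A \<phi> \<longleftrightarrow>
     smooth_emb (cball 0 1) N \<phi> \<and>
     (\<forall>(U, \<psi>)\<in>A. \<forall>x\<in>ball 0 1. \<phi> x \<in> \<psi> ` U \<longrightarrow> orient_pres_at (inv_into U \<psi> \<circ> \<phi>) x)"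


section \<open>Banded links\<close>

text \<open>An oriented submanifold diffeomorphic to \<open>n\<close> annuli is given by an embedding of the standard
  oriented surface \<open>annuli n\<close> in the plane, up to orientation-preserving reparametrization. The
  reparametrization is part of the relation \<open>isotopic\<close> below.\<close>

definition shift :: "nat \<Rightarrow> real^2" where
  "shift i = vector [5 * real i, 0]"

definition annuli :: "nat \<Rightarrow> (real^2) set" where
  "annuli n = (\<Union>i<n. {x. 1 \<le> norm (x - shift i) \<and> norm (x - shift i) \<le> 2})"

type_synonym 'a link = "nat \<times> (real^2 \<Rightarrow> 'a)"

definition is_link :: "'a::euclidean_space set \<Rightarrow> 'a link \<Rightarrow> bool" where
  "is_link N = (\<lambda>(n, e). smooth_emb (annuli n) N e)"

definition supp :: "'a link \<Rightarrow> 'a set" where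
  "supp = (\<lambda>(n, e). e ` annuli n)"

definition empty_link :: "'a link" where
  "empty_link = (0, \<lambda>_. undefined)"

definition link_union :: "'a link \<Rightarrow> 'a link \<Rightarrow> 'a link" where
  "link_union = (\<lambda>(n, e) (m, e').
     (n + m, \<lambda>x. if x \<in> annuli n then e x else e' (x - shift n)))"

definition isotopic :: "'a::euclidean_space set \<Rightarrow> 'a link \<Rightarrow> 'a link \<Rightarrow> bool" where
  "isotopic N = (\<lambda>(n, e) (m, e'). n = m \<and>
     (\<exists>H :: real \<times> (real^2) \<Rightarrow> 'a. \<exists>\<rho>.
        smooth_map ({0..1} \<times> annuli n) H \<and>
        (\<forall>s\<in>{0..1}. smooth_emb (annuli n) N (\<lambda>x. H (s, x))) \<and>
        smooth_emb (annuli n) (annuli n) \<rho> \<and> \<rho> ` annuli n = annuli n \<and>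
        (\<forall>x\<in>interior (annuli n). orient_pres_at \<rho> x) \<and>
        (\<forall>x\<in>annuli n. H (0, x) = e x \<and> H (1, x) = e' (\<rho> x))))"


section \<open>Kauffman relations\<close>

definition lift3 :: "real^2 \<Rightarrow> real \<Rightarrow> real^3" where
  "lift3 x z = vector [x $ 1, x $ 2, z]"

definition proj2 :: "real^3 \<Rightarrow> real^2" where
  "proj2 p = vector [p $ 1, p $ 2]"

text \<open>The ball is the unit ball, seen from the positive third axis. All three tangles leave
  it through four arcs on the equator. In the crossing, the over-strand is a band along the first
  axis, raised to height \<open>h\<close>, and the under-strand is a flat band along the second axis.\<close>

definition east where "east w = {x :: real^2. norm x = 1 \<and> \<bar>x $ 2\<bar> \<le> w \<and> 0 < x $ 1}"
definition west where "west w = {x :: real^2. norm x = 1 \<and> \<bar>x $ 2\<bar> \<le> w \<and> x $ 1 < 0}"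
definition north where "north w = {x :: real^2. norm x = 1 \<and> \<bar>x $ 1\<bar> \<le> w \<and> 0 < x $ 2}"
definition south where "south w = {x :: real^2. norm x = 1 \<and> \<bar>x $ 1\<bar> \<le> w \<and> x $ 2 < 0}"

definition height_fun :: "real \<Rightarrow> (real^2 \<Rightarrow> real) \<Rightarrow> bool" where
  "height_fun w h \<longleftrightarrow>
     smooth_map {x \<in> cball 0 1. \<bar>x $ 2\<bar> \<le> w} h \<and>
     (\<forall>x\<in>cball 0 1. \<bar>x $ 2\<bar> \<le> w \<longrightarrow>
        0 \<le> h x \<and> (\<bar>x $ 1\<bar> \<le> w \<longrightarrow> 0 < h x) \<and>
        (norm x = 1 \<longrightarrow> h x = 0) \<and> (norm x < 1 \<longrightarrow> norm (lift3 x (h x)) < 1))"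

definition crossing :: "real \<Rightarrow> (real^2 \<Rightarrow> real) \<Rightarrow> (real^3) set" where
  "crossing w h =
     (\<lambda>x. lift3 x (h x)) ` {x \<in> cball 0 1. \<bar>x $ 2\<bar> \<le> w} \<union>
     (\<lambda>x. lift3 x 0) ` {x \<in> cball 0 1. \<bar>x $ 1\<bar> \<le> w}"

definition flat_band :: "(real^2) set \<Rightarrow> (real^2) set \<Rightarrow> (real^2) set \<Rightarrow> bool" where
  "flat_band a b B \<longleftrightarrow>
     (\<exists>\<beta> :: real^2 \<Rightarrow> real^2. smooth_emb (cbox 0 1) (cball 0 1) \<beta> \<and> \<beta> ` cbox 0 1 = B \<and>
        \<beta> ` {x \<in> cbox 0 1. x $ 1 = 0} = a \<and> \<beta> ` {x \<in> cbox 0 1. x $ 1 = 1} = b \<and>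
        B \<inter> sphere 0 1 = a \<union> b)"

definition smoothing ::
  "(real^2) set \<Rightarrow> (real^2) set \<Rightarrow> (real^2) set \<Rightarrow> (real^2) set \<Rightarrow> (real^3) set \<Rightarrow> bool" where
  "smoothing a b a' b' T \<longleftrightarrow>
     (\<exists>B B'. flat_band a b B \<and> flat_band a' b' B' \<and> B \<inter> B' = {} \<and>
             T = (\<lambda>x. lift3 x 0) ` (B \<union> B'))"

definition faces_up :: "(real^3 \<Rightarrow> 'a) \<Rightarrow> 'a link \<Rightarrow> bool" where
  "faces_up \<phi> = (\<lambda>(n, e). \<forall>x\<in>interior (annuli n). e x \<in> \<phi> ` ball 0 1 \<longrightarrow>
     orient_pres_at (proj2 \<circ> inv_into (cball 0 1) \<phi> \<circ> e) x)"

definition coincide_outside :: "(real^3 \<Rightarrow> 'a) \<Rightarrow> 'a link \<Rightarrow> 'a link \<Rightarrow> bool" where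
  "coincide_outside \<phi> = (\<lambda>(n, e) (m, e').
     supp (n, e) - \<phi> ` ball 0 1 = supp (m, e') - \<phi> ` ball 0 1 \<and>
     (\<forall>x\<in>interior (annuli n). e x \<notin> \<phi> ` cball 0 1 \<longrightarrow>
        orient_pres_at (inv_into (annuli m) e' \<circ> e) x))"

text \<open>Rotating the over-strand counterclockwise to the under-strand sweeps the north-east and
  south-west regions. \<open>L\<^sub>\<infinity>\<close> joins these, so its two bands cut off the south-east and the
  north-west regions.\<close>

definition kauffman_triple ::
  "'a::euclidean_space set \<Rightarrow> 'a chart set \<Rightarrow> 'a link \<Rightarrow> 'a link \<Rightarrow> 'a link \<Rightarrow> bool" where
  "kauffman_triple N A L Linf L0 \<longleftrightarrow>
     is_link N L \<and> is_link N Linf \<and> is_link N L0 \<and>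
     (\<exists>\<phi> w h Tinf T0.
        oriented_ball N A \<phi> \<and> 0 < w \<and> w < 1/2 \<and> height_fun w h \<and>
        smoothing (east w) (south w) (north w) (west w) Tinf \<and>
        smoothing (east w) (north w) (south w) (west w) T0 \<and>
        supp L \<inter> \<phi> ` cball 0 1 = \<phi> ` crossing w h \<and>
        supp Linf \<inter> \<phi> ` cball 0 1 = \<phi> ` Tinf \<and>
        supp L0 \<inter> \<phi> ` cball 0 1 = \<phi> ` T0 \<and>
        faces_up \<phi> L \<and> faces_up \<phi> Linf \<and> faces_up \<phi> L0 \<and>
        coincide_outside \<phi> L Linf \<and> coincide_outside \<phi> L L0)"

definition trivial_knot :: "(real^3 \<Rightarrow> 'a) \<Rightarrow> 'a link" where
  "trivial_knot \<phi> = (1, \<lambda>x. \<phi> (lift3 ((1/4) *\<^sub>R x) 0))"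


section \<open>Skein modules\<close>

abbreviation fsmult :: "'r::comm_ring_1 \<Rightarrow> ('k \<Rightarrow>\<^sub>0 'r) \<Rightarrow> ('k \<Rightarrow>\<^sub>0 'r)" where
  "fsmult r \<equiv> Poly_Mapping.map ((*) r)"

definition free_links :: "'a::euclidean_space set \<Rightarrow> ('a link \<Rightarrow>\<^sub>0 'r::comm_ring_1) set" where
  "free_links N = {x. \<forall>L\<in>Poly_Mapping.keys x. is_link N L}"

inductive_set skein_relations ::
  "'a::euclidean_space set \<Rightarrow> 'a chart set \<Rightarrow> 'r::comm_ring_1 \<Rightarrow> ('a link \<Rightarrow>\<^sub>0 'r) set"
  for N A t where
  zero: "0 \<in> skein_relations N A t"
| add: "x \<in> skein_relations N A t \<Longrightarrow> y \<in> skein_relations N A t \<Longrightarrow> x + y \<in> skein_relations N A t"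
| scale: "x \<in> skein_relations N A t \<Longrightarrow> fsmult r x \<in> skein_relations N A t"
| isotopy: "is_link N L \<Longrightarrow> is_link N L' \<Longrightarrow> isotopic N L L' \<Longrightarrow>
    Poly_Mapping.single L 1 - Poly_Mapping.single L' 1 \<in> skein_relations N A t"
| crossing: "kauffman_triple N A L Linf L0 \<Longrightarrow>
    Poly_Mapping.single L 1 -
      (Poly_Mapping.single Linf t + Poly_Mapping.single L0 (unit_inverse t))
      \<in> skein_relations N A t"
| unknot: "is_link N L \<Longrightarrow> smooth_emb (cball 0 1) N \<phi> \<Longrightarrow> supp L \<inter> \<phi> ` cball 0 1 = {} \<Longrightarrow>
    Poly_Mapping.single (link_union L (trivial_knot \<phi>)) 1 -
      Poly_Mapping.single L (- (t\<^sup>2 + (unit_inverse t)\<^sup>2)) \<in> skein_relations N A t"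

definition skein_class ::
  "'a::euclidean_space set \<Rightarrow> 'a chart set \<Rightarrow> 'r::comm_ring_1 \<Rightarrow>
    ('a link \<Rightarrow>\<^sub>0 'r) \<Rightarrow> ('a link \<Rightarrow>\<^sub>0 'r) set" where
  "skein_class N A t x = {y \<in> free_links N. y - x \<in> skein_relations N A t}"

text \<open>Only the module structure is specified here; the product exists for the collar.\<close>

definition skein_module ::
  "'a::euclidean_space set \<Rightarrow> 'a chart set \<Rightarrow> 'r::comm_ring_1 \<Rightarrow>
    ('r, ('a link \<Rightarrow>\<^sub>0 'r) set) module" where
  "skein_module N A t =
    \<lparr> carrier = skein_class N A t ` free_links N,
      mult = undefined, one = undefined,
      zero = skein_class N A t 0,
      add = (\<lambda>X Y. \<Union>x\<in>X. \<Union>y\<in>Y. skein_class N A t (x + y)),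
      smult = (\<lambda>r X. \<Union>x\<in>X. skein_class N A t (fsmult r x)) \<rparr>"

text \<open>Stacking: the first factor is moved to the third of the collar next to the boundary
  (collar coordinate 0), the second one to the innermost third.\<close>

definition collar_rescale ::
  "'a::euclidean_space set \<Rightarrow> ('a \<times> real \<Rightarrow> 'a) \<Rightarrow> (real \<Rightarrow> real) \<Rightarrow> 'a \<Rightarrow> 'a" where
  "collar_rescale M c u p =
     (let (x, s) = inv_into (bdry M \<times> {0..1}) c p in c (x, u s))"

definition stack ::
  "'a::euclidean_space set \<Rightarrow> ('a \<times> real \<Rightarrow> 'a) \<Rightarrow> 'a link \<Rightarrow> 'a link \<Rightarrow> 'a link" where
  "stack M c = (\<lambda>(n, e) (m, e').
     link_union (n, collar_rescale M c (\<lambda>s. s / 3) \<circ> e)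
                (m, collar_rescale M c (\<lambda>s. (s + 2) / 3) \<circ> e'))"

definition stack_free ::
  "'a::euclidean_space set \<Rightarrow> ('a \<times> real \<Rightarrow> 'a) \<Rightarrow>
    ('a link \<Rightarrow>\<^sub>0 'r::comm_ring_1) \<Rightarrow> ('a link \<Rightarrow>\<^sub>0 'r) \<Rightarrow> ('a link \<Rightarrow>\<^sub>0 'r)" where
  "stack_free M c x y =
     (\<Sum>K\<in>Poly_Mapping.keys x. \<Sum>L\<in>Poly_Mapping.keys y.
        Poly_Mapping.single (stack M c K L) (Poly_Mapping.lookup x K * Poly_Mapping.lookup y L))"

definition skein_collar ::
  "'a::euclidean_space set \<Rightarrow> 'a chart set \<Rightarrow> ('a \<times> real \<Rightarrow> 'a) \<Rightarrow> 'r::comm_ring_1 \<Rightarrow>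
    ('r, ('a link \<Rightarrow>\<^sub>0 'r) set) module" where
  "skein_collar M A c t =
     (skein_module (BM M c) A t)
       \<lparr> mult := (\<lambda>X Y. \<Union>x\<in>X. \<Union>y\<in>Y. skein_class (BM M c) A t (stack_free M c x y)),
         one := skein_class (BM M c) A t (Poly_Mapping.single empty_link 1) \<rparr>"

definition skein_kernel ::
  "'a::euclidean_space set \<Rightarrow> 'a chart set \<Rightarrow> ('a \<times> real \<Rightarrow> 'a) \<Rightarrow> 'r::comm_ring_1 \<Rightarrow>
    ('a link \<Rightarrow>\<^sub>0 'r) set set" where
  "skein_kernel M A c t =
     a_kernel (skein_collar M A c t) (skein_module M A t) (\<lambda>X. \<Union>x\<in>X. skein_class M A t x)"


section \<open>Multicurves\<close>

text \<open>A multicurve is given through an annular neighbourhood in \<open>\<partial>M\<close>, which carries the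
  framing; it is placed in the middle of the collar.\<close>

definition multicurve ::
  "'a::euclidean_space set \<Rightarrow> ('a \<times> real \<Rightarrow> 'a) \<Rightarrow> 'a link \<Rightarrow> bool" where
  "multicurve M c L \<longleftrightarrow>
     (\<exists>n a. L = (n, \<lambda>x. c (a x, 1/2)) \<and> smooth_emb (annuli n) (bdry M) a \<and>
        (\<forall>i<n. \<not> (\<exists>d :: real^2 \<Rightarrow> 'a. smooth_emb (cball 0 1) (bdry M) d \<and>
                     d ` sphere 0 1 = a ` sphere (shift i) (3/2))))"

definition multicurve_classes ::
  "'a::euclidean_space set \<Rightarrow> ('a \<times> real \<Rightarrow> 'a) \<Rightarrow> 'a link set set" where
  "multicurve_classes M c =
     (\<lambda>L. {L'. multicurve M c L' \<and> isotopic (BM M c) L L'}) ` {L. multicurve M c L}"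

definition multicurve_combs ::
  "'a::euclidean_space set \<Rightarrow> ('a \<times> real \<Rightarrow> 'a) \<Rightarrow> ('a link set \<Rightarrow>\<^sub>0 'r::comm_ring_1) set" where
  "multicurve_combs M c = {a. Poly_Mapping.keys a \<subseteq> multicurve_classes M c}"

definition from_multicurves ::
  "'a::euclidean_space set \<Rightarrow> 'a chart set \<Rightarrow> ('a \<times> real \<Rightarrow> 'a) \<Rightarrow> 'r::comm_ring_1 \<Rightarrow>
    ('a link set \<Rightarrow>\<^sub>0 'r) \<Rightarrow> ('a link \<Rightarrow>\<^sub>0 'r) set" where
  "from_multicurves M A c t a =
     skein_class (BM M c) A t
       (\<Sum>K\<in>Poly_Mapping.keys a. Poly_Mapping.single (SOME L. L \<in> K) (Poly_Mapping.lookup a K))"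

definition multicurves_form_basis ::
  "'a::euclidean_space set \<Rightarrow> 'a chart set \<Rightarrow> ('a \<times> real \<Rightarrow> 'a) \<Rightarrow> 'r::comm_ring_1 \<Rightarrow> bool" where
  "multicurves_form_basis M A c t \<longleftrightarrow>
     bij_betw (from_multicurves M A c t) (multicurve_combs M c) (carrier (skein_collar M A c t))"


section \<open>First-order deformation\<close>

definition SB where "SB M A c = skein_collar M A c (- 1 :: complex)"
definition SB' where "SB' M A c = skein_collar M A c (- 1 + dual_eps)"
definition PB where "PB M A c = skein_kernel M A c (- 1 :: complex)"
definition PB' where "PB' M A c = skein_kernel M A c (- 1 + dual_eps)"

type_synonym 'a skein = "('a link \<Rightarrow>\<^sub>0 complex) set"
type_synonym 'a skein' = "('a link \<Rightarrow>\<^sub>0 dual) set"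

definition multicurve_coords ::
  "'a::euclidean_space set \<Rightarrow> 'a chart set \<Rightarrow> ('a \<times> real \<Rightarrow> 'a) \<Rightarrow> 'a skein \<Rightarrow>
    ('a link set \<Rightarrow>\<^sub>0 complex)" where
  "multicurve_coords M A c = inv_into (multicurve_combs M c) (from_multicurves M A c (- 1))"

text \<open>The element \<open>f + \<epsilon> f'\<close> of \<open>S'(BM)\<close>, formed in the multicurve basis.\<close>

definition plus_eps ::
  "'a::euclidean_space set \<Rightarrow> 'a chart set \<Rightarrow> ('a \<times> real \<Rightarrow> 'a) \<Rightarrow>
    'a skein \<Rightarrow> 'a skein \<Rightarrow> 'a skein'" where
  "plus_eps M A c f f' =
     from_multicurves M A c (- 1 + dual_eps)
       (Poly_Mapping.map (\<lambda>z. Dual z 0) (multicurve_coords M A c f) +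
        Poly_Mapping.map (\<lambda>z. Dual 0 z) (multicurve_coords M A c f'))"

definition mod_eps ::
  "'a::euclidean_space set \<Rightarrow> 'a chart set \<Rightarrow> ('a \<times> real \<Rightarrow> 'a) \<Rightarrow> 'a skein' \<Rightarrow> 'a skein" where
  "mod_eps M A c F =
     (THE f. f \<in> carrier (SB M A c) \<and> (\<exists>f'\<in>carrier (SB M A c). F = plus_eps M A c f f'))"

text \<open>The Goldman bracket \<open>{f,g}\<close>, with the sign and normalization fixed by
  \<open>(f + \<epsilon> f') (g + \<epsilon> g') = f g + \<epsilon> (f g' + f' g + {f,g}/2)\<close>.\<close>

definition goldman_bracket ::
  "'a::euclidean_space set \<Rightarrow> 'a chart set \<Rightarrow> ('a \<times> real \<Rightarrow> 'a) \<Rightarrow>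
    'a skein \<Rightarrow> 'a skein \<Rightarrow> 'a skein" where
  "goldman_bracket M A c f g =
     (let S = SB M A c in
      THE h. h \<in> carrier S \<and>
        (\<forall>f'\<in>carrier S. \<forall>g'\<in>carrier S.
           plus_eps M A c f f' \<otimes>\<^bsub>SB' M A c\<^esub> plus_eps M A c g g' =
           plus_eps M A c (f \<otimes>\<^bsub>S\<^esub> g)
             ((f \<otimes>\<^bsub>S\<^esub> g' \<oplus>\<^bsub>S\<^esub> f' \<otimes>\<^bsub>S\<^esub> g) \<oplus>\<^bsub>S\<^esub> (1/2) \<odot>\<^bsub>S\<^esub> h)))"

text \<open>Exactness of \<open>0 \<rightarrow> P \<rightarrow> P' \<rightarrow> P \<rightarrow> 0\<close>.\<close>

definition regular_kernel ::
  "'a::euclidean_space set \<Rightarrow> 'a chart set \<Rightarrow> ('a \<times> real \<Rightarrow> 'a) \<Rightarrow> bool" where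
  "regular_kernel M A c \<longleftrightarrow>
     inj_on (plus_eps M A c \<zero>\<^bsub>SB M A c\<^esub>) (PB M A c) \<and>
     plus_eps M A c \<zero>\<^bsub>SB M A c\<^esub> ` PB M A c =
       {F \<in> PB' M A c. mod_eps M A c F = \<zero>\<^bsub>SB M A c\<^esub>} \<and>
     mod_eps M A c ` PB' M A c = PB M A c"

text \<open>The quotient \<open>S(BM)/P\<close> consists of the additive cosets of \<open>P\<close>.\<close>

definition coset_act ::
  "'a::euclidean_space set \<Rightarrow> 'a chart set \<Rightarrow> ('a \<times> real \<Rightarrow> 'a) \<Rightarrow>
    'a skein \<Rightarrow> 'a skein set \<Rightarrow> 'a skein set" where
  "coset_act M A c g Q = (\<Union>q\<in>Q. PB M A c +>\<^bsub>SB M A c\<^esub> (g \<otimes>\<^bsub>SB M A c\<^esub> q))"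

definition Upsilon ::
  "'a::euclidean_space set \<Rightarrow> 'a chart set \<Rightarrow> ('a \<times> real \<Rightarrow> 'a) \<Rightarrow> 'a skein \<Rightarrow> 'a skein set" where
  "Upsilon M A c f =
     PB M A c +>\<^bsub>SB M A c\<^esub> (SOME f'. f' \<in> carrier (SB M A c) \<and> plus_eps M A c f f' \<in> PB' M A c)"

end

theory Submission
  imports Defs
begin

text \<open>
  Reduction modulo \<open>\<epsilon>\<close> and the lift of multicurves along the basis give
  \<open>lift f * lift g = lift (f g) + \<epsilon> lift b\<close>, whence the product formula defining the Goldman bracket,
  with \<open>{f,g} = 2 b\<close>. This needs stacking to be compatible with the Kauffman relations, which holds because
  the collar rescalings are isotopic to the identity and therefore preserve the orientation of balls.
  Exactness makes a lift \<open>f + \<epsilon> f'\<close> of \<open>f\<close> to \<open>P'\<close> unique up to \<open>\<epsilon> P\<close>.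

  The kernel \<open>P'\<close> is a left ideal: an embedding of \<open>M\<close> into itself that pushes \<open>M\<close> off the outer third of the
  collar carries a relation in \<open>M\<close> that annihilates \<open>F\<close> to one disjoint from any \<open>G\<close> in the outer third, and
  in the collar it is isotopic to the inner rescaling used by stacking. Multiplying \<open>f + \<epsilon> f'\<close> on the left
  by \<open>g\<close> therefore stays in \<open>P'\<close>, and the product formula identifies the \<open>\<epsilon>\<close>-part as \<open>g f' + {g,f}/2\<close>.
\<close>

section \<open>Iterated differentiability\<close>

text \<open>The right factor of a product lies deeper in \<open>M\<close>. A relation that kills
  \<open>F\<close> may use links anywhere in \<open>M\<close>, so room for \<open>G\<close> can be
  made on the outer side, by moving all of \<open>M\<close> inwards, while a deeper factor would sit
  where the relation takes place; hence a left ideal. The rescaling \<open>(s + 2) / 3\<close> used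
  by \<open>stack\<close> cannot serve as this motion: it fixes the inner end of the collar with
  slope 1/3, so its extension by the identity is not smooth. \<open>push_fun\<close> is the
  replacement, equal to the identity from 3/4 on; \<open>flat_fun\<close> and the calculus of one
  variable behind it exist for its sake. Its coefficient 3/2 balances two demands: 0 must be pushed
  beyond 1/3, which asks for exp (4/3) < 9/2, and the slope must stay positive, which asks that the
  maximum 4/(e*e) of \<open>inverse x ^ 2 * exp (- inverse x)\<close> be below 2/3. Crossings tell
  the two smoothings apart only through the orientation of the ball, and the atlas compares charts
  only at interior points of their domains; this is why orientation is tracked point by point and
  along isotopies.\<close>

lemma Ck_on_subset: "Ck_on k f U \<Longrightarrow> V \<subseteq> U \<Longrightarrow> Ck_on k f V"
  by (induction k arbitrary: f) (auto intro: continuous_on_subset)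

text \<open>A derivative at a point depends on the values near it, so agreement is asked on an open
  set. As \<open>frechet_derivative\<close> is a choice among derivatives, equal sets of derivatives
  give literally equal choices, which is what the induction uses.\<close>

lemma Ck_on_cong:
  assumes "open U" "\<And>x. x \<in> U \<Longrightarrow> f x = g x"
  shows "Ck_on k f U \<longleftrightarrow> Ck_on k g U"
  using assms(2)
proof (induction k arbitrary: f g)
  case 0
  then show ?case by (simp cong: continuous_on_cong)
next
  case (Suc k)
  have deriv: "(f has_derivative D) (at x) \<longleftrightarrow> (g has_derivative D) (at x)" if "x \<in> U" for x D
    using has_derivative_transform_within_open[OF _ \<open>open U\<close> that, of f D UNIV g]
      has_derivative_transform_within_open[OF _ \<open>open U\<close> that, of g D UNIV f] Suc.prems
    by fastforce
  then have diff: "f differentiable (at x) \<longleftrightarrow> g differentiable (at x)" if "x \<in> U" for x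
    using that by (simp add: differentiable_def)
  have "frechet_derivative f (at x) = frechet_derivative g (at x)" if "x \<in> U" for x
    using deriv[OF that] by (simp add: frechet_derivative_def)
  then have "Ck_on k (\<lambda>x. frechet_derivative f (at x) v) U \<longleftrightarrow>
      Ck_on k (\<lambda>x. frechet_derivative g (at x) v) U" for v
    by (intro Suc.IH) simp
  then show ?case using diff by simp
qed

text \<open>Replaces \<open>frechet_derivative\<close> by an explicit formula \<open>F\<close>; most
  closure rules compute the next derivative by hand and feed it in here.\<close>

lemma Ck_on_SucI:
  assumes "open U" "\<And>x. x \<in> U \<Longrightarrow> (f has_derivative F x) (at x)"
    and "\<And>v. Ck_on k (\<lambda>x. F x v) U"
  shows "Ck_on (Suc k) f U"
proof -
  have "frechet_derivative f (at x) = F x" if "x \<in> U" for x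
    using frechet_derivative_at[OF assms(2)[OF that]] by simp
  then have "Ck_on k (\<lambda>x. frechet_derivative f (at x) v) U" for v
    using assms(3)[of v] by (subst Ck_on_cong[OF assms(1), where g = "\<lambda>x. F x v"]) auto
  then show ?thesis using assms(2) by (auto simp: differentiable_def)
qed

lemma Ck_on_SucD:
  assumes "Ck_on (Suc k) f U" shows "Ck_on k f U"
  using assms
proof (induction k arbitrary: f)
  case 0
  then show ?case
    by (auto intro!: continuous_at_imp_continuous_on differentiable_imp_continuous_within)
qed auto

lemma Ck_on_Suc_has_derivative:
  "Ck_on (Suc k) f U \<Longrightarrow> x \<in> U \<Longrightarrow> (f has_derivative frechet_derivative f (at x)) (at x)"
  by (simp add: frechet_derivative_works)

lemma Ck_on_const: "open U \<Longrightarrow> Ck_on k (\<lambda>x. c) U"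
  by (induction k arbitrary: c) auto

lemma Ck_on_id: "open U \<Longrightarrow> Ck_on k (\<lambda>x. x) U"
  by (cases k) (auto simp: Ck_on_const)

lemma Ck_on_bounded_linear:
  assumes "open U" "bounded_linear L" "Ck_on k f U"
  shows "Ck_on k (\<lambda>x. L (f x)) U"
  using assms(3)
proof (induction k arbitrary: f)
  case 0
  then show ?case using linear_continuous_on_compose assms(2)
    by (auto intro: bounded_linear.continuous_on)
next
  case (Suc k)
  show ?case
  proof (rule Ck_on_SucI[OF \<open>open U\<close>])
    show "((\<lambda>x. L (f x)) has_derivative (\<lambda>v. L (frechet_derivative f (at x) v))) (at x)"
      if "x \<in> U" for x
      by (rule bounded_linear.has_derivative[OF assms(2) Ck_on_Suc_has_derivative[OF Suc.prems that]])
  qed (use Suc in auto)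
qed

lemma Ck_on_add:
  assumes "open U" "Ck_on k f U" "Ck_on k g U"
  shows "Ck_on k (\<lambda>x. f x + g x) U"
  using assms(2,3)
proof (induction k arbitrary: f g)
  case 0
  then show ?case by (auto intro: continuous_on_add)
next
  case (Suc k)
  show ?case
  proof (rule Ck_on_SucI[OF \<open>open U\<close> has_derivative_add])
    show "(f has_derivative frechet_derivative f (at x)) (at x)"
      "(g has_derivative frechet_derivative g (at x)) (at x)" if "x \<in> U" for x
      using Suc.prems that by (auto intro: Ck_on_Suc_has_derivative simp del: Ck_on.simps)
  qed (use Suc in auto)
qed

lemma Ck_on_bounded_bilinear:
  assumes "open U" "bounded_bilinear B" "Ck_on k f U" "Ck_on k g U"
  shows "Ck_on k (\<lambda>x. B (f x) (g x)) U"
  using assms(3,4)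
proof (induction k arbitrary: f g)
  case 0
  then show ?case using bounded_bilinear.continuous_on[OF assms(2)] by auto
next
  case (Suc k)
  show ?case
  proof (rule Ck_on_SucI[OF \<open>open U\<close> bounded_bilinear.FDERIV[OF assms(2)]])
    show "Ck_on k (\<lambda>x. B (f x) (frechet_derivative g (at x) v)
                     + B (frechet_derivative f (at x) v) (g x)) U" for v
      using Suc.prems Suc.prems[THEN Ck_on_SucD] by (intro Ck_on_add assms(1) Suc.IH) auto
    show "(f has_derivative frechet_derivative f (at x)) (at x)"
      "(g has_derivative frechet_derivative g (at x)) (at x)" if "x \<in> U" for x
      using Suc.prems that by (auto intro: Ck_on_Suc_has_derivative simp del: Ck_on.simps)
  qed
qed

lemma Ck_on_sum:
  assumes "open U" "finite I" "\<And>i. i \<in> I \<Longrightarrow> Ck_on k (f i) U"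
  shows "Ck_on k (\<lambda>x. \<Sum>i\<in>I. f i x) U"
  using assms(2,3)
  by (induction I rule: finite_induct) (auto intro: Ck_on_add Ck_on_const assms(1))

lemma Ck_on_compose:
  assumes "open U" "Ck_on k g V" "Ck_on k f U" "f ` U \<subseteq> V"
  shows "Ck_on k (\<lambda>x. g (f x)) U"
  using assms(2,3)
proof (induction k arbitrary: g)
  case 0
  then show ?case using assms(4) by (auto intro: continuous_on_compose2)
next
  case (Suc k)
  have lin: "linear (frechet_derivative g (at (f x)))" if "x \<in> U" for x
    using Suc.prems(1) assms(4) that by (auto intro!: linear_frechet_derivative)
  show ?case
  proof (rule Ck_on_SucI[OF \<open>open U\<close>])
    fix x assume "x \<in> U"
    have "((\<lambda>x. g (f x)) has_derivative
        (\<lambda>v. frechet_derivative g (at (f x)) (frechet_derivative f (at x) v))) (at x)"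
      using Suc.prems \<open>x \<in> U\<close> assms(4)
      by (intro has_derivative_compose[where g = g and f = f]) (auto simp: Ck_on_Suc_has_derivative)
    \<comment> \<open>\<open>Ck_on\<close> controls derivatives in a fixed direction only, whereas
      the direction \<open>frechet_derivative f (at x) v\<close> varies with \<open>x\<close>.
      Expanding it in \<open>Basis\<close> leaves fixed directions \<open>b\<close> with varying
      coefficients, to which the induction hypothesis applies.\<close>
    also have "(\<lambda>v. frechet_derivative g (at (f x)) (frechet_derivative f (at x) v)) =
        (\<lambda>v. \<Sum>b\<in>Basis. (frechet_derivative f (at x) v \<bullet> b) *\<^sub>R frechet_derivative g (at (f x)) b)"
    proof
      fix v
      let ?w = "frechet_derivative f (at x) v"
      have "frechet_derivative g (at (f x)) ?w =
          frechet_derivative g (at (f x)) (\<Sum>b\<in>Basis. (?w \<bullet> b) *\<^sub>R b)"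
        by (simp add: euclidean_representation)
      then show "frechet_derivative g (at (f x)) ?w =
        (\<Sum>b\<in>Basis. (?w \<bullet> b) *\<^sub>R frechet_derivative g (at (f x)) b)"
        by (simp add: linear_sum[OF lin[OF \<open>x \<in> U\<close>]] linear_cmul[OF lin[OF \<open>x \<in> U\<close>]])
    qed
    finally show "((\<lambda>x. g (f x)) has_derivative
        (\<lambda>v. \<Sum>b\<in>Basis. (frechet_derivative f (at x) v \<bullet> b) *\<^sub>R frechet_derivative g (at (f x)) b)) (at x)" .
  next
    fix v
    have f: "Ck_on k f U" using Suc.prems(2) by (rule Ck_on_SucD)
    show "Ck_on k (\<lambda>x. \<Sum>b\<in>Basis. (frechet_derivative f (at x) v \<bullet> b) *\<^sub>R
                       frechet_derivative g (at (f x)) b) U"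
    proof (intro Ck_on_sum \<open>open U\<close> finite_Basis
        Ck_on_bounded_bilinear[OF _ bounded_bilinear_scaleR])
      fix b :: 'b
      show "Ck_on k (\<lambda>x. frechet_derivative f (at x) v \<bullet> b) U"
        using Suc.prems(2)
        by (intro Ck_on_bounded_linear[OF \<open>open U\<close> bounded_linear_inner_left]) auto
      show "Ck_on k (\<lambda>x. frechet_derivative g (at (f x)) b) U"
        using Suc.prems(1) f by (intro Suc.IH) auto
    qed
  qed
qed

lemma bounded_linear_Pair_left: "bounded_linear (\<lambda>x. (x, 0))"
  and bounded_linear_Pair_right: "bounded_linear (\<lambda>y. (0, y))"
  by (simp_all add: bounded_linear_Pair bounded_linear_ident bounded_linear_zero)

lemma Ck_on_Pair:
  assumes "open U" "Ck_on k f U" "Ck_on k g U"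
  shows "Ck_on k (\<lambda>x. (f x, g x)) U"
proof -
  have "Ck_on k (\<lambda>x. (f x, 0) + (0, g x)) U"
    by (intro Ck_on_add assms(1) Ck_on_bounded_linear[OF assms(1) bounded_linear_Pair_left assms(2)]
        Ck_on_bounded_linear[OF assms(1) bounded_linear_Pair_right assms(3)])
  then show ?thesis by simp
qed

lemma Ck_on_mult:
  fixes f g :: "'a::euclidean_space \<Rightarrow> real"
  shows "open U \<Longrightarrow> Ck_on k f U \<Longrightarrow> Ck_on k g U \<Longrightarrow> Ck_on k (\<lambda>x. f x * g x) U"
  by (rule Ck_on_bounded_bilinear[OF _ bounded_bilinear_mult])

section \<open>Smooth functions of one real variable: reciprocal, flat functions, inverse
  functions\<close>

lemma Ck_on_inverse: "Ck_on k (inverse :: real \<Rightarrow> real) {0<..}"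
proof (induction k)
  case 0
  then show ?case by (auto intro!: continuous_intros)
next
  case (Suc k)
  show ?case
  proof (rule Ck_on_SucI[OF open_greaterThan])
    show "(inverse has_derivative (\<lambda>v. - (inverse x * v * inverse x))) (at x)"
      if "x \<in> {0<..}" for x :: real
      using that by (auto intro!: derivative_eq_intros)
    \<comment> \<open>The derivative is a polynomial in \<open>inverse\<close> itself, so the
      induction hypothesis suffices.\<close>
    have "Ck_on k (\<lambda>x. (inverse x * inverse x) * (- v)) {0<..}" for v :: real
      by (intro Ck_on_mult Suc open_greaterThan Ck_on_const)
    then show "Ck_on k (\<lambda>x. - (inverse x * v * inverse x)) {0<..}" for v :: real
      by (simp add: algebra_simps)
  qed
qed

lemma Ck_on_real_SucI:
  fixes f :: "real \<Rightarrow> real"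
  assumes "open U" "\<And>x. x \<in> U \<Longrightarrow> (f has_real_derivative f' x) (at x)" "Ck_on k f' U"
  shows "Ck_on (Suc k) f U"
  by (rule Ck_on_SucI[where F = "\<lambda>x v. f' x * v", OF assms(1)])
     (use assms in \<open>auto simp: has_field_derivative_def intro!: Ck_on_mult Ck_on_const\<close>)

lemma Ck_on_real_SucD:
  fixes f :: "real \<Rightarrow> real"
  assumes "open U" "Ck_on (Suc k) f U"
  shows "\<And>x. x \<in> U \<Longrightarrow> (f has_real_derivative deriv f x) (at x)" "Ck_on k (deriv f) U"
proof -
  show D: "(f has_real_derivative deriv f x) (at x)" if "x \<in> U" for x
    using assms(2) that
    by (metis Ck_on.simps(2) DERIV_imp_deriv real_differentiable_def)
  have "frechet_derivative f (at x) 1 = deriv f x" if "x \<in> U" for x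
    using D[OF that] by (metis frechet_derivative_at has_field_derivative_def mult.right_neutral)
  moreover have "Ck_on k (\<lambda>x. frechet_derivative f (at x) 1) U" using assms(2) by simp
  ultimately show "Ck_on k (deriv f) U"
    by (subst Ck_on_cong[OF assms(1), where g = "\<lambda>x. frechet_derivative f (at x) 1"]) auto
qed

text \<open>The family \<open>x\<^sup>-\<^sup>n exp (- 1 / x)\<close> is, up to linear combinations, closed under
  differentiation.\<close>

definition flat_fun :: "nat \<Rightarrow> real \<Rightarrow> real" where
  "flat_fun n x = (if 0 < x then inverse x ^ n * exp (- inverse x) else 0)"

text \<open>With \<open>y = inverse x\<close> this is the decay of \<open>y ^ n / exp y\<close> at
  infinity.\<close>

lemma flat_fun_tendsto_0: "(flat_fun n \<longlongrightarrow> 0) (at_right 0)"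
proof -
  have "((\<lambda>y::real. y ^ n / exp y) \<longlongrightarrow> 0) at_top" by (rule tendsto_power_div_exp_0)
  then have "((\<lambda>x. inverse x ^ n / exp (inverse x)) \<longlongrightarrow> (0::real)) (at_right 0)"
    by (rule filterlim_compose) (rule filterlim_inverse_at_top_right)
  then show ?thesis
    by (rule Lim_transform_eventually)
       (auto simp: flat_fun_def eventually_at_filter exp_minus divide_inverse)
qed

lemma flat_fun_derivative:
  "(flat_fun n has_real_derivative flat_fun (n + 2) x - real n * flat_fun (n + 1) x) (at x)"
proof (cases x "0::real" rule: linorder_cases)
  case less
  have "((\<lambda>_. 0) has_real_derivative 0) (at x)" by simp
  then have "(flat_fun n has_real_derivative 0) (at x)"
    by (rule has_field_derivative_transform_within_open[where S = "{..<0}"])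
       (use less in \<open>auto simp: flat_fun_def\<close>)
  then show ?thesis using less by (simp add: flat_fun_def)
next
  case greater
  have "((\<lambda>x. inverse x ^ n * exp (- inverse x)) has_real_derivative
       inverse x ^ n * (exp (- inverse x) * (inverse x * inverse x))
       + real n * inverse x ^ (n - 1) * (- (inverse x * inverse x)) * exp (- inverse x)) (at x)"
    using greater by (auto intro!: derivative_eq_intros simp: power2_eq_square)
  moreover have "inverse x ^ n * (exp (- inverse x) * (inverse x * inverse x))
       + real n * inverse x ^ (n - 1) * (- (inverse x * inverse x)) * exp (- inverse x)
     = flat_fun (n + 2) x - real n * flat_fun (n + 1) x"
    \<comment> \<open>For \<open>n = 0\<close> the truncated exponent \<open>n - 1\<close> does no
      harm, because the factor \<open>real n\<close> vanishes.\<close>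
    using greater by (cases n) (auto simp: flat_fun_def power2_eq_square algebra_simps)
  ultimately have "((\<lambda>x. inverse x ^ n * exp (- inverse x)) has_real_derivative
      flat_fun (n + 2) x - real n * flat_fun (n + 1) x) (at x)"
    by simp
  then show ?thesis
    by (rule has_field_derivative_transform_within_open[where S = "{0<..}"])
       (use greater in \<open>auto simp: flat_fun_def\<close>)
next
  case equal
  \<comment> \<open>At the origin the difference quotient of \<open>flat_fun n\<close> from the
    right is \<open>flat_fun (Suc n)\<close>, which tends to 0; from the left it is 0.\<close>
  have "((\<lambda>h. flat_fun n h / h) \<longlongrightarrow> 0) (at_right 0)"
    by (rule Lim_transform_eventually[OF flat_fun_tendsto_0[of "Suc n"]])
       (auto simp: flat_fun_def eventually_at_filter divide_inverse)
  moreover have "((\<lambda>h. flat_fun n h / h) \<longlongrightarrow> 0) (at_left 0)"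
    by (rule Lim_transform_eventually[OF tendsto_const])
       (auto simp: flat_fun_def eventually_at_filter)
  ultimately have "((\<lambda>h. flat_fun n h / h) \<longlongrightarrow> 0) (at 0)"
    by (simp add: filterlim_split_at)
  then have "(flat_fun n has_real_derivative 0) (at 0)"
    by (simp add: DERIV_def flat_fun_def)
  then show ?thesis using equal by (simp add: flat_fun_def)
qed

lemma Ck_on_flat_fun: "Ck_on k (flat_fun n) UNIV"
proof (induction k arbitrary: n)
  case 0
  then show ?case
    using flat_fun_derivative by (auto intro!: DERIV_continuous_on)
next
  case (Suc k)
  have "Ck_on k (\<lambda>x. flat_fun (n + 2) x + (- real n) * flat_fun (n + 1) x) UNIV"
    by (intro Ck_on_add Ck_on_mult Ck_on_const Suc open_UNIV)
  then show ?case
    by (intro Ck_on_real_SucI[OF open_UNIV flat_fun_derivative]) simp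
qed

text \<open>The derivative of the inverse is the reciprocal of \<open>deriv u\<close>, evaluated at
  the inverse, so smoothness of order \<open>k\<close> yields order \<open>Suc k\<close>. The
  induction starts from continuity, which is invariance of domain.\<close>

lemma Ck_on_inv:
  fixes u :: "real \<Rightarrow> real"
  assumes "\<And>k. Ck_on k u UNIV" and pos: "\<And>x. 0 < deriv u x"
  shows "inj u" "open (range u)" "Ck_on k (inv_into UNIV u) (range u)"
proof -
  have D: "(u has_real_derivative deriv u x) (at x)" for x
    using Ck_on_real_SucD(1)[OF open_UNIV assms(1)] by blast
  have "strict_mono u"
    using D pos by (intro strict_monoI) (metis DERIV_pos_imp_increasing)
  then show inj: "inj u" by (rule strict_mono_imp_inj_on)
  have contu: "continuous_on UNIV u" using assms(1)[of 0] by simp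
  show op: "open (range u)" using invariance_of_domain[OF contu open_UNIV inj] .
  \<comment> \<open>Invariance of domain supplies some continuous inverse \<open>w\<close>;
    injectivity identifies it with \<open>inv_into\<close>.\<close>
  obtain w where "homeomorphism UNIV (range u) u w"
    using invariance_of_domain_homeomorphism[OF open_UNIV contu _ inj] by auto
  then have "continuous_on (range u) w" "\<And>x. w (u x) = x"
    by (auto simp: homeomorphism_def)
  then have cont: "continuous_on (range u) (inv_into UNIV u)"
    using inj by (subst continuous_on_cong[where g = w]) auto
  have Dinv: "(inv_into UNIV u has_real_derivative inverse (deriv u (inv_into UNIV u y))) (at y)" if "y \<in> range u" for y
  proof -
    obtain e where e: "0 < e" "ball y e \<subseteq> range u" using op \<open>y \<in> range u\<close> by (meson open_contains_ball)
    show ?thesis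
    proof (rule DERIV_inverse_function[where a = "y - e" and b = "y + e"])
      show "(u has_real_derivative deriv u (inv_into UNIV u y)) (at (inv_into UNIV u y))" by (rule D)
      show "deriv u (inv_into UNIV u y) \<noteq> 0" using pos by (metis less_irrefl)
      show "u (inv_into UNIV u z) = z" if "y - e < z" "z < y + e" for z
        using that e(2) by (intro f_inv_into_f) (auto simp: dist_real_def)
      show "isCont (inv_into UNIV u) y" using cont op that continuous_on_eq_continuous_at by blast
    qed (use e in auto)
  qed
  show "Ck_on k (inv_into UNIV u) (range u)"
  proof (induction k)
    case 0
    then show ?case using cont by simp
  next
    case (Suc k)
    have "Ck_on k (\<lambda>y. deriv u (inv_into UNIV u y)) (range u)"
      by (rule Ck_on_compose[OF op Ck_on_real_SucD(2)[OF open_UNIV assms(1)] Suc]) simp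
    then have "Ck_on k (\<lambda>y. inverse (deriv u (inv_into UNIV u y))) (range u)"
      by (rule Ck_on_compose[OF op Ck_on_inverse]) (use pos in auto)
    then show ?case using Dinv op by (intro Ck_on_real_SucI) auto
  qed
qed

section \<open>Smooth maps and orientation\<close>

lemma smooth_mapI:
  assumes "\<And>x. x \<in> X \<Longrightarrow> \<exists>U g. open U \<and> x \<in> U \<and> (\<forall>k. Ck_on k g U) \<and> (\<forall>y\<in>X \<inter> U. g y = f y)"
  shows "smooth_map X f"
  using assms unfolding smooth_map_def by blast

lemma smooth_mapE:
  assumes "smooth_map X f" "x \<in> X"
  obtains U g where "open U" "x \<in> U" "\<And>k. Ck_on k g U" "\<And>y. y \<in> X \<Longrightarrow> y \<in> U \<Longrightarrow> g y = f y"
  using assms unfolding smooth_map_def by (metis IntI)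

lemma smooth_map_subset:
  assumes "smooth_map X f" "Y \<subseteq> X" shows "smooth_map Y f"
proof (rule smooth_mapI)
  fix x assume "x \<in> Y"
  then obtain U g where "open U" "x \<in> U" "\<And>k. Ck_on k g U" "\<And>y. y \<in> X \<Longrightarrow> y \<in> U \<Longrightarrow> g y = f y"
    using assms smooth_mapE by blast
  then show "\<exists>U g. open U \<and> x \<in> U \<and> (\<forall>k. Ck_on k g U) \<and> (\<forall>y\<in>Y \<inter> U. g y = f y)"
    using assms(2) by (intro exI[of _ U] exI[of _ g]) auto
qed

lemma smooth_map_Ck: "open U \<Longrightarrow> (\<And>k. Ck_on k f U) \<Longrightarrow> X \<subseteq> U \<Longrightarrow> smooth_map X f"
  by (rule smooth_mapI) auto

lemma smooth_map_cong:
  assumes "X = Y" "\<And>x. x \<in> Y \<Longrightarrow> f x = g x"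
  shows "smooth_map X f \<longleftrightarrow> smooth_map Y g"
  using assms unfolding smooth_map_def by auto

lemma smooth_map_local:
  assumes "\<And>x. x \<in> X \<Longrightarrow> \<exists>V. open V \<and> x \<in> V \<and> smooth_map (X \<inter> V) f"
  shows "smooth_map X f"
proof (rule smooth_mapI)
  fix x assume x: "x \<in> X"
  obtain V where V: "open V" "x \<in> V" "smooth_map (X \<inter> V) f" using assms[OF x] by blast
  then obtain U g where "open U" "x \<in> U" "\<And>k. Ck_on k g U"
    "\<And>y. y \<in> X \<inter> V \<Longrightarrow> y \<in> U \<Longrightarrow> g y = f y"
    using x by (metis IntI smooth_mapE)
  then show "\<exists>U g. open U \<and> x \<in> U \<and> (\<forall>k. Ck_on k g U) \<and> (\<forall>y\<in>X \<inter> U. g y = f y)"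
    using V by (intro exI[of _ "U \<inter> V"] exI[of _ g]) (auto intro: Ck_on_subset)
qed

lemma smooth_map_openin_Un:
  assumes "openin (top_of_set Z) X" "openin (top_of_set Z) Y" "Z \<subseteq> X \<union> Y"
    "smooth_map X f" "smooth_map Y f"
  shows "smooth_map Z f"
proof (rule smooth_map_local)
  fix x assume "x \<in> Z"
  obtain U V where UV: "open U" "X = Z \<inter> U" "open V" "Y = Z \<inter> V"
    using assms(1,2) by (metis openin_open)
  then show "\<exists>V. open V \<and> x \<in> V \<and> smooth_map (Z \<inter> V) f"
    using assms \<open>x \<in> Z\<close> by blast
qed

text \<open>Disjoint closed sets are relatively open in their union, so the two pieces can be
  treated locally.\<close>

lemma smooth_map_closed_Un:
  assumes "closed X" "closed Y" "X \<inter> Y = {}" "smooth_map X f" "smooth_map Y f"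
  shows "smooth_map (X \<union> Y) f"
proof (rule smooth_map_openin_Un)
  have "X = (X \<union> Y) \<inter> - Y" "Y = (X \<union> Y) \<inter> - X" using assms(3) by auto
  then show "openin (top_of_set (X \<union> Y)) X" "openin (top_of_set (X \<union> Y)) Y"
    using assms(1,2) by (metis openin_open open_Compl)+
qed (use assms in auto)

lemma smooth_map_continuous:
  assumes "smooth_map X f" shows "continuous_on X f"
  unfolding continuous_on_eq_continuous_within
proof
  fix x assume x: "x \<in> X"
  then obtain U g where U: "open U" "x \<in> U" "\<And>k. Ck_on k g U" "\<And>y. y \<in> X \<Longrightarrow> y \<in> U \<Longrightarrow> g y = f y"
    using assms by (metis smooth_mapE)
  have "continuous (at x) g"
    using U(1,2) U(3)[of 0] by (simp add: continuous_on_eq_continuous_at)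
  then have "continuous (at x within X) g" by (rule continuous_at_imp_continuous_within)
  moreover have "\<forall>\<^sub>F y in at x within X. g y = f y"
    using U by (auto simp: eventually_at_topological)
  ultimately show "continuous (at x within X) f"
    using U(4)[OF x U(2)] Lim_transform_eventually unfolding continuous_within by metis
qed

lemma smooth_map_const: "smooth_map X (\<lambda>x. c)"
  by (rule smooth_map_Ck[OF open_UNIV Ck_on_const]) auto

lemma smooth_map_id: "smooth_map X (\<lambda>x. x)"
  by (rule smooth_map_Ck[OF open_UNIV Ck_on_id]) auto

lemma smooth_map_bounded_linear: "bounded_linear f \<Longrightarrow> smooth_map X f"
  using Ck_on_bounded_linear[OF open_UNIV _ Ck_on_id[OF open_UNIV], of f]
  by (intro smooth_map_Ck[OF open_UNIV]) auto

lemma smooth_map_compose: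
  assumes "smooth_map X f" "smooth_map Y g" "f ` X \<subseteq> Y"
  shows "smooth_map X (\<lambda>x. g (f x))"
proof (rule smooth_mapI)
  fix x assume x: "x \<in> X"
  obtain U F where U: "open U" "x \<in> U" "\<And>k. Ck_on k F U" "\<And>y. y \<in> X \<Longrightarrow> y \<in> U \<Longrightarrow> F y = f y"
    using assms(1) x by (rule smooth_mapE) blast
  have "f x \<in> Y" using assms(3) x by auto
  with assms(2) obtain V G where V: "open V" "f x \<in> V" "\<And>k. Ck_on k G V"
    "\<And>y. y \<in> Y \<Longrightarrow> y \<in> V \<Longrightarrow> G y = g y"
    by (rule smooth_mapE) blast
  \<comment> \<open>The domain is cut down by the extension \<open>F\<close> rather than by
    \<open>f\<close>: a map continuous on an open set has open preimages of open sets.\<close>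
  have op: "open (U \<inter> F -` V)"
    using U(3)[of 0] U(1) V(1) by (intro continuous_open_preimage) auto
  have F: "Ck_on k F (U \<inter> F -` V)" for k using U(3) Ck_on_subset by blast
  show "\<exists>U h. open U \<and> x \<in> U \<and> (\<forall>k. Ck_on k h U) \<and> (\<forall>y\<in>X \<inter> U. h y = g (f y))"
  proof (intro exI conjI allI ballI)
    show "Ck_on k (\<lambda>y. G (F y)) (U \<inter> F -` V)" for k
      by (rule Ck_on_compose[OF op V(3) F]) auto
    show "x \<in> U \<inter> F -` V" using U V x by auto
    show "G (F y) = g (f y)" if "y \<in> X \<inter> (U \<inter> F -` V)" for y
      using that U(4)[of y] V(4)[of "f y"] assms(3) by auto
  qed (rule op)
qed

lemma smooth_map_Pair:
  assumes "smooth_map X f" "smooth_map X g"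
  shows "smooth_map X (\<lambda>x. (f x, g x))"
proof (rule smooth_mapI)
  fix x assume x: "x \<in> X"
  obtain U F where U: "open U" "x \<in> U" "\<And>k. Ck_on k F U" "\<And>y. y \<in> X \<Longrightarrow> y \<in> U \<Longrightarrow> F y = f y"
    using assms(1) x by (rule smooth_mapE) blast
  obtain V G where V: "open V" "x \<in> V" "\<And>k. Ck_on k G V" "\<And>y. y \<in> X \<Longrightarrow> y \<in> V \<Longrightarrow> G y = g y"
    using assms(2) x by (rule smooth_mapE) blast
  show "\<exists>U h. open U \<and> x \<in> U \<and> (\<forall>k. Ck_on k h U) \<and> (\<forall>y\<in>X \<inter> U. h y = (f y, g y))"
    using U V
    by (intro exI[of _ "U \<inter> V"] exI[of _ "\<lambda>y. (F y, G y)"])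
       (auto intro!: Ck_on_Pair intro: Ck_on_subset[OF U(3)] Ck_on_subset[OF V(3)])
qed

lemma smooth_map_fst: "smooth_map X f \<Longrightarrow> smooth_map X (\<lambda>x. fst (f x))"
  by (rule smooth_map_compose[where Y = UNIV])
     (auto intro: smooth_map_bounded_linear bounded_linear_fst)

lemma smooth_map_snd: "smooth_map X f \<Longrightarrow> smooth_map X (\<lambda>x. snd (f x))"
  by (rule smooth_map_compose[where Y = UNIV])
     (auto intro: smooth_map_bounded_linear bounded_linear_snd)

lemma smooth_map_add:
  assumes "smooth_map X f" "smooth_map X g" shows "smooth_map X (\<lambda>x. f x + g x)"
proof -
  have "bounded_linear (\<lambda>p :: 'b \<times> 'b. fst p + snd p)"
    by (intro bounded_linear_add bounded_linear_fst bounded_linear_snd)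
  from smooth_map_compose[OF smooth_map_Pair[OF assms] smooth_map_bounded_linear[OF this, of UNIV]]
  show ?thesis by simp
qed

lemma smooth_map_scaleR:
  assumes "smooth_map X f" "smooth_map X g" shows "smooth_map X (\<lambda>x. f x *\<^sub>R g x)"
proof -
  have "Ck_on k (\<lambda>p :: real \<times> 'b. fst p *\<^sub>R snd p) UNIV" for k
    by (intro Ck_on_bounded_bilinear[OF _ bounded_bilinear_scaleR] open_UNIV
        Ck_on_bounded_linear[OF _ bounded_linear_fst] Ck_on_bounded_linear[OF _ bounded_linear_snd] Ck_on_id)
  from smooth_map_compose[OF smooth_map_Pair[OF assms] smooth_map_Ck[OF open_UNIV this, of UNIV]]
  show ?thesis by simp
qed

lemma smooth_map_mult:
  fixes f g :: "'a::euclidean_space \<Rightarrow> real"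
  shows "smooth_map X f \<Longrightarrow> smooth_map X g \<Longrightarrow> smooth_map X (\<lambda>x. f x * g x)"
  using smooth_map_scaleR[of X f g] by simp

lemma smooth_map_diff:
  assumes "smooth_map X f" "smooth_map X g" shows "smooth_map X (\<lambda>x. f x - g x)"
  using smooth_map_add[OF assms(1) smooth_map_scaleR[OF smooth_map_const[of X "- 1 :: real"] assms(2)]]
  by simp

section \<open>Smooth embeddings\<close>

lemma smooth_emb_smooth: "smooth_emb X Y f \<Longrightarrow> smooth_map X f"
  and smooth_emb_into: "smooth_emb X Y f \<Longrightarrow> f ` X \<subseteq> Y"
  and smooth_emb_inj: "smooth_emb X Y f \<Longrightarrow> inj_on f X"
  and smooth_emb_inverse: "smooth_emb X Y f \<Longrightarrow> smooth_map (f ` X) (inv_into X f)"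
  by (simp_all add: smooth_emb_def)

text \<open>Any smooth left inverse on the image will do; it agrees there with
  \<open>inv_into\<close>, the form in which \<open>smooth_emb\<close> is phrased.\<close>

lemma smooth_embI:
  assumes "smooth_map X f" "f ` X \<subseteq> Y" "smooth_map (f ` X) g" "\<And>x. x \<in> X \<Longrightarrow> g (f x) = x"
  shows "smooth_emb X Y f"
proof -
  have inj: "inj_on f X" using assms(4) by (metis inj_onI)
  have "inv_into X f y = g y" if "y \<in> f ` X" for y
    using that assms(4) by (auto simp: inv_into_f_f[OF inj])
  then show ?thesis
    using assms inj smooth_map_cong[of "f ` X" "f ` X" "inv_into X f" g] by (simp add: smooth_emb_def)
qed

lemma smooth_emb_mono: "smooth_emb X Y f \<Longrightarrow> Y \<subseteq> Z \<Longrightarrow> smooth_emb X Z f"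
  by (auto simp: smooth_emb_def)

lemma smooth_emb_subset:
  assumes "smooth_emb X Y f" "X' \<subseteq> X" shows "smooth_emb X' Y f"
proof (rule smooth_embI[where g = "inv_into X f"])
  show "smooth_map (f ` X') (inv_into X f)"
    using smooth_emb_inverse[OF assms(1)] by (rule smooth_map_subset) (use assms(2) in auto)
qed (use assms smooth_map_subset[of X f X'] in \<open>auto simp: smooth_emb_def\<close>)

lemma smooth_emb_into_subset: "smooth_emb X Y f \<Longrightarrow> f ` X \<subseteq> Z \<Longrightarrow> smooth_emb X Z f"
  by (simp add: smooth_emb_def)

lemma smooth_emb_cong:
  assumes "\<And>x. x \<in> X \<Longrightarrow> f x = g x" "smooth_emb X Y f"
  shows "smooth_emb X Y g"
proof (rule smooth_embI[where g = "inv_into X f"])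
  have "f ` X = g ` X" using assms(1) by auto
  then show "smooth_map (g ` X) (inv_into X f)" "g ` X \<subseteq> Y"
    using assms(2) by (auto simp: smooth_emb_def)
  show "smooth_map X g" using assms smooth_map_cong[of X X f g] by (auto simp: smooth_emb_def)
  show "inv_into X f (g x) = x" if "x \<in> X" for x
    using assms that by (metis inv_into_f_f smooth_emb_inj)
qed

lemma smooth_emb_id: "X \<subseteq> Y \<Longrightarrow> smooth_emb X Y (\<lambda>x. x)"
  by (rule smooth_embI[where g = "\<lambda>x. x"]) (auto intro: smooth_map_id)

lemma smooth_emb_compose:
  assumes "smooth_emb X Y f" "smooth_emb Y Z g"
  shows "smooth_emb X Z (g \<circ> f)"
proof (rule smooth_embI[where g = "\<lambda>z. inv_into X f (inv_into Y g z)"])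
  note f = assms(1)[unfolded smooth_emb_def] and g = assms(2)[unfolded smooth_emb_def]
  show "smooth_map X (g \<circ> f)" unfolding o_def using f g by (intro smooth_map_compose[of X f Y g]) auto
  have sub: "(g \<circ> f) ` X \<subseteq> g ` Y" using f by auto
  have inv: "inv_into Y g (g (f x)) = f x" if "x \<in> X" for x
    using that f g by (auto intro: inv_into_f_f)
  show "smooth_map ((g \<circ> f) ` X) (\<lambda>z. inv_into X f (inv_into Y g z))"
    by (rule smooth_map_compose[OF smooth_map_subset[OF _ sub]]) (use f g inv in auto)
  show "inv_into X f (inv_into Y g ((g \<circ> f) x)) = x" if "x \<in> X" for x
    using that inv f by auto
qed (use assms in \<open>auto simp: smooth_emb_def\<close>)

lemma smooth_emb_inv_into:
  assumes "smooth_emb X Y f" shows "smooth_emb (f ` X) X (inv_into X f)"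
  using assms
  by (intro smooth_embI[where g = f])
     (auto simp: smooth_emb_def f_inv_into_f inv_into_into image_image
       intro: smooth_map_subset)

lemma smooth_emb_continuous: "smooth_emb X Y f \<Longrightarrow> continuous_on X f"
  by (simp add: smooth_emb_def smooth_map_continuous)

text \<open>On an open set the local extension coincides with \<open>f\<close> near
  \<open>x\<close>, so smoothness in the sense of extensions gives a genuine derivative.\<close>

lemma smooth_map_open_has_derivative:
  assumes "open U" "smooth_map U f" "x \<in> U"
  shows "(f has_derivative frechet_derivative f (at x)) (at x)"
proof -
  obtain V g where V: "open V" "x \<in> V" "\<And>k. Ck_on k g V" "\<And>y. y \<in> U \<Longrightarrow> y \<in> V \<Longrightarrow> g y = f y"
    using assms(2,3) by (rule smooth_mapE) blast
  have "(g has_derivative frechet_derivative g (at x)) (at x)"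
    using V(3) V(2) by (rule Ck_on_Suc_has_derivative)
  then have "(f has_derivative frechet_derivative g (at x)) (at x)"
    by (rule has_derivative_transform_within_open[OF _ open_Int[OF assms(1) V(1)]]) (use V assms in auto)
  then show ?thesis by (metis frechet_derivative_at)
qed

text \<open>Turns a relatively open target, typically a chart image, into an ambient open set that
  cuts out its preimage; for open \<open>X\<close> this gives a neighbourhood on which to
  differentiate.\<close>

lemma continuous_preimage_openin:
  assumes "continuous_on X f" "f ` X \<subseteq> Y" "openin (top_of_set Y) T"
  obtains V where "open V" "{x \<in> X. f x \<in> T} = X \<inter> V"
proof -
  have "openin (top_of_set X) (X \<inter> f -` T)"
    by (rule continuous_openin_preimage) (use assms in auto)
  then show thesis using that by (auto simp: openin_open vimage_def Int_def)
qed

section \<open>Orientation as the sign of a Jacobian determinant\<close>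

lemma orient_pres_atI:
  "(f has_derivative D) (at x) \<Longrightarrow> 0 < det (matrix D) \<Longrightarrow> orient_pres_at f x"
  unfolding orient_pres_at_def by (metis differentiable_def frechet_derivative_at)

lemma orient_pres_at_cong:
  assumes "open U" "x \<in> U" "\<And>y. y \<in> U \<Longrightarrow> f y = g y" "orient_pres_at f x"
  shows "orient_pres_at g x"
proof -
  have "(f has_derivative frechet_derivative f (at x)) (at x)"
    using assms(4) by (simp add: orient_pres_at_def frechet_derivative_works)
  then have "(g has_derivative frechet_derivative f (at x)) (at x)"
    by (rule has_derivative_transform_within_open[OF _ assms(1,2)]) (rule assms(3))
  then show ?thesis using assms(4) by (intro orient_pres_atI) (auto simp: orient_pres_at_def)
qed

lemma orient_pres_at_compose:
  assumes "orient_pres_at g (f x)" "orient_pres_at f x"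
  shows "orient_pres_at (g \<circ> f) x"
proof (rule orient_pres_atI)
  let ?F = "frechet_derivative f (at x)" and ?G = "frechet_derivative g (at (f x))"
  have F: "(f has_derivative ?F) (at x)" and G: "(g has_derivative ?G) (at (f x))"
    using assms by (simp_all add: orient_pres_at_def frechet_derivative_works)
  show "(g \<circ> f has_derivative ?G \<circ> ?F) (at x)" using F G by (rule diff_chain_at)
  have "linear ?F" "linear ?G" using F G by (auto intro: has_derivative_linear)
  then show "0 < det (matrix (?G \<circ> ?F))"
    using assms by (simp add: matrix_compose det_mul orient_pres_at_def)
qed

lemma orient_pres_at_id: "orient_pres_at (\<lambda>x. x) x"
  by (rule orient_pres_atI[OF has_derivative_ident]) (simp add: matrix_id flip: id_def)

lemma orient_pres_at_translation: "orient_pres_at (\<lambda>x. x + a) x"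
proof (rule orient_pres_atI)
  show "((\<lambda>x. x + a) has_derivative (\<lambda>x. x)) (at x)" by (auto intro!: derivative_eq_intros)
qed (simp add: matrix_id flip: id_def)

text \<open>Invariance of domain makes the image open, so the inverse has a derivative at
  \<open>g x\<close>; by the chain rule it is a left inverse of the derivative of
  \<open>g\<close>.\<close>

lemma smooth_emb_open_det:
  fixes g :: "real^'n \<Rightarrow> real^'n"
  assumes "open B" "smooth_emb B Y g" "x \<in> B"
  shows "det (matrix (frechet_derivative g (at x))) \<noteq> 0"
proof -
  have op: "open (g ` B)"
    using assms by (intro invariance_of_domain) (auto simp: smooth_emb_inj smooth_emb_continuous)
  let ?G = "frechet_derivative g (at x)" and ?h = "inv_into B g"
  have G: "(g has_derivative ?G) (at x)"
    using assms by (intro smooth_map_open_has_derivative[OF assms(1)]) (auto simp: smooth_emb_def)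
  have H: "(?h has_derivative frechet_derivative ?h (at (g x))) (at (g x))"
    using assms by (intro smooth_map_open_has_derivative[OF op]) (auto simp: smooth_emb_def)
  have "(?h \<circ> g has_derivative frechet_derivative ?h (at (g x)) \<circ> ?G) (at x)"
    using G H by (rule diff_chain_at)
  moreover have "(?h \<circ> g has_derivative (\<lambda>v. v)) (at x)"
    by (rule has_derivative_transform_within_open[OF has_derivative_ident assms(1,3)])
       (use smooth_emb_inj[OF assms(2)] in auto)
  ultimately have "frechet_derivative ?h (at (g x)) \<circ> ?G = (\<lambda>v. v)"
    by (rule has_derivative_unique)
  then have "inj ?G" by (metis injI o_apply)
  then show ?thesis using det_nz_iff_inj[OF has_derivative_linear[OF G]] by simp
qed

lemma chart_domain:
  assumes "oriented_3manifold M A" "(V, \<eta>) \<in> A"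
  shows "smooth_emb V M \<eta>" "openin (top_of_set M) (\<eta> ` V)"
  using assms by (fastforce simp: oriented_3manifold_def is_chart_def)+

lemma smooth_emb_into_chart:
  assumes "oriented_3manifold M A" "(V, \<eta>) \<in> A" "smooth_emb B M \<phi>" "\<phi> ` B \<subseteq> \<eta> ` V"
  shows "smooth_emb B V (inv_into V \<eta> \<circ> \<phi>)"
  using smooth_emb_into_subset[OF assms(3,4)] smooth_emb_inv_into[OF chart_domain(1)[OF assms(1,2)]]
  by (rule smooth_emb_compose)

text \<open>Invariance of domain rules out boundary points of the chart, where the atlas
  gives no orientation information.\<close>

lemma orient_pres_chart_change:
  assumes M: "oriented_3manifold M A" and B: "open B" "smooth_emb B M \<phi>" "x \<in> B"
    and V: "(V, \<eta>) \<in> A" "\<phi> x \<in> \<eta> ` V" and V': "(V', \<eta>') \<in> A" "\<phi> x \<in> \<eta>' ` V'"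
    and or: "orient_pres_at (inv_into V \<eta> \<circ> \<phi>) x"
  shows "orient_pres_at (inv_into V' \<eta>' \<circ> \<phi>) x"
proof -
  obtain O1 where O1: "open O1" "{x \<in> B. \<phi> x \<in> \<eta> ` V} = B \<inter> O1"
    using continuous_preimage_openin[OF smooth_emb_continuous[OF B(2)] smooth_emb_into[OF B(2)]
        chart_domain(2)[OF M V(1)]] .
  let ?B = "B \<inter> O1"
  have sub: "\<phi> ` ?B \<subseteq> \<eta> ` V" using O1(2) by auto
  have op: "open ?B" and x: "x \<in> ?B" using O1 B V by auto
  have emb: "smooth_emb ?B V (inv_into V \<eta> \<circ> \<phi>)"
    using smooth_emb_subset[OF B(2)] sub by (intro smooth_emb_into_chart[OF M V(1)]) auto
  then have "open ((inv_into V \<eta> \<circ> \<phi>) ` ?B)"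
    by (intro invariance_of_domain op smooth_emb_continuous smooth_emb_inj)
  moreover have "(inv_into V \<eta> \<circ> \<phi>) ` ?B \<subseteq> V" using emb by (rule smooth_emb_into)
  ultimately have "inv_into V \<eta> (\<phi> x) \<in> interior V"
    using x by (metis comp_apply image_eqI interiorI)
  moreover have "\<eta> (inv_into V \<eta> (\<phi> x)) = \<phi> x" using V(2) by (rule f_inv_into_f)
  moreover have "\<forall>(U, \<psi>)\<in>A. \<forall>(V, \<eta>)\<in>A. \<forall>x\<in>interior U.
      \<psi> x \<in> \<eta> ` V \<longrightarrow> orient_pres_at (inv_into V \<eta> \<circ> \<psi>) x"
    using M by (simp add: oriented_3manifold_def)
  ultimately have "orient_pres_at (inv_into V' \<eta>' \<circ> \<eta>) (inv_into V \<eta> (\<phi> x))"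
    using V(1) V' by fastforce
  then have "orient_pres_at ((inv_into V' \<eta>' \<circ> \<eta>) \<circ> (inv_into V \<eta> \<circ> \<phi>)) x"
    using or by (intro orient_pres_at_compose) auto
  then show ?thesis
    by (rule orient_pres_at_cong[OF op x, rotated]) (use sub in \<open>auto simp: f_inv_into_f image_subset_iff\<close>)
qed

text \<open>The pointwise condition inside \<open>oriented_ball\<close>. Isolating a single point
  allows it to be verified on a small neighbourhood, where a map may be given by a simpler
  formula.\<close>

definition pres_orient :: "'a::euclidean_space chart set \<Rightarrow> (real^3 \<Rightarrow> 'a) \<Rightarrow> real^3 \<Rightarrow> bool" where
  "pres_orient A \<phi> x \<longleftrightarrow>
     (\<forall>(V, \<eta>)\<in>A. \<phi> x \<in> \<eta> ` V \<longrightarrow> orient_pres_at (inv_into V \<eta> \<circ> \<phi>) x)"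

lemma oriented_ball_iff:
  "oriented_ball N A \<phi> \<longleftrightarrow> smooth_emb (cball 0 1) N \<phi> \<and> (\<forall>x\<in>ball 0 1. pres_orient A \<phi> x)"
  unfolding oriented_ball_def pres_orient_def by fast

lemma pres_orient_cong:
  assumes "open U" "x \<in> U" "\<And>y. y \<in> U \<Longrightarrow> f y = g y" "pres_orient A f x"
  shows "pres_orient A g x"
  unfolding pres_orient_def
proof (safe)
  fix V \<eta> v assume "(V, \<eta>) \<in> A" and v: "g x = \<eta> v" "v \<in> V"
  then have "orient_pres_at (inv_into V \<eta> \<circ> f) x"
    using assms unfolding pres_orient_def by fastforce
  then show "orient_pres_at (inv_into V \<eta> \<circ> g) x"
    by (rule orient_pres_at_cong[OF assms(1,2), rotated]) (simp add: assms(3))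
qed

text \<open>\<open>pres_orient\<close> quantifies over all charts at \<open>\<phi> x\<close>;
  compatibility of the atlas reduces it to any one of them.\<close>

lemma pres_orient_iff:
  assumes "oriented_3manifold M A" "open B" "smooth_emb B M \<phi>" "x \<in> B" "(V, \<eta>) \<in> A" "\<phi> x \<in> \<eta> ` V"
  shows "pres_orient A \<phi> x \<longleftrightarrow> orient_pres_at (inv_into V \<eta> \<circ> \<phi>) x"
  using assms orient_pres_chart_change[OF assms(1-6)] unfolding pres_orient_def by fast

lemma continuous_on_det_matrix:
  fixes F :: "'a::topological_space \<Rightarrow> real^'n \<Rightarrow> real^'n"
  assumes "\<And>v. continuous_on S (\<lambda>s. F s v)"
  shows "continuous_on S (\<lambda>s. det (matrix (F s)))"
  unfolding det_def matrix_def using assms by (auto intro!: continuous_intros)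

text \<open>Along a smooth family of embeddings, the Jacobian determinant in a chart is continuous and
  never zero.\<close>

lemma pres_orient_isotopy:
  assumes M: "oriented_3manifold M A" and B: "open B" "x \<in> B"
    and H: "smooth_map ({0..1} \<times> B) H" "\<And>s. s \<in> {0..1} \<Longrightarrow> smooth_emb B M (\<lambda>y. H (s, y))"
    and 0: "pres_orient A (\<lambda>y. H (0::real, y)) x"
  shows "pres_orient A (\<lambda>y. H (1, y)) x"
\<comment> \<open>The interval is connected, so it is enough that the orientation is locally
  constant in \<open>s\<close>.\<close>
proof (rule connected_induction_simple[where S = "{0..1}" and P = "\<lambda>s. pres_orient A (\<lambda>y. H (s, y)) x"
      and a = 0])
  fix s0 :: real assume s0: "s0 \<in> {0..1}"
  let ?X = "{0..1} \<times> B"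
  have HM: "H ` ?X \<subseteq> M" using H(2)[THEN smooth_emb_into] by force
  then have "H (s0, x) \<in> M" using s0 B by auto
  moreover have "M \<subseteq> (\<Union>(U, \<psi>)\<in>A. \<psi> ` U)" using M by (simp add: oriented_3manifold_def)
  ultimately obtain V \<eta> where V: "(V, \<eta>) \<in> A" "H (s0, x) \<in> \<eta> ` V" by blast
  note ch = chart_domain[OF M V(1)]
  obtain O1 where O1: "open O1" "{z \<in> ?X. H z \<in> \<eta> ` V} = ?X \<inter> O1"
    using continuous_preimage_openin[OF smooth_map_continuous[OF H(1)] HM ch(2)] .
  have "smooth_map (?X \<inter> O1) (\<lambda>z. inv_into V \<eta> (H z))"
    by (rule smooth_map_compose[OF smooth_map_subset[OF H(1)] smooth_emb_inverse[OF ch(1)]])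
       (use O1(2) in auto)
  moreover have z0: "(s0, x) \<in> ?X \<inter> O1" using O1(2) s0 B V by blast
  ultimately obtain U G where U: "open U" "(s0, x) \<in> U" "\<And>k. Ck_on k G U"
    "\<And>z. z \<in> ?X \<inter> O1 \<Longrightarrow> z \<in> U \<Longrightarrow> G z = inv_into V \<eta> (H z)"
    by (rule smooth_mapE) blast
  \<comment> \<open>\<open>G\<close> extends the family, read in the chart, to an open set around
    \<open>(s0, x)\<close>; \<open>D s\<close> is its derivative in the space directions and
    therefore depends continuously on \<open>s\<close>.\<close>
  define D where "D s = (\<lambda>v. frechet_derivative G (at (s, x)) (0, v))" for s
  define S where "S = {s \<in> {0..1}. (s, x) \<in> U \<inter> O1}"
  have slice: "open ((\<lambda>s. (s, x)) -` (U \<inter> O1))" "open (Pair s -` (U \<inter> O1))" for s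
    using U(1) O1(1) by (auto intro!: open_vimage continuous_intros)
  have contD: "continuous_on ((\<lambda>s. (s, x)) -` (U \<inter> O1)) (\<lambda>s. det (matrix (D s)))"
  proof (rule continuous_on_det_matrix)
    fix v
    have "continuous_on U (\<lambda>z. frechet_derivative G (at z) (0, v))"
      using U(3)[of 1] by simp
    then show "continuous_on ((\<lambda>s. (s, x)) -` (U \<inter> O1)) (\<lambda>s. D s v)"
      unfolding D_def by (rule continuous_on_compose2) (auto intro!: continuous_intros)
  qed
  have key: "(inv_into V \<eta> \<circ> (\<lambda>y. H (s, y)) has_derivative D s) (at x)"
      "pres_orient A (\<lambda>y. H (s, y)) x \<longleftrightarrow> 0 < det (matrix (D s))"
      "det (matrix (D s)) \<noteq> 0" if "s \<in> S" for s
  proof -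
    have s: "s \<in> {0..1}" "(s, x) \<in> U" "(s, x) \<in> O1" using that by (auto simp: S_def)
    let ?B = "B \<inter> Pair s -` (U \<inter> O1)"
    have opB: "open ?B" "x \<in> ?B" using B slice s by (auto simp: open_Int)
    have eq: "G (s, y) = inv_into V \<eta> (H (s, y))" if "y \<in> ?B" for y
      using that s by (intro U(4)) auto
    have "(G has_derivative frechet_derivative G (at (s, x))) (at (s, x))"
      using U(3) s(2) by (rule Ck_on_Suc_has_derivative)
    then have "((\<lambda>y. G (s, y)) has_derivative D s) (at x)"
      unfolding D_def by (rule has_derivative_compose[rotated]) (auto intro!: derivative_eq_intros)
    then show der: "(inv_into V \<eta> \<circ> (\<lambda>y. H (s, y)) has_derivative D s) (at x)"
      by (rule has_derivative_transform_within_open[OF _ opB]) (simp add: eq)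
    have fd: "frechet_derivative (inv_into V \<eta> \<circ> (\<lambda>y. H (s, y))) (at x) = D s"
      using frechet_derivative_at[OF der] by simp
    have "(\<lambda>y. H (s, y)) ` ?B \<subseteq> \<eta> ` V" using O1(2) s by auto
    then have "smooth_emb ?B V (inv_into V \<eta> \<circ> (\<lambda>y. H (s, y)))"
      using smooth_emb_subset[OF H(2)[OF s(1)]] by (intro smooth_emb_into_chart[OF M V(1)]) auto
    from smooth_emb_open_det[OF opB(1) this opB(2)] show "det (matrix (D s)) \<noteq> 0" by (simp add: fd)
    have "H (s, x) \<in> \<eta> ` V" using O1(2) s B by auto
    from pres_orient_iff[OF M B(1) H(2)[OF s(1)] B(2) V(1) this]
    show "pres_orient A (\<lambda>y. H (s, y)) x \<longleftrightarrow> 0 < det (matrix (D s))"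
      using der by (auto simp: orient_pres_at_def fd differentiable_def)
  qed
  let ?W = "(\<lambda>s. (s, x)) -` (U \<inter> O1)"
  \<comment> \<open>Positive exactly where the determinant has the same sign as at
    \<open>s0\<close>.\<close>
  let ?d = "\<lambda>s. det (matrix (D s)) * det (matrix (D s0))"
  have "open (?W \<inter> ?d -` {0<..})"
    using slice(1) by (intro continuous_open_preimage continuous_on_mult_right contD) auto
  moreover have s0S: "s0 \<in> S" using s0 z0 U by (auto simp: S_def)
  then have "0 < ?d s0" using key(3)[of s0] by (auto simp: zero_less_mult_iff)
  ultimately show "\<exists>T. openin (top_of_set {0..1}) T \<and> s0 \<in> T \<and>
      (\<forall>s\<in>T. \<forall>s'\<in>T. pres_orient A (\<lambda>y. H (s, y)) x \<longrightarrow> pres_orient A (\<lambda>y. H (s', y)) x)"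
    using s0 s0S
    by (intro exI[of _ "{0..1} \<inter> (?W \<inter> ?d -` {0<..})"])
       (auto simp: S_def key(2) zero_less_mult_iff)
qed (use 0 in auto)

section \<open>Self-embeddings along the collar\<close>

text \<open>Smoothness and a positive derivative are asked for on the whole line, so that
  \<open>Ck_on_inv\<close> makes the inverse smooth on an open set containing the image of the unit
  interval.\<close>

definition rescaling :: "(real \<Rightarrow> real) \<Rightarrow> bool" where
  "rescaling u \<longleftrightarrow> (\<forall>k. Ck_on k u UNIV) \<and> (\<forall>x. 0 < deriv u x) \<and> u ` {0..1} \<subseteq> {0..1}"

lemma rescalingI:
  assumes "\<And>k. Ck_on k u UNIV" "\<And>x. (u has_real_derivative u' x) (at x)" "\<And>x. 0 < u' x"
    "0 \<le> u 0" "u 1 \<le> 1"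
  shows "rescaling u"
proof -
  have "mono u"
    using assms(2,3) by (intro monoI) (metis DERIV_nonneg_imp_nondecreasing less_imp_le)
  then have "u ` {0..1} \<subseteq> {0..1}"
    using assms(4,5) monoD[of u 0] monoD[of u _ 1] by (force intro: order_trans)
  then show ?thesis using assms DERIV_imp_deriv[OF assms(2)] by (simp add: rescaling_def)
qed

lemma rescaling_derivative: "rescaling u \<Longrightarrow> (u has_real_derivative deriv u x) (at x)"
  unfolding rescaling_def using Ck_on_real_SucD(1)[OF open_UNIV] by blast

lemma rescaling_mono:
  assumes "rescaling u" "x \<le> y" shows "u x \<le> u y"
  using assms rescaling_derivative[OF assms(1)]
  by (metis DERIV_nonneg_imp_nondecreasing less_imp_le rescaling_def)

lemma rescaling_in: "rescaling u \<Longrightarrow> s \<in> {0..1} \<Longrightarrow> u s \<in> {0..1}"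
  unfolding rescaling_def by blast

lemma rescaling_id: "rescaling (\<lambda>s. s)"
  by (rule rescalingI[where u' = "\<lambda>_. 1"]) (auto intro: Ck_on_id)

lemma rescaling_affine:
  assumes "0 < a" "0 \<le> b" "a + b \<le> 1" shows "rescaling (\<lambda>s. a * s + b)"
  using assms
  by (intro rescalingI[where u' = "\<lambda>_. a"])
     (auto intro!: Ck_on_add Ck_on_mult Ck_on_const Ck_on_id derivative_eq_intros)

lemma rescaling_outer: "rescaling (\<lambda>s. s / 3)"
  using rescaling_affine[of "1/3" 0] by simp

lemma rescaling_inner: "rescaling (\<lambda>s. (s + 2) / 3)"
  using rescaling_affine[of "1/3" "2/3"] by (simp add: add_divide_distrib)

text \<open>Rescalings form a convex set, which connects any two of them through rescalings.\<close>

lemma rescaling_convex: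
  assumes "rescaling u" "rescaling v" "s \<in> {0..1}"
  shows "rescaling (\<lambda>x. (1 - s) * u x + s * v x)"
proof (rule rescalingI)
  show "((\<lambda>x. (1 - s) * u x + s * v x) has_real_derivative (1 - s) * deriv u x + s * deriv v x) (at x)"
    for x
    by (rule derivative_eq_intros rescaling_derivative[OF assms(1)] rescaling_derivative[OF assms(2)] refl)+
       simp
  show "0 < (1 - s) * deriv u x + s * deriv v x" for x
  proof (cases "s = 0")
    case False
    then show ?thesis
      using assms by (intro add_nonneg_pos mult_nonneg_nonneg) (auto simp: rescaling_def less_imp_le)
  qed (use assms in \<open>simp add: rescaling_def\<close>)
  show "0 \<le> (1 - s) * u 0 + s * v 0"
    using assms(3) rescaling_in[OF assms(1), of 0] rescaling_in[OF assms(2), of 0] by simp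
  show "(1 - s) * u 1 + s * v 1 \<le> 1"
    using assms(3) rescaling_in[OF assms(1), of 1] rescaling_in[OF assms(2), of 1]
    by (intro convex_bound_le) auto
  show "Ck_on k (\<lambda>x. (1 - s) * u x + s * v x) UNIV" for k
    using assms by (intro Ck_on_add Ck_on_mult Ck_on_const open_UNIV) (auto simp: rescaling_def)
qed

lemma rescaling_smooth_emb:
  assumes "rescaling u" shows "smooth_emb {0..1} {0..1} u"
proof -
  have u: "\<And>k. Ck_on k u UNIV" "\<And>x. 0 < deriv u x" "u ` {0..1} \<subseteq> {0..1}"
    using assms by (auto simp: rescaling_def)
  show ?thesis
  proof (rule smooth_embI[where g = "inv_into UNIV u"])
    show "smooth_map {0..1} u" using u(1) by (rule smooth_map_Ck[OF open_UNIV]) simp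
    show "smooth_map (u ` {0..1}) (inv_into UNIV u)"
      by (rule smooth_map_Ck[OF Ck_on_inv(2,3)[OF u(1,2)]]) auto
    show "inv_into UNIV u (u x) = x" for x
      using Ck_on_inv(1)[OF u(1,2)] by simp
  qed (rule u(3))
qed

text \<open>Pushes the collar off its outer third and is the identity near its inner boundary.\<close>

definition push_fun :: "real \<Rightarrow> real" where
  "push_fun s = s + 3/2 * flat_fun 0 (3/4 - s)"

lemma push_fun_inner: "3/4 \<le> s \<Longrightarrow> push_fun s = s"
  by (simp add: push_fun_def flat_fun_def)

text \<open>With \<open>z = inverse x\<close> the maximum of \<open>z\<^sup>2 * exp (- z)\<close> is
  4/(e*e), about 0.54. The bound 2/3 is the reciprocal of the coefficient 3/2 in
  \<open>push_fun\<close>, so it says that the slope of \<open>push_fun\<close> is positive.\<close>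

lemma flat_fun_2_less: "flat_fun 2 x < 2/3"
proof (cases "0 < x")
  case True
  define z where "z = inverse x"
  have z: "0 < z" using True by (simp add: z_def)
  \<comment> \<open>Since \<open>exp (z / 2) = exp 1 * exp (z / 2 - 1)\<close>, the two estimates
    give \<open>5/4 * z \<le> exp (z / 2)\<close>; squaring bounds the product by 16/25, which is
    below 2/3.\<close>
  have "5/2 \<le> exp (1::real)" using exp_lower_Taylor_quadratic[of 1] by simp
  moreover have "z / 2 \<le> exp (z / 2 - 1)" using exp_ge_add_one_self[of "z / 2 - 1"] by simp
  ultimately have "5/2 * (z / 2) \<le> exp 1 * exp (z / 2 - 1)" using z by (intro mult_mono) auto
  also have "\<dots> = exp (z / 2)" by (simp flip: exp_add)
  finally have "(5/4 * z)\<^sup>2 \<le> (exp (z / 2))\<^sup>2" using z by (intro power_mono) auto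
  also have "\<dots> = exp z" by (simp add: power2_eq_square flip: exp_add)
  finally have "25/16 * z\<^sup>2 \<le> exp z" by (simp add: power_mult_distrib power2_eq_square)
  moreover have "0 < z\<^sup>2" using z by simp
  ultimately have "z\<^sup>2 < 2/3 * exp z" by linarith
  then have "z\<^sup>2 * exp (- z) < 2/3" by (simp add: exp_minus field_simps)
  then show ?thesis using True by (simp add: flat_fun_def z_def)
qed (simp add: flat_fun_def)

lemma rescaling_push_fun: "rescaling push_fun"
proof (rule rescalingI)
  have "Ck_on k (\<lambda>s. 3/4 + (- 1) * s :: real) UNIV" for k
    by (intro Ck_on_add Ck_on_mult Ck_on_const Ck_on_id open_UNIV)
  then have "Ck_on k (\<lambda>s. flat_fun 0 (3/4 + (- 1) * s)) UNIV" for k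
    by (rule Ck_on_compose[OF open_UNIV Ck_on_flat_fun]) simp
  then show "Ck_on k push_fun UNIV" for k
    unfolding push_fun_def by (intro Ck_on_add Ck_on_mult Ck_on_const Ck_on_id open_UNIV) simp
  have "((\<lambda>s. flat_fun 0 (3/4 - s)) has_real_derivative flat_fun 2 (3/4 - x) * (- 1)) (at x)" for x
    by (rule DERIV_chain2[where f = "flat_fun 0"])
       (use flat_fun_derivative[of 0 "3/4 - x"] in
        \<open>auto intro!: derivative_eq_intros simp: numeral_2_eq_2\<close>)
  then show "(push_fun has_real_derivative 1 - 3/2 * flat_fun 2 (3/4 - x)) (at x)" for x
    unfolding push_fun_def by (auto intro!: derivative_eq_intros)
  show "0 < 1 - 3/2 * flat_fun 2 (3/4 - x)" for x using flat_fun_2_less[of "3/4 - x"] by simp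
qed (auto simp: push_fun_def flat_fun_def)

text \<open>By monotonicity only \<open>s = 0\<close> matters, where the value is 3/2 * exp (-4/3).
  It exceeds 1/3 because exp (4/3) < 9/2, which is checked on cubes: 3 ^ 4 = 81 is less than
  729/8.\<close>

lemma push_fun_gt:
  assumes "0 \<le> s" shows "1/3 < push_fun s"
proof -
  have "exp 1 ^ 4 \<le> (3::real) ^ 4" by (rule power_mono[OF exp_le]) simp
  moreover have "exp (4/3) ^ 3 = exp (1::real) ^ 4" by (simp flip: exp_of_nat_mult)
  moreover have "(3::real) ^ 4 < (9/2) ^ 3" by (simp add: power3_eq_cube)
  ultimately have "exp (4/3) ^ 3 < (9/2 :: real) ^ 3" by linarith
  then have "exp (4/3 :: real) < 9/2" by (rule power_less_imp_less_base) simp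
  then have "1/3 < push_fun 0" by (simp add: push_fun_def flat_fun_def exp_minus field_simps)
  also have "\<dots> \<le> push_fun s" using rescaling_mono[OF rescaling_push_fun assms] .
  finally show ?thesis .
qed

lemma collar_smooth_emb: "collar M c \<Longrightarrow> smooth_emb (bdry M \<times> {0..1}) M c"
  by (simp add: collar_def)

section \<open>Rescalings of the collar and interpolation between them\<close>

lemma BM_subset: "collar M c \<Longrightarrow> BM M c \<subseteq> M"
  using smooth_emb_into[OF collar_smooth_emb] by (simp add: BM_def)

lemma collar_rescale_apply:
  assumes "collar M c" "x \<in> bdry M" "s \<in> {0..1}"
  shows "collar_rescale M c u (c (x, s)) = c (x, u s)"
  using assms smooth_emb_inj[OF collar_smooth_emb[OF assms(1)]] by (simp add: collar_rescale_def)

lemma BM_E: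
  assumes "p \<in> BM M c" obtains x s where "x \<in> bdry M" "s \<in> {0..1}" "p = c (x, s)"
  using assms by (auto simp: BM_def)

lemma collar_rescale_id: "collar M c \<Longrightarrow> p \<in> BM M c \<Longrightarrow> collar_rescale M c (\<lambda>s. s) p = p"
  by (auto elim!: BM_E simp: collar_rescale_apply)

lemma smooth_emb_map_snd:
  assumes "smooth_emb Y Z u" shows "smooth_emb (X \<times> Y) (X \<times> Z) (\<lambda>p. (fst p, u (snd p)))"
proof (rule smooth_embI[where g = "\<lambda>p. (fst p, inv_into Y u (snd p))"])
  note u = assms[unfolded smooth_emb_def]
  show "smooth_map (X \<times> Y) (\<lambda>p. (fst p, u (snd p)))"
    using u by (intro smooth_map_Pair smooth_map_fst smooth_map_id
        smooth_map_compose[OF smooth_map_snd[OF smooth_map_id]]) auto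
  show "smooth_map ((\<lambda>p. (fst p, u (snd p))) ` (X \<times> Y)) (\<lambda>p. (fst p, inv_into Y u (snd p)))"
    using u by (intro smooth_map_Pair smooth_map_fst smooth_map_id
        smooth_map_compose[OF smooth_map_snd[OF smooth_map_id]]) auto
qed (use assms in \<open>auto simp: smooth_emb_def\<close>)

text \<open>The collar map conjugates \<open>collar_rescale\<close> to the product of the identity
  with \<open>u\<close>.\<close>

lemma collar_rescale_smooth_emb:
  assumes "collar M c" "rescaling u"
  shows "smooth_emb (BM M c) (BM M c) (collar_rescale M c u)"
proof -
  let ?X = "bdry M \<times> {0..1::real}"
  have c: "smooth_emb ?X (BM M c) c"
    using smooth_emb_into_subset[OF collar_smooth_emb[OF assms(1)]] by (simp add: BM_def)
  have "smooth_emb (BM M c) (BM M c) (c \<circ> ((\<lambda>p. (fst p, u (snd p))) \<circ> inv_into ?X c))"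
    using smooth_emb_inv_into[OF c] unfolding BM_def[symmetric]
    by (intro smooth_emb_compose[OF smooth_emb_compose[OF _ smooth_emb_map_snd[OF rescaling_smooth_emb[OF assms(2)]]] c])
  then show ?thesis
    by (rule smooth_emb_cong[rotated]) (simp add: collar_rescale_def case_prod_beta Let_def)
qed

text \<open>Straight-line interpolation of the collar coordinate after a map \<open>f\<close> into
  the collar. With \<open>f\<close> on a ball it transports orientation, with \<open>f\<close> on
  annuli it gives link isotopies; time and point form a pair as in \<open>isotopic\<close>.\<close>

definition rescale_homotopy where
  "rescale_homotopy M c u v f = (\<lambda>(s, y). collar_rescale M c (\<lambda>x. (1 - s) * u x + s * v x) (f y))"

lemma rescale_homotopy_ends:
  "rescale_homotopy M c u v f (0, y) = collar_rescale M c u (f y)"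
  "rescale_homotopy M c u v f (1, y) = collar_rescale M c v (f y)"
  by (simp_all add: rescale_homotopy_def)

lemma rescale_homotopy_slice:
  assumes "collar M c" "rescaling u" "rescaling v" "smooth_emb X (BM M c) f" "s \<in> {0..1}"
  shows "smooth_emb X (BM M c) (\<lambda>y. rescale_homotopy M c u v f (s, y))"
  using smooth_emb_compose[OF assms(4) collar_rescale_smooth_emb[OF assms(1) rescaling_convex[OF assms(2,3,5)]]]
  by (simp add: rescale_homotopy_def comp_def)

lemma rescale_homotopy_smooth:
  assumes "collar M c" "rescaling u" "rescaling v" "smooth_emb X (BM M c) f"
  shows "smooth_map ({0..1} \<times> X) (rescale_homotopy M c u v f)"
proof -
  let ?C = "bdry M \<times> {0..1::real}"
  let ?f = "\<lambda>y. inv_into ?C c (f (snd y))"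
  note c = collar_smooth_emb[OF assms(1)]
  have fB: "f y \<in> c ` ?C" if "y \<in> X" for y
    using smooth_emb_into[OF assms(4)] that by (auto simp: BM_def)
  have f: "smooth_map ({0..1} \<times> X) ?f"
    by (rule smooth_map_compose[OF smooth_map_compose[OF smooth_map_snd[OF smooth_map_id] smooth_emb_smooth[OF assms(4)]]
        smooth_emb_inverse[OF c]]) (use fB in auto)
  have uv: "smooth_map UNIV u" "smooth_map UNIV v"
    using assms(2,3) by (auto intro!: smooth_map_Ck[OF open_UNIV] simp: rescaling_def)
  have "smooth_map ({0..1} \<times> X)
      (\<lambda>y. c (fst (?f y), (1 - fst y) * u (snd (?f y)) + fst y * v (snd (?f y))))"
  proof (rule smooth_map_compose[OF _ smooth_emb_smooth[OF c]])
    show "smooth_map ({0..1} \<times> X)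
        (\<lambda>y. (fst (?f y), (1 - fst y) * u (snd (?f y)) + fst y * v (snd (?f y))))"
      by (intro smooth_map_Pair smooth_map_fst[OF f] smooth_map_add smooth_map_mult smooth_map_diff
          smooth_map_const smooth_map_fst[OF smooth_map_id]
          smooth_map_compose[OF smooth_map_snd[OF f] uv(1)] smooth_map_compose[OF smooth_map_snd[OF f] uv(2)])
         auto
    \<comment> \<open>The interpolated coordinate has to stay in the unit interval, over which
      \<open>c\<close> is known to be smooth.\<close>
    show "(\<lambda>y. (fst (?f y), (1 - fst y) * u (snd (?f y)) + fst y * v (snd (?f y)))) ` ({0..1} \<times> X) \<subseteq> ?C"
    proof (rule image_subsetI)
      fix z assume "z \<in> {0..1::real} \<times> X"
      then have z: "fst z \<in> {0..1}" "snd z \<in> X" by auto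
      have "?f z \<in> ?C" using fB[OF z(2)] by (rule inv_into_into)
      then have "fst (?f z) \<in> bdry M" "snd (?f z) \<in> {0..1}" by (auto simp: mem_Times_iff)
      then show "(fst (?f z), (1 - fst z) * u (snd (?f z)) + fst z * v (snd (?f z))) \<in> ?C"
        using rescaling_in[OF rescaling_convex[OF assms(2,3) z(1)]] by (simp add: mem_Times_iff)
    qed
  qed
  then show ?thesis
    by (simp add: rescale_homotopy_def collar_rescale_def case_prod_unfold Let_def)
qed

lemma collar_rescale_pres_orient:
  assumes M: "oriented_3manifold M A" and c: "collar M c" and u: "rescaling u"
    and B: "open B" "x \<in> B" "smooth_emb B (BM M c) \<phi>" and or: "pres_orient A \<phi> x"
  shows "pres_orient A (collar_rescale M c u \<circ> \<phi>) x"
proof -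
  let ?H = "rescale_homotopy M c (\<lambda>s. s) u \<phi>"
  have "?H (0, y) = \<phi> y" if "y \<in> B" for y
    using smooth_emb_into[OF B(3)] that
    by (auto simp: rescale_homotopy_ends intro!: collar_rescale_id[OF c])
  then have "pres_orient A (\<lambda>y. ?H (0, y)) x"
    by (intro pres_orient_cong[OF B(1,2) _ or]) simp
  then have "pres_orient A (\<lambda>y. ?H (1, y)) x"
    using pres_orient_isotopy[OF M B(1,2) rescale_homotopy_smooth[OF c rescaling_id u B(3)]]
      smooth_emb_mono[OF rescale_homotopy_slice[OF c rescaling_id u B(3)] BM_subset[OF c]] by blast
  then show ?thesis by (simp add: rescale_homotopy_ends comp_def)
qed

text \<open>The crossing relation distinguishes its smoothings by the orientation of the ball, so
  this is what is asked of an embedding, beyond smoothness, to transport it.\<close>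

definition preserves_balls where
  "preserves_balls A X Y i \<longleftrightarrow> (\<forall>\<phi>. oriented_ball X A \<phi> \<longrightarrow> oriented_ball Y A (i \<circ> \<phi>))"

lemma collar_rescale_preserves_balls:
  assumes "oriented_3manifold M A" "collar M c" "rescaling u"
  shows "preserves_balls A (BM M c) (BM M c) (collar_rescale M c u)"
  unfolding preserves_balls_def oriented_ball_iff
proof (intro allI impI conjI ballI; elim conjE)
  fix \<phi> :: "real^3 \<Rightarrow> 'a" assume \<phi>: "smooth_emb (cball 0 1) (BM M c) \<phi>"
    and or: "\<forall>x\<in>ball 0 1. pres_orient A \<phi> x"
  show "smooth_emb (cball 0 1) (BM M c) (collar_rescale M c u \<circ> \<phi>)"
    using \<phi> collar_rescale_smooth_emb[OF assms(2,3)] by (rule smooth_emb_compose)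
  show "pres_orient A (collar_rescale M c u \<circ> \<phi>) x" if "x \<in> ball 0 1" for x
    using collar_rescale_pres_orient[OF assms open_ball that smooth_emb_subset[OF \<phi> ball_subset_cball]]
      or that by blast
qed

section \<open>Pushing the manifold off its boundary\<close>

lemma openin_restrict:
  assumes "openin (top_of_set M) T" "Z \<subseteq> M" shows "openin (top_of_set Z) (Z \<inter> T)"
proof -
  obtain U where "open U" "T = M \<inter> U" using assms(1) by (auto simp: openin_open)
  then have "Z \<inter> T = Z \<inter> U" using assms(2) by auto
  then show ?thesis using \<open>open U\<close> by (auto simp: openin_open)
qed

text \<open>The complement in \<open>M\<close> is a union of relatively open chart images, so the
  boundary is closed in a compact set.\<close>

lemma compact_bdry:
  assumes "compact M" shows "compact (bdry M)"
proof -
  let ?\<U> = "{\<psi> ` U | U (\<psi> :: real^3 \<Rightarrow> 'a). open U \<and> smooth_emb U M \<psi> \<and> openin (top_of_set M) (\<psi> ` U)}"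
  have "bdry M = M - \<Union>?\<U>" unfolding bdry_def by blast
  moreover have "openin (top_of_set M) (\<Union>?\<U>)" by (rule openin_Union) auto
  ultimately have "closedin (top_of_set M) (bdry M)" by (simp add: closedin_diff)
  then show ?thesis using assms closedin_compact by blast
qed

text \<open>The two formulas agree at collar coordinates from 3/4 on, since \<open>push_fun\<close>
  is the identity there; this overlap makes the extension smooth.\<close>

definition push_off where
  "push_off M c p = (if p \<in> BM M c then collar_rescale M c push_fun p else p)"

context
  fixes M :: "'a::euclidean_space set" and c
  assumes cpt: "compact M" and c: "collar M c"
begin

lemma openin_collar_outer: "openin (top_of_set M) (c ` (bdry M \<times> {0..<1}))"
  using c by (simp add: collar_def)

lemma openin_collar_inner: "openin (top_of_set M) (M - c ` (bdry M \<times> {0..3/4}))"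
proof -
  have "compact (c ` (bdry M \<times> {0..3/4}))"
    by (intro compact_continuous_image compact_Times compact_bdry[OF cpt]
        continuous_on_subset[OF smooth_emb_continuous[OF collar_smooth_emb[OF c]]]) auto
  then show ?thesis by (auto simp: openin_open Diff_eq dest!: compact_imp_closed intro!: open_Compl)
qed

text \<open>The two relatively open pieces overlap at coordinates strictly between 3/4 and 1. On the
  first \<open>push_off\<close> is a collar rescaling, on the second the identity, and local
  questions about it are settled on one of them.\<close>

lemma collar_cover: "M \<subseteq> c ` (bdry M \<times> {0..<1}) \<union> (M - c ` (bdry M \<times> {0..3/4}))"
  by force

lemma push_off_inner:
  assumes "p \<in> M - c ` (bdry M \<times> {0..3/4})" shows "push_off M c p = p"
proof (cases "p \<in> BM M c")
  case True
  then obtain x s where p: "x \<in> bdry M" "s \<in> {0..1}" "p = c (x, s)" by (rule BM_E)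
  then have "3/4 \<le> s" using assms by force
  then show ?thesis using True p by (simp add: push_off_def collar_rescale_apply[OF c] push_fun_inner)
qed (simp add: push_off_def)

lemma push_off_outer: "p \<in> BM M c \<Longrightarrow> push_off M c p = collar_rescale M c push_fun p"
  by (simp add: push_off_def)

lemma outer_subset_BM: "c ` (bdry M \<times> {0..<1}) \<subseteq> BM M c"
  by (auto simp: BM_def)

lemma push_off_in_BM: "p \<in> M \<Longrightarrow> push_off M c p \<in> BM M c \<longleftrightarrow> p \<in> BM M c"
  using smooth_emb_into[OF collar_rescale_smooth_emb[OF c rescaling_push_fun]]
  by (auto simp: push_off_def)

lemma push_off_smooth_emb: "smooth_emb M M (push_off M c)"
proof -
  let ?i = "collar_rescale M c push_fun"
  note i = collar_rescale_smooth_emb[OF c rescaling_push_fun]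
  let ?g = "\<lambda>q. if q \<in> BM M c then inv_into (BM M c) ?i q else q"
  have g: "?g (push_off M c p) = p" if "p \<in> M" for p
    using that smooth_emb_inj[OF i] smooth_emb_into[OF i] by (auto simp: push_off_def)
  have pM: "push_off M c ` M \<subseteq> M"
    using smooth_emb_into[OF i] BM_subset[OF c] by (auto simp: push_off_def)
  show ?thesis
  proof (rule smooth_embI[where g = ?g])
    show "smooth_map M (push_off M c)"
    proof (rule smooth_map_openin_Un[OF openin_collar_outer openin_collar_inner collar_cover])
      have "smooth_map (BM M c) (push_off M c)"
        using smooth_emb_smooth[OF i] smooth_map_cong[OF refl push_off_outer, of "BM M c"] by simp
      then show "smooth_map (c ` (bdry M \<times> {0..<1})) (push_off M c)"
        by (rule smooth_map_subset) (rule outer_subset_BM)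
      show "smooth_map (M - c ` (bdry M \<times> {0..3/4})) (push_off M c)"
        using smooth_map_id by (subst smooth_map_cong[OF refl push_off_inner]) auto
    qed
    let ?Z = "push_off M c ` M"
    show "smooth_map ?Z ?g"
    proof (rule smooth_map_openin_Un)
      let ?X = "?Z \<inter> c ` (bdry M \<times> {0..<1})" and ?Y = "?Z \<inter> (M - c ` (bdry M \<times> {0..3/4}))"
      show "openin (top_of_set ?Z) ?X" "openin (top_of_set ?Z) ?Y"
        using openin_restrict[OF _ pM] openin_collar_outer openin_collar_inner by auto
      show "?Z \<subseteq> ?X \<union> ?Y" using pM collar_cover by blast
      \<comment> \<open>A value of \<open>push_off\<close> in the collar can only come from the
        collar, so on this piece the inverse of the rescaling is available.\<close>
      have "?X \<subseteq> ?i ` BM M c"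
      proof
        fix q assume q: "q \<in> ?X"
        then obtain p where p: "p \<in> M" "q = push_off M c p" by auto
        then have "p \<in> BM M c" using q outer_subset_BM push_off_in_BM by auto
        then show "q \<in> ?i ` BM M c" using p by (simp add: push_off_def)
      qed
      from smooth_map_subset[OF smooth_emb_inverse[OF i] this]
      show "smooth_map ?X ?g"
        by (rule smooth_map_cong[THEN iffD1, rotated 2]) (use outer_subset_BM in auto)
      \<comment> \<open>A point of the inner piece is its own image under \<open>push_off\<close>,
        so the left inverse property gives the claim.\<close>
      have "?g q = q" if "q \<in> ?Y" for q
        using that g push_off_inner by (metis Int_iff Diff_iff)
      then show "smooth_map ?Y ?g"
        using smooth_map_id smooth_map_cong[OF refl, of ?Y ?g "\<lambda>q. q"] by blast
    qed
  qed (use g pM in auto)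
qed

text \<open>A ball may straddle both pieces of the cover, but \<open>pres_orient\<close> is local:
  near each point \<open>push_off\<close> is a collar rescaling or the identity.\<close>

lemma push_off_preserves_balls:
  assumes M: "oriented_3manifold M A" shows "preserves_balls A M M (push_off M c)"
  unfolding preserves_balls_def oriented_ball_iff
proof (intro allI impI conjI ballI; elim conjE)
  fix \<phi> :: "real^3 \<Rightarrow> 'a" assume \<phi>: "smooth_emb (cball 0 1) M \<phi>"
    and or: "\<forall>x\<in>ball 0 1. pres_orient A \<phi> x"
  show "smooth_emb (cball 0 1) M (push_off M c \<circ> \<phi>)"
    using \<phi> push_off_smooth_emb by (rule smooth_emb_compose)
  fix x :: "real^3" assume x: "x \<in> ball 0 1"
  have \<phi>b: "smooth_emb (ball 0 1) M \<phi>" using smooth_emb_subset[OF \<phi> ball_subset_cball] .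
  note preim = continuous_preimage_openin[OF smooth_emb_continuous[OF \<phi>b] smooth_emb_into[OF \<phi>b]]
  have "\<phi> x \<in> M" using smooth_emb_into[OF \<phi>b] x by auto
  then consider "\<phi> x \<in> c ` (bdry M \<times> {0..<1})" | "\<phi> x \<in> M - c ` (bdry M \<times> {0..3/4})"
    using collar_cover by blast
  then show "pres_orient A (push_off M c \<circ> \<phi>) x"
  proof cases
    case 1
    obtain U where U: "open U" "{x \<in> ball 0 1. \<phi> x \<in> c ` (bdry M \<times> {0..<1})} = ball 0 1 \<inter> U"
      using preim[OF openin_collar_outer] .
    have B: "open (ball 0 1 \<inter> U)" "x \<in> ball 0 1 \<inter> U" using U x 1 by auto
    have im: "\<phi> ` (ball 0 1 \<inter> U) \<subseteq> BM M c" using U(2) outer_subset_BM by blast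
    then have "smooth_emb (ball 0 1 \<inter> U) (BM M c) \<phi>"
      by (rule smooth_emb_into_subset[OF smooth_emb_subset[OF \<phi>b Int_lower1]])
    from collar_rescale_pres_orient[OF M c rescaling_push_fun B this]
    have "pres_orient A (collar_rescale M c push_fun \<circ> \<phi>) x" using or x by blast
    then show ?thesis
      by (rule pres_orient_cong[OF B, rotated]) (use im in \<open>auto simp: push_off_def image_subset_iff\<close>)
  next
    case 2
    obtain U where U: "open U"
      "{x \<in> ball 0 1. \<phi> x \<in> M - c ` (bdry M \<times> {0..3/4})} = ball 0 1 \<inter> U"
      using preim[OF openin_collar_inner] .
    have B: "open (ball 0 1 \<inter> U)" "x \<in> ball 0 1 \<inter> U" using U x 2 by auto
    show ?thesis
    proof (rule pres_orient_cong[OF B])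
      show "\<phi> y = (push_off M c \<circ> \<phi>) y" if "y \<in> ball 0 1 \<inter> U" for y
      proof -
        have "\<phi> y \<in> M - c ` (bdry M \<times> {0..3/4})" using that unfolding U(2)[symmetric] by blast
        then show ?thesis by (simp add: push_off_inner)
      qed
    qed (use or x in blast)
  qed
qed

lemma push_off_notin_outer:
  assumes "p \<in> M" shows "push_off M c p \<notin> c ` (bdry M \<times> {0..1/3})"
proof (cases "p \<in> BM M c")
  case True
  then obtain x s where p: "x \<in> bdry M" "s \<in> {0..1}" "p = c (x, s)" by (rule BM_E)
  have eq: "push_off M c p = c (x, push_fun s)"
    using True p by (simp add: push_off_def collar_rescale_apply[OF c])
  have "push_fun s \<in> {0..1}" using rescaling_in[OF rescaling_push_fun p(2)] .
  moreover have "1/3 < push_fun s" using p(2) by (intro push_fun_gt) auto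
  ultimately show ?thesis
    using p(1) inj_onD[OF smooth_emb_inj[OF collar_smooth_emb[OF c]]] unfolding eq by fastforce
next
  case False
  then show ?thesis by (auto simp: push_off_def BM_def)
qed

end

section \<open>Unions and isotopies of banded links\<close>

lemma shift_nth [simp]: "shift i $ 1 = 5 * real i" "shift i $ 2 = 0"
  by (simp_all add: shift_def)

lemma shift_add: "shift (n + m) = shift n + shift m"
  and shift_0 [simp]: "shift 0 = 0"
  by (simp_all add: vec_eq_iff forall_2 algebra_simps)

lemma annuli_iff: "x \<in> annuli n \<longleftrightarrow> (\<exists>i<n. 1 \<le> norm (x - shift i) \<and> norm (x - shift i) \<le> 2)"
  by (auto simp: annuli_def)

text \<open>The number 5n - 5/2 is the midpoint of the gap between the right edge 5(n - 1) + 2 of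
  the last annulus and the left edge 5n - 2 of the next one; the vertical line through it separates
  the two blocks of a union.\<close>

lemma annuli_bounds:
  assumes "x \<in> annuli n" shows "- 2 \<le> x $ 1" "x $ 1 < 5 * real n - 5/2"
proof -
  obtain i where i: "i < n" "norm (x - shift i) \<le> 2" using assms by (auto simp: annuli_iff)
  have "\<bar>x $ 1 - 5 * real i\<bar> \<le> 2"
    using order_trans[OF component_le_norm_cart[of "x - shift i" 1] i(2)] by simp
  moreover have "real i \<le> real n - 1" using i(1) by simp
  ultimately show "- 2 \<le> x $ 1" "x $ 1 < 5 * real n - 5/2" by auto
qed

lemma annuli_add: "annuli (n + m) = annuli n \<union> (\<lambda>x. x + shift n) ` annuli m"
proof (intro equalityI subsetI)
  fix x assume "x \<in> annuli (n + m)"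
  then obtain i where i: "i < n + m" "1 \<le> norm (x - shift i)" "norm (x - shift i) \<le> 2"
    by (auto simp: annuli_iff)
  show "x \<in> annuli n \<union> (\<lambda>x. x + shift n) ` annuli m"
  proof (cases "i < n")
    case False
    then obtain j where j: "i = n + j" "j < m" using i(1) by (metis add_diff_inverse_nat nat_add_left_cancel_less)
    then have "x - shift n \<in> annuli m" using i by (auto simp: annuli_iff shift_add diff_diff_eq)
    then have "x - shift n + shift n \<in> (\<lambda>x. x + shift n) ` annuli m" by (rule imageI)
    then show ?thesis by simp
  qed (use i in \<open>auto simp: annuli_iff\<close>)
next
  fix x assume "x \<in> annuli n \<union> (\<lambda>x. x + shift n) ` annuli m"
  then show "x \<in> annuli (n + m)"
  proof
    assume "x \<in> annuli n"
    then show ?thesis unfolding annuli_iff using trans_less_add1 by blast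
  next
    assume "x \<in> (\<lambda>x. x + shift n) ` annuli m"
    then obtain j where "j < m" "1 \<le> norm (x - shift n - shift j)" "norm (x - shift n - shift j) \<le> 2"
      by (auto simp: annuli_iff)
    then show ?thesis
      unfolding annuli_iff by (intro exI[of _ "n + j"]) (simp add: shift_add diff_diff_eq)
  qed
qed

lemma annuli_add_cases:
  assumes "x \<in> annuli (n + m)"
  obtains "x \<in> annuli n" "x $ 1 < 5 * real n - 5/2"
  | y where "y \<in> annuli m" "x = y + shift n" "5 * real n - 5/2 < x $ 1" "x \<notin> annuli n"
proof -
  consider "x \<in> annuli n" | y where "y \<in> annuli m" "x = y + shift n" using assms by (auto simp: annuli_add)
  then show thesis
  proof cases
    case 2
    moreover have "5 * real n - 5/2 < x $ 1" using 2 annuli_bounds(1)[OF 2(1)] by simp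
    ultimately show ?thesis using that(2) annuli_bounds(2) by (metis less_asym)
  qed (use that(1) annuli_bounds(2) in blast)
qed

lemma annuli_left: "x \<in> annuli n \<Longrightarrow> x \<in> annuli (n + m)"
  and annuli_right: "y \<in> annuli m \<Longrightarrow> y + shift n \<in> annuli (n + m)"
  by (auto simp: annuli_add)

lemma shifted_notin_annuli: "y \<in> annuli m \<Longrightarrow> y + shift n \<notin> annuli n"
  using annuli_bounds(1)[of y m] annuli_bounds(2)[of "y + shift n" n] by auto

lemma compact_annuli: "compact (annuli n)"
proof -
  have "{x. 1 \<le> norm (x - shift i) \<and> norm (x - shift i) \<le> 2} = cball (shift i) 2 - ball (shift i) 1" for i
    by (auto simp: dist_norm norm_minus_commute)
  then show ?thesis unfolding annuli_def by (intro compact_UN) (auto intro: compact_diff)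
qed

lemma open_halfplanes: "open {x :: real^2. x $ 1 < b}" "open {x :: real^2. b < x $ 1}"
  by (auto intro!: open_Collect_less continuous_intros)

text \<open>Each block lies in its own open half-plane, and intersecting a neighbourhood with that
  half-plane keeps it inside the block. Orientation conditions, which concern interior points, can
  thus be checked blockwise.\<close>

lemma interior_annuli_add_cases:
  assumes "x \<in> interior (annuli (n + m))"
  obtains "x \<in> interior (annuli n)" "x $ 1 < 5 * real n - 5/2"
  | "x - shift n \<in> interior (annuli m)" "5 * real n - 5/2 < x $ 1"
proof -
  obtain T where T: "open T" "x \<in> T" "T \<subseteq> annuli (n + m)" using assms by (auto simp: interior_def)
  from T(2,3) have "x \<in> annuli (n + m)" by auto
  then show thesis
  proof (cases rule: annuli_add_cases)
    case 1
    have "T \<inter> {x. x $ 1 < 5 * real n - 5/2} \<subseteq> annuli n"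
    proof
      fix z assume z: "z \<in> T \<inter> {x. x $ 1 < 5 * real n - 5/2}"
      then have "z \<in> annuli (n + m)" using T by auto
      then show "z \<in> annuli n" by (cases rule: annuli_add_cases) (use z in auto)
    qed
    then have "x \<in> interior (annuli n)"
      using T 1 open_halfplanes by (intro interiorI[of "T \<inter> {x. x $ 1 < 5 * real n - 5/2}"]) auto
    then show ?thesis using that(1) 1 by blast
  next
    case (2 y)
    let ?T = "(\<lambda>z. z + shift n) -` (T \<inter> {x. 5 * real n - 5/2 < x $ 1})"
    have "?T \<subseteq> annuli m"
    proof
      fix z assume z: "z \<in> ?T"
      then have "z + shift n \<in> annuli (n + m)" using T by auto
      then show "z \<in> annuli m" by (cases rule: annuli_add_cases) (use z in auto)
    qed
    moreover have "open ?T" using T open_halfplanes by (auto intro!: open_vimage continuous_intros)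
    ultimately have "x - shift n \<in> interior (annuli m)"
      using T 2 by (intro interiorI[of ?T]) auto
    then show ?thesis using that(2) 2 by blast
  qed
qed

section \<open>Unions of parametrized links\<close>

definition join :: "nat \<Rightarrow> (real^2 \<Rightarrow> 'a) \<Rightarrow> (real^2 \<Rightarrow> 'a) \<Rightarrow> real^2 \<Rightarrow> 'a" where
  "join n e e' = (\<lambda>x. if x \<in> annuli n then e x else e' (x - shift n))"

lemma link_union_join: "link_union (n, e) (m, e') = (n + m, join n e e')"
  by (simp add: link_union_def join_def)

lemma join_left: "x \<in> annuli n \<Longrightarrow> join n e e' x = e x"
  by (simp add: join_def)

lemma join_right: "y \<in> annuli m \<Longrightarrow> join n e e' (y + shift n) = e' y"
  by (simp add: join_def shifted_notin_annuli)

text \<open>Valid on an open half-plane, including points outside the annuli, and therefore usable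
  when derivatives of \<open>join\<close> are compared.\<close>

lemma join_halfplane: "5 * real n - 5/2 < x $ 1 \<Longrightarrow> join n e e' x = e' (x - shift n)"
  using annuli_bounds(2)[of x n] by (auto simp: join_def)

lemma join_image: "join n e e' ` annuli (n + m) = e ` annuli n \<union> e' ` annuli m"
proof -
  have "join n e e' ` annuli n = e ` annuli n" by (auto simp: join_def)
  moreover have "join n e e' ` (\<lambda>x. x + shift n) ` annuli m = e' ` annuli m"
    unfolding image_image by (rule image_cong) (auto simp: join_right)
  ultimately show ?thesis by (simp add: annuli_add image_Un)
qed

lemma smooth_map_shifted:
  assumes "smooth_map (annuli m) f" shows "smooth_map ((\<lambda>x. x + shift n) ` annuli m) (\<lambda>x. f (x - shift n))"
  by (rule smooth_map_compose[OF smooth_map_diff[OF smooth_map_id smooth_map_const] assms]) auto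

lemma closed_shifted_annuli: "closed ((\<lambda>x. x + shift n) ` annuli m)"
  by (auto intro!: compact_imp_closed compact_continuous_image compact_annuli continuous_intros)

lemma annuli_disjoint: "annuli n \<inter> (\<lambda>x. x + shift n) ` annuli m = {}"
  using shifted_notin_annuli by blast

lemma smooth_map_join:
  assumes "smooth_map (annuli n) e" "smooth_map (annuli m) e'"
  shows "smooth_map (annuli (n + m)) (join n e e')"
  unfolding annuli_add
proof (rule smooth_map_closed_Un)
  show "smooth_map (annuli n) (join n e e')"
    using assms(1) by (subst smooth_map_cong[OF refl join_left]) auto
  show "smooth_map ((\<lambda>x. x + shift n) ` annuli m) (join n e e')"
    by (rule smooth_map_cong[THEN iffD1, OF refl _ smooth_map_shifted[OF assms(2)]])
       (auto simp: join_def shifted_notin_annuli)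
qed (auto simp: annuli_disjoint closed_shifted_annuli compact_imp_closed compact_annuli)

text \<open>The images are disjoint and compact, so the two inverses glue to a smooth inverse on
  their union.\<close>

lemma smooth_emb_join:
  assumes e: "smooth_emb (annuli n) N e" "smooth_emb (annuli m) N e'"
    and disj: "e ` annuli n \<inter> e' ` annuli m = {}"
  shows "smooth_emb (annuli (n + m)) N (join n e e')"
proof (rule smooth_embI)
  let ?g = "\<lambda>q. if q \<in> e ` annuli n then inv_into (annuli n) e q else inv_into (annuli m) e' q + shift n"
  show "smooth_map (annuli (n + m)) (join n e e')"
    using e by (intro smooth_map_join smooth_emb_smooth)
  show "join n e e' ` annuli (n + m) \<subseteq> N"
    using e[THEN smooth_emb_into] by (simp add: join_image)
  show "smooth_map (join n e e' ` annuli (n + m)) ?g"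
    unfolding join_image
  proof (rule smooth_map_closed_Un)
    show "smooth_map (e ` annuli n) ?g"
      by (rule smooth_map_cong[THEN iffD1, OF refl _ smooth_emb_inverse[OF e(1)]]) simp
    show "smooth_map (e' ` annuli m) ?g"
      by (rule smooth_map_cong[THEN iffD1, OF refl _ smooth_map_add[OF smooth_emb_inverse[OF e(2)] smooth_map_const]])
         (use disj in auto)
    show "closed (e ` annuli n)" "closed (e' ` annuli m)"
      using e[THEN smooth_emb_continuous]
      by (auto intro!: compact_imp_closed compact_continuous_image compact_annuli)
  qed (rule disj)
  fix x assume "x \<in> annuli (n + m)"
  then show "?g (join n e e' x) = x"
  proof (cases rule: annuli_add_cases)
    case 1
    then show ?thesis by (simp add: join_left inv_into_f_f[OF smooth_emb_inj[OF e(1)]])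
  next
    case (2 y)
    then have "e' y \<notin> e ` annuli n" using disj by auto
    then show ?thesis using 2 by (simp add: join_right inv_into_f_f[OF smooth_emb_inj[OF e(2)]])
  qed
qed

definition link_image :: "('a \<Rightarrow> 'b) \<Rightarrow> 'a link \<Rightarrow> 'b link" where
  "link_image i = (\<lambda>(n, e). (n, i \<circ> e))"

lemma is_link_image: "is_link X L \<Longrightarrow> smooth_emb X Y i \<Longrightarrow> is_link Y (link_image i L)"
  by (auto simp: is_link_def link_image_def intro: smooth_emb_compose)

lemma is_link_mono: "is_link X L \<Longrightarrow> X \<subseteq> Y \<Longrightarrow> is_link Y L"
  by (auto simp: is_link_def intro: smooth_emb_mono)

lemma is_link_supp: "is_link X L \<Longrightarrow> supp L \<subseteq> X"
  by (auto simp: is_link_def supp_def dest: smooth_emb_into)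

lemma supp_image [simp]: "supp (link_image i L) = i ` supp L"
  by (cases L) (auto simp: link_image_def supp_def)

lemma supp_union [simp]: "supp (link_union K L) = supp K \<union> supp L"
  by (cases K; cases L) (simp add: link_union_join supp_def join_image)

lemma is_link_union:
  "is_link N K \<Longrightarrow> is_link N L \<Longrightarrow> supp K \<inter> supp L = {} \<Longrightarrow> is_link N (link_union K L)"
  by (cases K; cases L) (simp add: link_union_join is_link_def supp_def smooth_emb_join)

section \<open>Isotopies of links and of their unions\<close>

lemma isotopicI:
  assumes "smooth_map ({0..1} \<times> annuli n) H" "\<And>s. s \<in> {0..1} \<Longrightarrow> smooth_emb (annuli n) N (\<lambda>x. H (s, x))"
    "smooth_emb (annuli n) (annuli n) \<rho>" "\<rho> ` annuli n = annuli n"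
    "\<And>x. x \<in> interior (annuli n) \<Longrightarrow> orient_pres_at \<rho> x"
    "\<And>x. x \<in> annuli n \<Longrightarrow> H (0::real, x) = e x" "\<And>x. x \<in> annuli n \<Longrightarrow> H (1, x) = e' (\<rho> x)"
  shows "isotopic N (n, e) (n, e')"
  unfolding isotopic_def prod.case
  by (intro conjI exI[of _ H] exI[of _ \<rho>]) (use assms in auto)

lemma isotopicE:
  assumes "isotopic N (n, e) L'"
  obtains e' H \<rho> where "L' = (n, e')" "smooth_map ({0..1} \<times> annuli n) H"
    "\<forall>s\<in>{0..1}. smooth_emb (annuli n) N (\<lambda>x. H (s, x))"
    "smooth_emb (annuli n) (annuli n) \<rho>" "\<rho> ` annuli n = annuli n"
    "\<forall>x\<in>interior (annuli n). orient_pres_at \<rho> x"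
    "\<forall>x\<in>annuli n. H (0::real, x) = e x" "\<forall>x\<in>annuli n. H (1, x) = e' (\<rho> x)"
  using assms unfolding isotopic_def by (cases L') auto

text \<open>A reparametrization \<open>\<rho>\<close> is part of \<open>isotopic\<close>, so a
  stationary homotopy suffices.\<close>

lemma isotopic_reparam:
  assumes "is_link N (n, e)" "smooth_emb (annuli n) (annuli n) \<rho>" "\<rho> ` annuli n = annuli n"
    "\<And>x. x \<in> interior (annuli n) \<Longrightarrow> orient_pres_at \<rho> x" "\<And>x. x \<in> annuli n \<Longrightarrow> e x = e' (\<rho> x)"
  shows "isotopic N (n, e) (n, e')"
proof (rule isotopicI[where H = "\<lambda>(s, x). e x"])
  have "smooth_map ({0..1} \<times> annuli n) (\<lambda>z. e (snd z))"
    using assms(1) by (intro smooth_map_compose[OF smooth_map_snd[OF smooth_map_id]])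
      (auto simp: is_link_def smooth_emb_smooth)
  then show "smooth_map ({0..1::real} \<times> annuli n) (\<lambda>(s, x). e x)" by (simp add: case_prod_unfold)
qed (use assms in \<open>auto simp: is_link_def\<close>)

lemma isotopic_eq_on:
  assumes "is_link N (n, e)" "\<And>x. x \<in> annuli n \<Longrightarrow> e x = e' x"
  shows "isotopic N (n, e) (n, e')"
  by (rule isotopic_reparam[where \<rho> = "\<lambda>x. x"])
     (use assms in \<open>auto simp: orient_pres_at_id intro: smooth_emb_id\<close>)

lemma isotopic_refl: "is_link N L \<Longrightarrow> isotopic N L L"
  by (cases L) (simp add: isotopic_eq_on)

lemma isotopic_image:
  assumes "isotopic X L L'" "smooth_emb X Y i"
  shows "isotopic Y (link_image i L) (link_image i L')"
proof -
  obtain n e where L: "L = (n, e)" by fastforce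
  from assms(1)[unfolded L] obtain e' H \<rho> where L': "L' = (n, e')"
    and H1: "smooth_map ({0..1::real} \<times> annuli n) H"
    and H2: "\<forall>s\<in>{0..1}. smooth_emb (annuli n) X (\<lambda>x. H (s, x))"
    and \<rho>': "smooth_emb (annuli n) (annuli n) \<rho>" "\<rho> ` annuli n = annuli n"
      "\<forall>x\<in>interior (annuli n). orient_pres_at \<rho> x"
    and ends': "\<forall>x\<in>annuli n. H (0, x) = e x" "\<forall>x\<in>annuli n. H (1, x) = e' (\<rho> x)"
    by (rule isotopicE)
  note H = H1 H2[rule_format] and \<rho> = \<rho>'(1,2) \<rho>'(3)[rule_format] and ends = ends'[rule_format]
  show ?thesis
    unfolding L L' link_image_def prod.case
  proof (rule isotopicI[where H = "\<lambda>z. i (H z)"])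
    show "smooth_map ({0..1} \<times> annuli n) (\<lambda>z. i (H z))"
      by (rule smooth_map_compose[OF H(1) smooth_emb_smooth[OF assms(2)]])
         (use H(2)[THEN smooth_emb_into] in force)
    show "smooth_emb (annuli n) Y (\<lambda>x. i (H (s, x)))" if "s \<in> {0..1}" for s
      using smooth_emb_compose[OF H(2)[OF that] assms(2)] by (simp add: comp_def)
  qed (use \<rho> ends in auto)
qed

text \<open>The isotopy takes place in \<open>N'\<close>, which \<open>K\<close> avoids, so
  \<open>K\<close> can be kept fixed; disjointness at all times is the reason for having two
  regions.\<close>

lemma isotopic_union:
  assumes "isotopic N' L L'" "N' \<subseteq> N" "is_link N K" "supp K \<inter> N' = {}"
  shows "isotopic N (link_union K L) (link_union K L')"
proof -
  obtain m f where L: "L = (m, f)" by fastforce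
  obtain n e where K: "K = (n, e)" by fastforce
  from assms(1)[unfolded L] obtain f' H \<rho> where L': "L' = (m, f')"
    and H1: "smooth_map ({0..1::real} \<times> annuli m) H"
    and H2: "\<forall>s\<in>{0..1}. smooth_emb (annuli m) N' (\<lambda>x. H (s, x))"
    and \<rho>': "smooth_emb (annuli m) (annuli m) \<rho>" "\<rho> ` annuli m = annuli m"
      "\<forall>x\<in>interior (annuli m). orient_pres_at \<rho> x"
    and ends': "\<forall>x\<in>annuli m. H (0, x) = f x" "\<forall>x\<in>annuli m. H (1, x) = f' (\<rho> x)"
    by (rule isotopicE)
  note H = H1 H2[rule_format] and \<rho> = \<rho>'(1,2) \<rho>'(3)[rule_format] and ends = ends'[rule_format]
  have e: "smooth_emb (annuli n) N e" using assms(3) by (simp add: K is_link_def)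
  let ?H = "\<lambda>(s, x). join n e (\<lambda>y. H (s, y)) x"
  \<comment> \<open>The identity on the first block and the conjugate of \<open>\<rho>\<close> by
    the shift on the second.\<close>
  let ?\<rho> = "join n (\<lambda>x. x) (\<lambda>y. \<rho> y + shift n)"
  have Hright: "?H (s, x) = H (s, x - shift n)" if "x \<in> (\<lambda>x. x + shift n) ` annuli m" for s x
    using that by (auto simp: join_right)
  have tr: "smooth_emb (annuli m) (annuli (n + m)) (\<lambda>y. y + shift n)"
    by (rule smooth_embI[where g = "\<lambda>y. y - shift n"])
       (auto intro: smooth_map_add smooth_map_diff smooth_map_id smooth_map_const simp: annuli_add)
  have \<rho>m: "\<rho> y \<in> annuli m" if "y \<in> annuli m" for y using that \<rho>(2) by blast
  show ?thesis
    unfolding K L L' link_union_join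
  proof (rule isotopicI[where H = ?H and \<rho> = ?\<rho>])
    have "{0..1::real} \<times> annuli (n + m) =
        {0..1} \<times> annuli n \<union> {0..1} \<times> (\<lambda>x. x + shift n) ` annuli m"
      by (auto simp: annuli_add)
    moreover have "smooth_map ({0..1} \<times> annuli n \<union> {0..1} \<times> (\<lambda>x. x + shift n) ` annuli m) ?H"
    proof (rule smooth_map_closed_Un)
      have "smooth_map ({0..1::real} \<times> annuli n) (\<lambda>z. e (snd z))"
        by (rule smooth_map_compose[OF smooth_map_snd[OF smooth_map_id] smooth_emb_smooth[OF e]]) auto
      then show "smooth_map ({0..1} \<times> annuli n) ?H"
        by (rule smooth_map_cong[THEN iffD1, OF refl, rotated]) (auto simp: join_left)
      have "smooth_map ({0..1} \<times> (\<lambda>x. x + shift n) ` annuli m) (\<lambda>z. H (fst z, snd z - shift n))"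
        by (rule smooth_map_compose[OF smooth_map_Pair[OF smooth_map_fst[OF smooth_map_id]
                smooth_map_diff[OF smooth_map_snd[OF smooth_map_id] smooth_map_const]] H(1)]) auto
      then show "smooth_map ({0..1} \<times> (\<lambda>x. x + shift n) ` annuli m) ?H"
        by (rule smooth_map_cong[THEN iffD1, OF refl, rotated]) (auto simp: join_right)
      show "({0..1::real} \<times> annuli n) \<inter> ({0..1} \<times> (\<lambda>x. x + shift n) ` annuli m) = {}"
        using annuli_disjoint by blast
    qed (intro closed_Times closed_shifted_annuli compact_imp_closed[OF compact_annuli] closed_atLeastAtMost)+
    ultimately show "smooth_map ({0..1} \<times> annuli (n + m)) ?H" by simp
    show "smooth_emb (annuli (n + m)) N (\<lambda>x. ?H (s, x))" if "s \<in> {0..1}" for s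
    proof -
      have "smooth_emb (annuli (n + m)) N (join n e (\<lambda>y. H (s, y)))"
      proof (rule smooth_emb_join[OF e smooth_emb_mono[OF H(2)[OF that] assms(2)]])
        show "e ` annuli n \<inter> (\<lambda>y. H (s, y)) ` annuli m = {}"
          using smooth_emb_into[OF H(2)[OF that]] assms(4) by (auto simp: K supp_def)
      qed
      then show ?thesis by simp
    qed
    show im: "?\<rho> ` annuli (n + m) = annuli (n + m)"
    proof -
      have "(\<lambda>y. \<rho> y + shift n) ` annuli m = (\<lambda>x. x + shift n) ` \<rho> ` annuli m" by (simp add: image_image)
      then show ?thesis unfolding join_image by (simp add: \<rho>(2) annuli_add)
    qed
    show "smooth_emb (annuli (n + m)) (annuli (n + m)) ?\<rho>"
    proof (rule smooth_emb_join)
      show "smooth_emb (annuli n) (annuli (n + m)) (\<lambda>x. x)"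
        by (rule smooth_emb_id) (simp add: annuli_add)
      show "smooth_emb (annuli m) (annuli (n + m)) (\<lambda>y. \<rho> y + shift n)"
        using smooth_emb_compose[OF \<rho>(1) tr] by (simp add: comp_def)
      show "(\<lambda>x. x) ` annuli n \<inter> (\<lambda>y. \<rho> y + shift n) ` annuli m = {}"
        using \<rho>m shifted_notin_annuli by fastforce
    qed
    show "orient_pres_at ?\<rho> x" if "x \<in> interior (annuli (n + m))" for x
      using that
    proof (cases rule: interior_annuli_add_cases)
      case 1
      show ?thesis
        by (rule orient_pres_at_cong[OF open_interior 1(1) _ orient_pres_at_id])
           (auto simp: join_left subsetD[OF interior_subset])
    next
      case 2
      have "orient_pres_at ((\<lambda>y. y + shift n) \<circ> (\<rho> \<circ> (\<lambda>x. x + - shift n))) x"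
        using \<rho>(3)[OF 2(1)] by (intro orient_pres_at_compose orient_pres_at_translation) auto
      then show ?thesis
        by (rule orient_pres_at_cong[OF open_halfplanes(2)[of "5 * real n - 5/2"], rotated 2])
           (use 2 in \<open>auto simp: join_halfplane\<close>)
    qed
    show "?H (0, x) = join n e f x" if "x \<in> annuli (n + m)" for x
      using that by (cases rule: annuli_add_cases) (auto simp: join_left join_right ends(1))
    show "?H (1, x) = join n e f' (?\<rho> x)" if "x \<in> annuli (n + m)" for x
      using that by (cases rule: annuli_add_cases) (auto simp: join_left join_right[where m = m] ends(2) \<rho>m)
  qed
qed

text \<open>As submanifolds both unions coincide; only the numbering of the annuli differs, and the
  reparametrization exchanges the two blocks by translations.\<close>

lemma isotopic_union_commute:
  assumes "is_link N K" "is_link N L" "supp K \<inter> supp L = {}"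
  shows "isotopic N (link_union K L) (link_union L K)"
proof -
  obtain m f where L: "L = (m, f)" by fastforce
  obtain n e where K: "K = (n, e)" by fastforce
  let ?\<rho> = "join n (\<lambda>x. x + shift m) (\<lambda>y. y)"
  have im: "?\<rho> ` annuli (n + m) = annuli (n + m)"
    unfolding join_image using annuli_add[of m n] by (auto simp: add.commute)
  have "isotopic N (n + m, join n e f) (n + m, join m f e)"
  proof (rule isotopic_reparam[where \<rho> = ?\<rho>])
    show "is_link N (n + m, join n e f)"
      using is_link_union[OF assms] by (simp add: K L link_union_join)
    show "smooth_emb (annuli (n + m)) (annuli (n + m)) ?\<rho>"
    proof (rule smooth_emb_join)
      show "smooth_emb (annuli n) (annuli (n + m)) (\<lambda>x. x + shift m)"
        by (rule smooth_embI[where g = "\<lambda>y. y - shift m"])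
           (use annuli_right in \<open>auto intro: smooth_map_add smooth_map_diff smooth_map_id
               smooth_map_const simp: add.commute[of n m]\<close>)
      show "smooth_emb (annuli m) (annuli (n + m)) (\<lambda>y. y)"
        by (rule smooth_emb_id) (auto simp: add.commute[of n m] annuli_left)
      show "(\<lambda>x. x + shift m) ` annuli n \<inter> (\<lambda>y. y) ` annuli m = {}"
        using shifted_notin_annuli by fastforce
    qed
    show "orient_pres_at ?\<rho> x" if "x \<in> interior (annuli (n + m))" for x
      using that
    proof (cases rule: interior_annuli_add_cases)
      case 1
      show ?thesis
        by (rule orient_pres_at_cong[OF open_interior 1(1) _ orient_pres_at_translation[of "shift m"]])
           (auto simp: join_left subsetD[OF interior_subset])
    next
      case 2
      show ?thesis
        by (rule orient_pres_at_cong[OF open_halfplanes(2)[of "5 * real n - 5/2"] _ _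
              orient_pres_at_translation[of "- shift n"]])
           (use 2 in \<open>auto simp: join_halfplane\<close>)
    qed
    show "join n e f x = join m f e (?\<rho> x)" if "x \<in> annuli (n + m)" for x
      using that by (cases rule: annuli_add_cases) (auto simp: join_left join_right)
  qed (rule im)
  then show ?thesis by (simp add: K L link_union_join add.commute)
qed

text \<open>Since shifts add up, both sides are the same map on the annuli.\<close>

lemma isotopic_union_assoc:
  assumes "is_link N (link_union (link_union K L) L')"
  shows "isotopic N (link_union (link_union K L) L') (link_union K (link_union L L'))"
proof -
  obtain n e where K: "K = (n, e)" by fastforce
  obtain m f where L: "L = (m, f)" by fastforce
  obtain k g where L': "L' = (k, g)" by fastforce
  have "isotopic N (n + m + k, join (n + m) (join n e f) g) (n + m + k, join n e (join m f g))"
  proof (rule isotopic_eq_on)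
    fix x assume "x \<in> annuli (n + m + k)"
    then show "join (n + m) (join n e f) g x = join n e (join m f g) x"
    proof (cases rule: annuli_add_cases)
      case 1
      from 1(1) show ?thesis
        by (cases rule: annuli_add_cases) (use 1 in \<open>auto simp: join_left join_right\<close>)
    next
      case (2 y)
      have "x = (y + shift m) + shift n" using 2 by (simp add: shift_add)
      moreover have "join (n + m) (join n e f) g x = g y" using 2 by (simp add: join_right)
      moreover have "join n e (join m f g) ((y + shift m) + shift n) = join m f g (y + shift m)"
        using join_right[OF annuli_right[OF 2(1)]] .
      ultimately show ?thesis using 2(1) by (simp add: join_right)
    qed
  qed (use assms in \<open>simp add: K L L' link_union_join\<close>)
  then show ?thesis by (simp add: K L L' link_union_join add.assoc)
qed

section \<open>Skein relations under embeddings\<close>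

text \<open>\<open>inv_into\<close> is a choice from a predicate, and the two predicates coincide.
  The equality thus holds even for \<open>z\<close> outside the image of \<open>f\<close>, as is
  wanted when derivatives are compared on whole neighbourhoods.\<close>

lemma inv_into_comp_inj_on:
  assumes "inj_on i X" "f ` S \<subseteq> X" "z \<in> X"
  shows "inv_into S (i \<circ> f) (i z) = inv_into S f z"
proof -
  have "(x \<in> S \<and> (i \<circ> f) x = i z) \<longleftrightarrow> (x \<in> S \<and> f x = z)" for x
    using assms by (auto simp: inj_on_eq_iff image_subset_iff)
  then show ?thesis by (simp add: inv_into_def)
qed

lemma faces_up_image:
  assumes "faces_up \<phi> L" "inj_on i X" "\<phi> ` cball 0 1 \<subseteq> X" "supp L \<subseteq> X"
  shows "faces_up (i \<circ> \<phi>) (link_image i L)"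
proof -
  obtain n e where L: "L = (n, e)" by fastforce
  have e: "e x \<in> X" if "x \<in> annuli n" for x using assms(4) that by (auto simp: L supp_def)
  show ?thesis
    unfolding faces_up_def L link_image_def prod.case
  proof (intro ballI impI)
    fix x assume x: "x \<in> interior (annuli n)" "(i \<circ> e) x \<in> (i \<circ> \<phi>) ` ball 0 1"
    then have "x \<in> annuli n" using interior_subset by blast
    then have "e x \<in> \<phi> ` ball 0 1"
      using x(2) assms(3) e ball_subset_cball[of "0 :: real^3" 1]
      by (fastforce simp: inj_on_eq_iff[OF assms(2)])
    then have "orient_pres_at (proj2 \<circ> inv_into (cball 0 1) \<phi> \<circ> e) x"
      using assms(1) x(1) by (simp add: faces_up_def L)
    then show "orient_pres_at (proj2 \<circ> inv_into (cball 0 1) (i \<circ> \<phi>) \<circ> (i \<circ> e)) x"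
    proof (rule orient_pres_at_cong[OF open_interior x(1), rotated])
      fix y assume "y \<in> interior (annuli n)"
      then have "e y \<in> X" using e interior_subset by blast
      then show "(proj2 \<circ> inv_into (cball 0 1) \<phi> \<circ> e) y = (proj2 \<circ> inv_into (cball 0 1) (i \<circ> \<phi>) \<circ> (i \<circ> e)) y"
        using inv_into_comp_inj_on[OF assms(2,3)] by simp
    qed
  qed
qed

text \<open>\<open>K\<close> misses the ball, so interior points mapped into it belong to the annuli
  of \<open>L\<close>, and the condition for \<open>L\<close> is transferred by a
  translation.\<close>

lemma faces_up_union:
  assumes "faces_up \<phi> L" "supp K \<inter> \<phi> ` ball 0 1 = {}"
  shows "faces_up \<phi> (link_union K L)"
proof -
  obtain n e where K: "K = (n, e)" by fastforce
  obtain m f where L: "L = (m, f)" by fastforce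
  show ?thesis
    unfolding faces_up_def K L link_union_join prod.case
  proof (intro ballI impI)
    fix x assume x: "x \<in> interior (annuli (n + m))" "join n e f x \<in> \<phi> ` ball 0 1"
    from x(1) show "orient_pres_at (proj2 \<circ> inv_into (cball 0 1) \<phi> \<circ> join n e f) x"
    proof (cases rule: interior_annuli_add_cases)
      case 1
      then have "x \<in> annuli n" using interior_subset by blast
      then have "join n e f x \<in> supp K" by (auto simp: K supp_def join_left)
      then show ?thesis using x(2) assms(2) by blast
    next
      case 2
      then have "f (x - shift n) \<in> \<phi> ` ball 0 1" using x(2) by (simp add: join_halfplane)
      then have "orient_pres_at (proj2 \<circ> inv_into (cball 0 1) \<phi> \<circ> f) (x + - shift n)"
        using assms(1) 2 by (simp add: faces_up_def L)
      then have "orient_pres_at ((proj2 \<circ> inv_into (cball 0 1) \<phi> \<circ> f) \<circ> (\<lambda>x. x + - shift n)) x"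
        by (rule orient_pres_at_compose) (rule orient_pres_at_translation)
      then show ?thesis
        by (rule orient_pres_at_cong[OF open_halfplanes(2)[of "5 * real n - 5/2"], rotated 2])
           (use 2 in \<open>auto simp: join_halfplane\<close>)
    qed
  qed
qed

lemma coincide_outside_image:
  assumes "coincide_outside \<phi> L L'" "inj_on i X" "\<phi> ` cball 0 1 \<subseteq> X" "supp L \<subseteq> X" "supp L' \<subseteq> X"
  shows "coincide_outside (i \<circ> \<phi>) (link_image i L) (link_image i L')"
proof -
  obtain n e where L: "L = (n, e)" by fastforce
  obtain m e' where L': "L' = (m, e')" by fastforce
  have e: "e x \<in> X" if "x \<in> annuli n" for x using assms(4) that by (auto simp: L supp_def)
  have e': "e' ` annuli m \<subseteq> X" using assms(5) by (simp add: L' supp_def)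
  have ball: "\<phi> ` ball 0 1 \<subseteq> X" using assms(3) ball_subset_cball[of "0 :: real^3" 1] by blast
  have sup: "supp L - \<phi> ` ball 0 1 = supp L' - \<phi> ` ball 0 1"
    using assms(1) by (simp add: coincide_outside_def L L')
  have "i ` supp K - (i \<circ> \<phi>) ` ball 0 1 = i ` (supp K - \<phi> ` ball 0 1)" if "supp K \<subseteq> X" for K
    using inj_on_image_set_diff[OF assms(2), of "supp K" "\<phi> ` ball 0 1"] that ball
    by (simp add: image_comp) blast
  then have "i ` supp L - (i \<circ> \<phi>) ` ball 0 1 = i ` supp L' - (i \<circ> \<phi>) ` ball 0 1"
    using assms(4,5) sup by simp
  moreover have "orient_pres_at (inv_into (annuli m) (i \<circ> e') \<circ> (i \<circ> e)) x"
    if x: "x \<in> interior (annuli n)" "(i \<circ> e) x \<notin> (i \<circ> \<phi>) ` cball 0 1" for x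
  proof -
    have "e x \<notin> \<phi> ` cball 0 1" using x(2) by auto
    then have "orient_pres_at (inv_into (annuli m) e' \<circ> e) x"
      using assms(1) x(1) by (simp add: coincide_outside_def L L')
    then show ?thesis
    proof (rule orient_pres_at_cong[OF open_interior x(1), rotated])
      fix y assume "y \<in> interior (annuli n)"
      then have "e y \<in> X" using e interior_subset by blast
      then show "(inv_into (annuli m) e' \<circ> e) y = (inv_into (annuli m) (i \<circ> e') \<circ> (i \<circ> e)) y"
        using inv_into_comp_inj_on[OF assms(2) e'] by simp
    qed
  qed
  ultimately show ?thesis
    unfolding coincide_outside_def L L' link_image_def prod.case
    using supp_image[of i L] supp_image[of i L'] by (simp add: L L' link_image_def)
qed

text \<open>On the annuli of \<open>K\<close> the transition map is the identity. On those of
  \<open>L\<close> the inverse of the union has to be known on a neighbourhood: the compact ball is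
  closed, so nearby points avoid it as well and lie on \<open>L'\<close>, where that inverse is the
  shifted inverse of \<open>L'\<close>.\<close>

lemma coincide_outside_union:
  assumes co: "coincide_outside \<phi> L L'" and K: "is_link N K" and L: "is_link N L" "is_link N L'"
    and disj: "supp K \<inter> supp L' = {}" and \<phi>: "compact (\<phi> ` cball 0 1)"
  shows "coincide_outside \<phi> (link_union K L) (link_union K L')"
proof -
  obtain n e where Ke: "K = (n, e)" by fastforce
  obtain m f where Lf: "L = (m, f)" by fastforce
  obtain k g where Lg: "L' = (k, g)" by fastforce
  have sup: "supp L - \<phi> ` ball 0 1 = supp L' - \<phi> ` ball 0 1"
    using co by (simp add: coincide_outside_def Lf Lg)
  have emb: "smooth_emb (annuli (n + k)) N (join n e g)"
    using is_link_union[OF K L(2) disj] by (simp add: Ke Lg link_union_join is_link_def)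
  have g: "smooth_emb (annuli k) N g" and f: "smooth_emb (annuli m) N f"
    using L by (simp_all add: Lf Lg is_link_def)
  have inv_left: "inv_into (annuli (n + k)) (join n e g) (e y) = y" if "y \<in> annuli n" for y
    using inv_into_f_f[OF smooth_emb_inj[OF emb] annuli_left[OF that]] by (simp add: join_left that)
  have inv_right: "inv_into (annuli (n + k)) (join n e g) (g y) = y + shift n" if "y \<in> annuli k" for y
    using inv_into_f_f[OF smooth_emb_inj[OF emb] annuli_right[OF that]]
    by (simp add: join_right[OF that])
  have "orient_pres_at (inv_into (annuli (n + k)) (join n e g) \<circ> join n e f) x"
    if x: "x \<in> interior (annuli (n + m))" "join n e f x \<notin> \<phi> ` cball 0 1" for x
    using x(1)
  proof (cases rule: interior_annuli_add_cases)
    case 1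
    show ?thesis
      by (rule orient_pres_at_cong[OF open_interior 1(1) _ orient_pres_at_id])
         (simp add: join_left subsetD[OF interior_subset] inv_left)
  next
    case 2
    have "continuous_on (interior (annuli m)) f"
      using smooth_emb_continuous[OF f] by (rule continuous_on_subset) (rule interior_subset)
    then have "open (interior (annuli m) \<inter> f -` (- \<phi> ` cball 0 1))"
      using compact_imp_closed[OF \<phi>] by (intro continuous_open_preimage) auto
    then have "open ((\<lambda>z. z - shift n) -` (interior (annuli m) \<inter> f -` (- \<phi> ` cball 0 1)))"
      by (intro open_vimage continuous_intros)
    then have op: "open (((\<lambda>z. z - shift n) -` (interior (annuli m) \<inter> f -` (- \<phi> ` cball 0 1)))
        \<inter> {x. 5 * real n - 5/2 < x $ 1})" (is "open ?W")
      using open_halfplanes by blast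
    have fx: "f (x - shift n) \<notin> \<phi> ` cball 0 1" using x(2) 2 by (simp add: join_halfplane)
    then have "orient_pres_at (inv_into (annuli k) g \<circ> f) (x + - shift n)"
      using co 2 by (simp add: coincide_outside_def Lf Lg)
    then have "orient_pres_at ((inv_into (annuli k) g \<circ> f) \<circ> (\<lambda>x. x + - shift n)) x"
      by (rule orient_pres_at_compose) (rule orient_pres_at_translation)
    then have "orient_pres_at ((\<lambda>y. y + shift n) \<circ> ((inv_into (annuli k) g \<circ> f) \<circ> (\<lambda>x. x + - shift n))) x"
      by (rule orient_pres_at_compose[OF orient_pres_at_translation])
    then show ?thesis
    proof (rule orient_pres_at_cong[OF op, rotated 2])
      show "x \<in> ?W" using 2 fx by auto
      fix z assume z: "z \<in> ?W"
      then have "f (z - shift n) \<in> supp L" using interior_subset by (auto simp: Lf supp_def)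
      then have "f (z - shift n) \<in> supp L - \<phi> ` ball 0 1"
        using z ball_subset_cball[of "0 :: real^3" 1] by auto
      then obtain y where y: "y \<in> annuli k" "f (z - shift n) = g y"
        unfolding sup by (auto simp: Lg supp_def)
      then show "((\<lambda>y. y + shift n) \<circ> ((inv_into (annuli k) g \<circ> f) \<circ> (\<lambda>x. x + - shift n))) z =
          (inv_into (annuli (n + k)) (join n e g) \<circ> join n e f) z"
        using z by (simp add: join_halfplane inv_right inv_into_f_f[OF smooth_emb_inj[OF g]])
    qed
  qed
  moreover have "supp (link_union K L) - \<phi> ` ball 0 1 = supp (link_union K L') - \<phi> ` ball 0 1"
    using sup by (simp add: Un_Diff)
  ultimately show ?thesis
    by (simp add: coincide_outside_def Ke Lf Lg link_union_join)
qed

lemma oriented_ball_into_subset: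
  "oriented_ball N A \<phi> \<Longrightarrow> \<phi> ` cball 0 1 \<subseteq> N' \<Longrightarrow> oriented_ball N' A \<phi>"
  by (auto simp: oriented_ball_iff intro: smooth_emb_into_subset)

lemma oriented_ball_into: "oriented_ball N A \<phi> \<Longrightarrow> \<phi> ` cball 0 1 \<subseteq> N"
  by (auto simp: oriented_ball_iff dest: smooth_emb_into)

lemma compact_oriented_ball: "oriented_ball N A \<phi> \<Longrightarrow> compact (\<phi> ` cball 0 1)"
  by (intro compact_continuous_image compact_cball smooth_emb_continuous) (auto simp: oriented_ball_iff)

lemma kauffman_tripleI:
  assumes "is_link N L" "is_link N Linf" "is_link N L0" "oriented_ball N A \<phi>"
    "0 < w" "w < 1/2" "height_fun w h"
    "smoothing (east w) (south w) (north w) (west w) Tinf"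
    "smoothing (east w) (north w) (south w) (west w) T0"
    "supp L \<inter> \<phi> ` cball 0 1 = \<phi> ` crossing w h"
    "supp Linf \<inter> \<phi> ` cball 0 1 = \<phi> ` Tinf" "supp L0 \<inter> \<phi> ` cball 0 1 = \<phi> ` T0"
    "faces_up \<phi> L" "faces_up \<phi> Linf" "faces_up \<phi> L0"
    "coincide_outside \<phi> L Linf" "coincide_outside \<phi> L L0"
  shows "kauffman_triple N A L Linf L0"
  unfolding kauffman_triple_def
  by (intro conjI exI[of _ \<phi>] exI[of _ w] exI[of _ h] exI[of _ Tinf] exI[of _ T0] assms)

lemma kauffman_tripleE:
  assumes "kauffman_triple N A L Linf L0"
  obtains \<phi> w h Tinf T0 where "is_link N L" "is_link N Linf" "is_link N L0" "oriented_ball N A \<phi>"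
    "0 < w" "w < 1/2" "height_fun w h"
    "smoothing (east w) (south w) (north w) (west w) Tinf"
    "smoothing (east w) (north w) (south w) (west w) T0"
    "supp L \<inter> \<phi> ` cball 0 1 = \<phi> ` crossing w h"
    "supp Linf \<inter> \<phi> ` cball 0 1 = \<phi> ` Tinf" "supp L0 \<inter> \<phi> ` cball 0 1 = \<phi> ` T0"
    "faces_up \<phi> L" "faces_up \<phi> Linf" "faces_up \<phi> L0"
    "coincide_outside \<phi> L Linf" "coincide_outside \<phi> L L0"
  using assms unfolding kauffman_triple_def by (elim conjE exE) (rule that; assumption)

text \<open>The target is the image of \<open>X\<close> rather than \<open>Y\<close>: when a further
  link is added, the whole ball has to avoid it, and the link is assumed disjoint from the image
  only.\<close>

lemma kauffman_triple_image:
  assumes tr: "kauffman_triple X A L Linf L0" and i: "smooth_emb X Y i" and bl: "preserves_balls A X Y i"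
  shows "kauffman_triple (i ` X) A (link_image i L) (link_image i Linf) (link_image i L0)"
proof -
  obtain \<phi> w h Tinf T0 where links: "is_link X L" "is_link X Linf" "is_link X L0"
    and ball: "oriented_ball X A \<phi>"
    and tangle: "0 < w" "w < 1/2" "height_fun w h"
      "smoothing (east w) (south w) (north w) (west w) Tinf"
      "smoothing (east w) (north w) (south w) (west w) T0"
    and sup: "supp L \<inter> \<phi> ` cball 0 1 = \<phi> ` crossing w h"
      "supp Linf \<inter> \<phi> ` cball 0 1 = \<phi> ` Tinf" "supp L0 \<inter> \<phi> ` cball 0 1 = \<phi> ` T0"
    and up: "faces_up \<phi> L" "faces_up \<phi> Linf" "faces_up \<phi> L0"
    and co: "coincide_outside \<phi> L Linf" "coincide_outside \<phi> L L0"
    using tr by (rule kauffman_tripleE)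
  note inj = smooth_emb_inj[OF i] and \<phi>X = oriented_ball_into[OF ball]
  have i': "smooth_emb X (i ` X) i" using i by (rule smooth_emb_into_subset) simp
  have "oriented_ball Y A (i \<circ> \<phi>)" using bl ball by (simp add: preserves_balls_def)
  then have ball': "oriented_ball (i ` X) A (i \<circ> \<phi>)"
    by (rule oriented_ball_into_subset) (use \<phi>X in auto)
  have sup': "supp (link_image i K) \<inter> (i \<circ> \<phi>) ` cball 0 1 = (i \<circ> \<phi>) ` T"
    if "is_link X K" "supp K \<inter> \<phi> ` cball 0 1 = \<phi> ` T" for K T
    using inj_on_image_Int[OF inj is_link_supp[OF that(1)] \<phi>X] that(2) by (simp add: image_comp)
  note up' = faces_up_image[OF _ inj \<phi>X is_link_supp]
    and co' = coincide_outside_image[OF _ inj \<phi>X is_link_supp is_link_supp]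
  show ?thesis
    by (rule kauffman_tripleI[OF links[THEN is_link_image[OF _ i']] ball' tangle
          sup'[OF links(1) sup(1)] sup'[OF links(2) sup(2)] sup'[OF links(3) sup(3)]
          up'[OF up(1) links(1)] up'[OF up(2) links(2)] up'[OF up(3) links(3)]
          co'[OF co(1) links(1,2)] co'[OF co(2) links(1,3)]])
qed

text \<open>The three tangles live in a ball inside \<open>N'\<close>, which \<open>K\<close> does
  not meet.\<close>

lemma kauffman_triple_union:
  assumes tr: "kauffman_triple N' A L Linf L0" and N: "N' \<subseteq> N" and K: "is_link N K" "supp K \<inter> N' = {}"
  shows "kauffman_triple N A (link_union K L) (link_union K Linf) (link_union K L0)"
proof -
  obtain \<phi> w h Tinf T0 where links': "is_link N' L" "is_link N' Linf" "is_link N' L0"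
    and ball: "oriented_ball N' A \<phi>"
    and tangle: "0 < w" "w < 1/2" "height_fun w h"
      "smoothing (east w) (south w) (north w) (west w) Tinf"
      "smoothing (east w) (north w) (south w) (west w) T0"
    and sup: "supp L \<inter> \<phi> ` cball 0 1 = \<phi> ` crossing w h"
      "supp Linf \<inter> \<phi> ` cball 0 1 = \<phi> ` Tinf" "supp L0 \<inter> \<phi> ` cball 0 1 = \<phi> ` T0"
    and up: "faces_up \<phi> L" "faces_up \<phi> Linf" "faces_up \<phi> L0"
    and co: "coincide_outside \<phi> L Linf" "coincide_outside \<phi> L L0"
    using tr by (rule kauffman_tripleE)
  note links = links'[THEN is_link_mono[OF _ N]]
  have disj: "supp K \<inter> supp L = {}" "supp K \<inter> supp Linf = {}" "supp K \<inter> supp L0 = {}"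
    using K(2) links'[THEN is_link_supp] by blast+
  have "supp K \<inter> \<phi> ` cball 0 1 = {}" using K(2) oriented_ball_into[OF ball] by blast
  then have sup': "supp (link_union K L) \<inter> \<phi> ` cball 0 1 = \<phi> ` crossing w h"
    "supp (link_union K Linf) \<inter> \<phi> ` cball 0 1 = \<phi> ` Tinf"
    "supp (link_union K L0) \<inter> \<phi> ` cball 0 1 = \<phi> ` T0"
    using sup by (simp_all add: Int_Un_distrib2)
  have "supp K \<inter> \<phi> ` ball 0 1 = {}"
    using K(2) oriented_ball_into[OF ball] ball_subset_cball[of "0 :: real^3" 1] by blast
  note up' = up[THEN faces_up_union[OF _ this]]
  note co' = coincide_outside_union[OF co(1) K(1) links(1,2) disj(2) compact_oriented_ball[OF ball]]
    coincide_outside_union[OF co(2) K(1) links(1,3) disj(3) compact_oriented_ball[OF ball]]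
  have "oriented_ball N A \<phi>"
    using ball by (rule oriented_ball_into_subset) (use oriented_ball_into[OF ball] N in blast)
  then show ?thesis
    by (intro kauffman_tripleI[OF _ _ _ _ tangle sup' up' co'] is_link_union K(1) links disj)
qed

lemma kauffman_triple_mono:
  assumes "kauffman_triple N' A L Linf L0" "N' \<subseteq> N"
  shows "kauffman_triple N A L Linf L0"
proof -
  have "oriented_ball N A \<phi>" if "oriented_ball N' A \<phi>" for \<phi>
    using oriented_ball_into_subset[OF that] oriented_ball_into[OF that] assms(2) by blast
  with assms(1) show ?thesis
    by (elim kauffman_tripleE) (rule kauffman_tripleI; (assumption | blast intro: is_link_mono[OF _ assms(2)]))
qed

section \<open>Trivial knots in a ball\<close>

lemma lift3_nth [simp]: "lift3 x z $ 1 = x $ 1" "lift3 x z $ 2 = x $ 2" "lift3 x z $ 3 = z"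
  by (simp_all add: lift3_def)

lemma proj2_nth [simp]: "proj2 p $ 1 = p $ 1" "proj2 p $ 2 = p $ 2"
  by (simp_all add: proj2_def)

text \<open>Division by 4 shrinks the outer radius 2 to 1/2, inside the unit ball, and
  \<open>4 *\<^sub>R proj2 p\<close> undoes it linearly.\<close>

lemma trivial_knot_smooth_emb:
  "smooth_emb (annuli 1) (cball 0 1) (\<lambda>x. lift3 ((1/4) *\<^sub>R x) 0)"
proof (rule smooth_embI[where g = "\<lambda>p. 4 *\<^sub>R proj2 p"])
  have "linear (\<lambda>x. lift3 ((1/4) *\<^sub>R x) 0)" "linear (\<lambda>p. 4 *\<^sub>R proj2 p)"
    by (auto intro!: linearI simp: vec_eq_iff forall_2 forall_3 algebra_simps)
  then show "smooth_map (annuli 1) (\<lambda>x. lift3 ((1/4) *\<^sub>R x) 0)"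
    "smooth_map ((\<lambda>x. lift3 ((1/4) *\<^sub>R x) 0) ` annuli 1) (\<lambda>p. 4 *\<^sub>R proj2 p)"
    by (auto intro: smooth_map_bounded_linear simp: linear_conv_bounded_linear)
  have "norm (lift3 x 0) = norm x" for x
    by (simp add: norm_eq_sqrt_inner inner_vec_def sum_2 sum_3)
  then show "(\<lambda>x. lift3 ((1/4) *\<^sub>R x) 0) ` annuli 1 \<subseteq> cball 0 1"
    by (auto simp: annuli_iff)
qed (simp add: vec_eq_iff forall_2)

lemma is_link_trivial_knot:
  assumes "smooth_emb (cball 0 1) N \<phi>" shows "is_link N (trivial_knot \<phi>)"
  using smooth_emb_compose[OF trivial_knot_smooth_emb assms]
  by (simp add: is_link_def trivial_knot_def comp_def)

lemma supp_trivial_knot: "supp (trivial_knot \<phi>) \<subseteq> \<phi> ` cball 0 1"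
  using smooth_emb_into[OF trivial_knot_smooth_emb] by (auto simp: trivial_knot_def supp_def)

lemma is_link_unknot_union:
  assumes "is_link N L" "smooth_emb (cball 0 1) N \<phi>" "supp L \<inter> \<phi> ` cball 0 1 = {}"
  shows "is_link N (link_union L (trivial_knot \<phi>))"
  using assms supp_trivial_knot[of \<phi>] by (intro is_link_union is_link_trivial_knot) auto

section \<open>Free modules on links and linear extension\<close>

lemma lookup_map0: "f 0 = 0 \<Longrightarrow> Poly_Mapping.lookup (Poly_Mapping.map f x) k = f (Poly_Mapping.lookup x k)"
  by transfer (auto simp: when_def)

lemma lookup_fsmult [simp]: "Poly_Mapping.lookup (fsmult r x) k = r * Poly_Mapping.lookup x k"
  by (simp add: lookup_map0)

lemma fsmult_simps [simp]:
  "fsmult r (x + y) = fsmult r x + fsmult r y"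
  "fsmult r (x - y) = fsmult r x - fsmult r y"
  "fsmult r (fsmult s x) = fsmult (r * s) x"
  "fsmult r 0 = 0" "fsmult 0 x = 0" "fsmult 1 x = x"
  "fsmult r (Poly_Mapping.single k s) = Poly_Mapping.single k (r * s)"
  by (auto intro!: poly_mapping_eqI simp: lookup_add lookup_minus algebra_simps lookup_single when_def)

lemma fsmult_add_left: "fsmult (r + s) x = fsmult r x + fsmult s x"
  by (auto intro!: poly_mapping_eqI simp: lookup_add algebra_simps)

lemma fsmult_minus_one: "fsmult (- 1) x = - x"
  by (auto intro!: poly_mapping_eqI)

lemma fsmult_sum: "fsmult r (\<Sum>i\<in>I. f i) = (\<Sum>i\<in>I. fsmult r (f i))"
  by (induction I rule: infinite_finite_induct) auto

text \<open>The linear extension of a map on generators to the free module; push-forwards, stacking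
  and multicurve combinations are all written with it.\<close>

definition fext :: "('k \<Rightarrow> 'l \<Rightarrow>\<^sub>0 'r) \<Rightarrow> ('k \<Rightarrow>\<^sub>0 'r) \<Rightarrow> ('l \<Rightarrow>\<^sub>0 'r::comm_ring_1)" where
  "fext F x = (\<Sum>k\<in>Poly_Mapping.keys x. fsmult (Poly_Mapping.lookup x k) (F k))"

lemma fext_superset:
  assumes "finite S" "Poly_Mapping.keys x \<subseteq> S"
  shows "fext F x = (\<Sum>k\<in>S. fsmult (Poly_Mapping.lookup x k) (F k))"
  unfolding fext_def by (rule sum.mono_neutral_left) (use assms in \<open>auto simp: in_keys_iff\<close>)

lemma keys_fsmult: "Poly_Mapping.keys (fsmult r x) \<subseteq> Poly_Mapping.keys x"
  by (auto simp: in_keys_iff)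

lemma fext_add: "fext F (x + y) = fext F x + fext F y"
proof -
  \<comment> \<open>A common finite support for both summands, since cancellation may shrink the
    support of the sum.\<close>
  let ?S = "Poly_Mapping.keys x \<union> Poly_Mapping.keys y"
  have "fext F z = (\<Sum>k\<in>?S. fsmult (Poly_Mapping.lookup z k) (F k))"
    if "Poly_Mapping.keys z \<subseteq> ?S" for z
    using that by (intro fext_superset) auto
  then show ?thesis using keys_add[of x y]
    by (simp add: lookup_add fsmult_add_left sum.distrib)
qed

lemma fext_fsmult: "fext F (fsmult r x) = fsmult r (fext F x)"
proof -
  have "fext F (fsmult r x) = (\<Sum>k\<in>Poly_Mapping.keys x. fsmult (r * Poly_Mapping.lookup x k) (F k))"
    using fext_superset[where F = F, OF finite_keys keys_fsmult[of r x]] by simp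
  then show ?thesis by (simp add: fext_def fsmult_sum)
qed

lemma fext_0 [simp]: "fext F 0 = 0"
  by (simp add: fext_def)

lemma fext_diff: "fext F (x - y) = fext F x - fext F y"
  using fext_add[of F x "fsmult (- 1) y"] by (simp add: fext_fsmult) (simp add: fsmult_minus_one)

lemma fext_single [simp]: "fext F (Poly_Mapping.single k r) = fsmult r (F k)"
  by (cases "r = 0") (simp_all add: fext_def)

text \<open>Exchanging the summations uses commutativity of the coefficients; it makes
  \<open>stack_free\<close> linear in its second argument too.\<close>

lemma fext_swap: "fext (\<lambda>k. fext (F k) y) x = fext (\<lambda>l. fext (\<lambda>k. F k l) x) y"
  unfolding fext_def fsmult_sum
  by (subst sum.swap) (simp add: mult.commute)

lemma fext_minus_fext: "fext F x - fext G x = fext (\<lambda>k. F k - G k) x"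
  by (simp add: fext_def sum_subtractf)

lemma stack_free_fext:
  "stack_free M c x y = fext (\<lambda>K. fext (\<lambda>L. Poly_Mapping.single (stack M c K L) 1) y) x"
  by (simp add: stack_free_def fext_def fsmult_sum)

section \<open>The submodule of relations and its transport\<close>

lemma skein_minus: "x \<in> skein_relations N A t \<Longrightarrow> - x \<in> skein_relations N A t"
  using skein_relations.scale[of x N A t "- 1"] by (simp add: fsmult_minus_one)

lemma skein_diff:
  "x \<in> skein_relations N A t \<Longrightarrow> y \<in> skein_relations N A t \<Longrightarrow> x - y \<in> skein_relations N A t"
  using skein_relations.add[OF _ skein_minus, of x N A t y] by simp

lemma skein_sum:
  "(\<And>i. i \<in> I \<Longrightarrow> f i \<in> skein_relations N A t) \<Longrightarrow> (\<Sum>i\<in>I. f i) \<in> skein_relations N A t"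
  by (induction I rule: infinite_finite_induct) (auto intro: skein_relations.zero skein_relations.add)

lemma fext_skein:
  "(\<And>k. k \<in> Poly_Mapping.keys x \<Longrightarrow> F k \<in> skein_relations N A t) \<Longrightarrow> fext F x \<in> skein_relations N A t"
  unfolding fext_def by (intro skein_sum skein_relations.scale)

lemma fext_skein_diff:
  assumes "\<And>k. k \<in> Poly_Mapping.keys x \<Longrightarrow> F k - G k \<in> skein_relations N A t"
  shows "fext F x - fext G x \<in> skein_relations N A t"
  unfolding fext_minus_fext by (rule fext_skein) (rule assms)

lemma fext_skein_cong:
  assumes "\<And>k. k \<in> Poly_Mapping.keys x \<Longrightarrow> F k - G k \<in> skein_relations N A t"
    and "fext G x \<in> skein_relations N A t"
  shows "fext F x \<in> skein_relations N A t"
  using skein_relations.add[OF fext_skein_diff[of x F G, OF assms(1)] assms(2)] by simp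

text \<open>A linear extension respects the submodules of relations as soon as it does so on the
  three kinds of generators.\<close>

lemma fext_skein_relations:
  assumes "x \<in> skein_relations N A t"
    and "\<And>L L'. is_link N L \<Longrightarrow> is_link N L' \<Longrightarrow> isotopic N L L' \<Longrightarrow> F L - F L' \<in> skein_relations N' A' t"
    and "\<And>L Linf L0. kauffman_triple N A L Linf L0 \<Longrightarrow>
      F L - (fsmult t (F Linf) + fsmult (unit_inverse t) (F L0)) \<in> skein_relations N' A' t"
    and "\<And>L \<phi>. is_link N L \<Longrightarrow> smooth_emb (cball 0 1) N \<phi> \<Longrightarrow> supp L \<inter> \<phi> ` cball 0 1 = {} \<Longrightarrow>
      F (link_union L (trivial_knot \<phi>)) - fsmult (- (t\<^sup>2 + (unit_inverse t)\<^sup>2)) (F L)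
        \<in> skein_relations N' A' t"
  shows "fext F x \<in> skein_relations N' A' t"
  using assms(1)
proof (induction rule: skein_relations.induct)
  case (unknot L \<phi>)
  then show ?case using assms(4)[OF unknot] by (simp only: fext_diff fext_single fsmult_simps)
qed (auto simp: fext_add fext_fsmult fext_diff intro: skein_relations.zero skein_relations.add
    skein_relations.scale assms)

lemma free_links_add: "x \<in> free_links N \<Longrightarrow> y \<in> free_links N \<Longrightarrow> x + y \<in> free_links N"
  unfolding free_links_def using keys_add[of x y] by blast

lemma free_links_fsmult: "x \<in> free_links N \<Longrightarrow> fsmult r x \<in> free_links N"
  unfolding free_links_def using keys_fsmult[of r x] by blast

lemma free_links_diff: "x \<in> free_links N \<Longrightarrow> y \<in> free_links N \<Longrightarrow> x - y \<in> free_links N"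
  using free_links_add[OF _ free_links_fsmult[of _ _ "- 1"]] by (simp add: fsmult_minus_one)

lemma free_links_0: "0 \<in> free_links N"
  by (simp add: free_links_def)

lemma free_links_single: "is_link N L \<Longrightarrow> Poly_Mapping.single L r \<in> free_links N"
  by (simp add: free_links_def)

lemma free_links_sum: "(\<And>i. i \<in> I \<Longrightarrow> f i \<in> free_links N) \<Longrightarrow> (\<Sum>i\<in>I. f i) \<in> free_links N"
  by (induction I rule: infinite_finite_induct) (auto intro: free_links_0 free_links_add)

lemma free_links_fext:
  "(\<And>k. k \<in> Poly_Mapping.keys x \<Longrightarrow> F k \<in> free_links N) \<Longrightarrow> fext F x \<in> free_links N"
  unfolding fext_def by (intro free_links_sum free_links_fsmult)

lemma free_links_mono: "X \<subseteq> Y \<Longrightarrow> free_links X \<subseteq> free_links Y"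
  unfolding free_links_def using is_link_mono by blast

lemma skein_relations_free_links: "x \<in> skein_relations N A t \<Longrightarrow> x \<in> free_links N"
proof (induction rule: skein_relations.induct)
  case (crossing L Linf L0)
  then have "is_link N L" "is_link N Linf" "is_link N L0" by (simp_all add: kauffman_triple_def)
  then show ?case by (intro free_links_diff free_links_add free_links_single)
qed (auto intro: free_links_0 free_links_add free_links_fsmult free_links_diff free_links_single
    is_link_unknot_union)

lemma skein_relations_mono:
  assumes "x \<in> skein_relations X A t" "X \<subseteq> Y" shows "x \<in> skein_relations Y A t"
  using assms(1)
proof (induction rule: skein_relations.induct)
  case (isotopy L L')
  have "isotopic Y L L'"
    using isotopic_image[OF isotopy(3) smooth_emb_id[OF assms(2)]] by (simp add: link_image_def case_prod_unfold comp_def)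
  then show ?case
    using isotopy is_link_mono[OF _ assms(2)] by (intro skein_relations.isotopy) auto
next
  case (unknot L \<phi>)
  then show ?case
    using is_link_mono[OF _ assms(2)] smooth_emb_mono[OF _ assms(2)]
    by (intro skein_relations.unknot) auto
qed (auto intro: skein_relations.intros kauffman_triple_mono[OF _ assms(2)])

text \<open>The common engine of the three stacking arguments: \<open>i\<close> is the inner
  rescaling, the outer rescaling or \<open>push_off\<close>, and each generator of the relations is
  moved by \<open>i\<close> and united with a link \<open>K\<close> that stays fixed.\<close>

lemma skein_relations_push:
  assumes x: "x \<in> skein_relations X A t" and i: "smooth_emb X N i" "preserves_balls A X N i"
    and K: "is_link N K" "supp K \<inter> i ` X = {}"
  shows "fext (\<lambda>L. Poly_Mapping.single (link_union K (link_image i L)) 1) x \<in> skein_relations N A t"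
proof (rule fext_skein_relations[OF x])
  have iX: "i ` X \<subseteq> N" and i': "smooth_emb X (i ` X) i"
    using smooth_emb_into[OF i(1)] smooth_emb_into_subset[OF i(1)] by auto
  have link: "is_link N (link_union K (link_image i L))" if "is_link X L" for L
    using is_link_union[OF K(1) is_link_image[OF that i(1)]] is_link_supp[OF that] K(2) by auto
  fix L L' assume L: "is_link X L" "is_link X L'" "isotopic X L L'"
  show "Poly_Mapping.single (link_union K (link_image i L)) 1 -
      Poly_Mapping.single (link_union K (link_image i L')) 1 \<in> skein_relations N A t"
    by (intro skein_relations.isotopy link L isotopic_union[OF isotopic_image[OF L(3) i'] iX K])
next
  fix L Linf L0 assume "kauffman_triple X A L Linf L0"
  from skein_relations.crossing[OF kauffman_triple_union[OF kauffman_triple_image[OF this i]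
        smooth_emb_into[OF i(1)] K], of t]
  show "Poly_Mapping.single (link_union K (link_image i L)) 1 -
      (fsmult t (Poly_Mapping.single (link_union K (link_image i Linf)) 1) +
       fsmult (unit_inverse t) (Poly_Mapping.single (link_union K (link_image i L0)) 1))
      \<in> skein_relations N A t"
    by simp
next
  fix L and \<phi> :: "real^3 \<Rightarrow> 'a" assume L: "is_link X L" and \<phi>: "smooth_emb (cball 0 1) X \<phi>" "supp L \<inter> \<phi> ` cball 0 1 = {}"
  let ?O = "trivial_knot (i \<circ> \<phi>)" and ?L = "link_union K (link_image i L)"
  have image_union: "link_image i (link_union L (trivial_knot \<phi>)) = link_union (link_image i L) ?O"
    by (cases L) (auto simp: link_image_def trivial_knot_def link_union_def)
  note i\<phi> = smooth_emb_compose[OF \<phi>(1) i(1)]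
  have Lk: "is_link N ?L"
    using is_link_union[OF K(1) is_link_image[OF L i(1)]] is_link_supp[OF L] K(2) by auto
  have "i ` supp L \<inter> (i \<circ> \<phi>) ` cball 0 1 = {}"
    using inj_on_image_Int[OF smooth_emb_inj[OF i(1)] is_link_supp[OF L] smooth_emb_into[OF \<phi>(1)]] \<phi>(2)
    by (simp add: image_comp)
  moreover have "(i \<circ> \<phi>) ` cball 0 1 \<subseteq> i ` X" using smooth_emb_into[OF \<phi>(1)] by auto
  ultimately have disj: "supp ?L \<inter> (i \<circ> \<phi>) ` cball 0 1 = {}" using K(2) by (simp add: Int_Un_distrib2) blast
  have Lk2: "is_link N (link_union ?L ?O)" by (rule is_link_unknot_union[OF Lk i\<phi> disj])
  have "is_link N (link_union K (link_union (link_image i L) ?O))"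
  proof -
    have Lk3: "is_link X (link_union L (trivial_knot \<phi>))" using is_link_unknot_union[OF L \<phi>] .
    then show ?thesis
      unfolding image_union[symmetric]
      using is_link_union[OF K(1) is_link_image[OF Lk3 i(1)]] is_link_supp[OF Lk3] K(2) by auto
  qed
  \<comment> \<open>The relation for a trivial knot wants it as the last member of the union,
    whereas here it is grouped with the image of \<open>L\<close>; associativity up to isotopy
    regroups.\<close>
  then have "Poly_Mapping.single (link_union ?L ?O) 1 -
      Poly_Mapping.single (link_union K (link_union (link_image i L) ?O)) 1 \<in> skein_relations N A t"
    by (intro skein_relations.isotopy Lk2 isotopic_union_assoc[OF Lk2])
  from skein_diff[OF skein_relations.unknot[OF Lk i\<phi> disj] this]
  show "Poly_Mapping.single (link_union K (link_image i (link_union L (trivial_knot \<phi>)))) 1 -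
      fsmult (- (t\<^sup>2 + (unit_inverse t)\<^sup>2)) (Poly_Mapping.single ?L 1) \<in> skein_relations N A t"
    by (simp add: image_union)
qed

section \<open>The stacking product and the kernel of inclusion\<close>

lemma skein_class_cong:
  assumes "x - y \<in> skein_relations N A t" shows "skein_class N A t x = skein_class N A t y"
proof -
  have "z - x \<in> skein_relations N A t \<longleftrightarrow> z - y \<in> skein_relations N A t" for z
    using skein_relations.add[OF _ assms, of "z - x"] skein_diff[OF _ assms, of "z - y"] by auto
  then show ?thesis by (simp add: skein_class_def)
qed

lemma skein_class_eq_iff:
  assumes "x \<in> free_links N"
  shows "skein_class N A t x = skein_class N A t y \<longleftrightarrow> x - y \<in> skein_relations N A t"
proof
  assume "skein_class N A t x = skein_class N A t y"
  moreover have "x \<in> skein_class N A t x" using assms by (simp add: skein_class_def skein_relations.zero)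
  ultimately show "x - y \<in> skein_relations N A t" by (simp add: skein_class_def)
qed (rule skein_class_cong)

text \<open>The operations on classes are unions over all representatives. If the result does not
  depend on the representative, the union is that common result.\<close>

lemma skein_class_UN:
  assumes "x \<in> free_links N" and "\<And>u. u \<in> free_links N \<Longrightarrow> u - x \<in> skein_relations N A t \<Longrightarrow> F u = F x"
  shows "(\<Union>u\<in>skein_class N A t x. F u) = F x"
proof (rule SUP_eq_const)
  show "skein_class N A t x \<noteq> {}" using assms(1) skein_relations.zero by (force simp: skein_class_def)
  show "F u = F x" if "u \<in> skein_class N A t x" for u
    using that assms(2) by (simp add: skein_class_def)
qed

lemma skein_module_zero: "\<zero>\<^bsub>skein_module N A t\<^esub> = skein_class N A t 0"
  by (simp add: skein_module_def)

lemma skein_module_add: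
  assumes "x \<in> free_links N" "y \<in> free_links N"
  shows "skein_class N A t x \<oplus>\<^bsub>skein_module N A t\<^esub> skein_class N A t y = skein_class N A t (x + y)"
proof -
  have "(\<Union>v\<in>skein_class N A t y. skein_class N A t (u + v)) = skein_class N A t (u + y)" for u
    using assms(2) by (rule skein_class_UN) (rule skein_class_cong, simp)
  moreover have "(\<Union>u\<in>skein_class N A t x. skein_class N A t (u + y)) = skein_class N A t (x + y)"
    using assms(1) by (rule skein_class_UN) (rule skein_class_cong, simp)
  ultimately show ?thesis by (simp add: skein_module_def)
qed

lemma skein_module_smult:
  assumes "x \<in> free_links N"
  shows "r \<odot>\<^bsub>skein_module N A t\<^esub> skein_class N A t x = skein_class N A t (fsmult r x)"
proof -
  have "(\<Union>u\<in>skein_class N A t x. skein_class N A t (fsmult r u)) = skein_class N A t (fsmult r x)"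
  proof (rule skein_class_UN[OF assms])
    fix u assume "u - x \<in> skein_relations N A t"
    then have "fsmult r u - fsmult r x \<in> skein_relations N A t"
      using skein_relations.scale[of "u - x" N A t r] by simp
    then show "skein_class N A t (fsmult r u) = skein_class N A t (fsmult r x)" by (rule skein_class_cong)
  qed
  then show ?thesis by (simp add: skein_module_def)
qed

lemma stack_link_union:
  "stack M c K L = link_union (link_image (collar_rescale M c (\<lambda>s. s / 3)) K)
     (link_image (collar_rescale M c (\<lambda>s. (s + 2) / 3)) L)"
  by (simp add: stack_def link_image_def case_prod_unfold)

section \<open>Bilinearity of stacking\<close>

lemma stack_free_add_left: "stack_free M c (x + x') y = stack_free M c x y + stack_free M c x' y"
  by (simp add: stack_free_fext fext_add)

lemma stack_free_fsmult_left: "stack_free M c (fsmult r x) y = fsmult r (stack_free M c x y)"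
  by (simp add: stack_free_fext fext_fsmult)

lemma stack_free_swap:
  "stack_free M c x y = fext (\<lambda>L. fext (\<lambda>K. Poly_Mapping.single (stack M c K L) 1) x) y"
  unfolding stack_free_fext by (rule fext_swap)

lemma stack_free_add_right: "stack_free M c x (y + y') = stack_free M c x y + stack_free M c x y'"
  by (simp add: stack_free_swap fext_add)

lemma stack_free_fsmult_right: "stack_free M c x (fsmult r y) = fsmult r (stack_free M c x y)"
  by (simp add: stack_free_swap fext_fsmult)

lemma stack_free_diff_left: "stack_free M c (x - x') y = stack_free M c x y - stack_free M c x' y"
  by (simp add: stack_free_fext fext_diff)

lemma stack_free_diff_right: "stack_free M c x (y - y') = stack_free M c x y - stack_free M c x y'"
  by (simp add: stack_free_swap fext_diff)

section \<open>Stacking in a collared manifold\<close>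

locale collared_manifold =
  fixes M :: "'a::euclidean_space set" and A :: "'a chart set" and c :: "'a \<times> real \<Rightarrow> 'a"
  assumes M: "oriented_3manifold M A" and cpt: "compact M" and c: "collar M c"
begin

abbreviation "to_outer \<equiv> collar_rescale M c (\<lambda>s. s / 3)"
abbreviation "to_inner \<equiv> collar_rescale M c (\<lambda>s. (s + 2) / 3)"

lemmas outer_emb = collar_rescale_smooth_emb[OF c rescaling_outer]
  and inner_emb = collar_rescale_smooth_emb[OF c rescaling_inner]
  and outer_balls = collar_rescale_preserves_balls[OF M c rescaling_outer]
  and inner_balls = collar_rescale_preserves_balls[OF M c rescaling_inner]
  and BM_sub = BM_subset[OF c]

lemma outer_image: "to_outer ` BM M c \<subseteq> c ` (bdry M \<times> {0..1/3})"
  by (auto elim!: BM_E simp: collar_rescale_apply[OF c])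

lemma c_inj: "x \<in> bdry M \<Longrightarrow> y \<in> bdry M \<Longrightarrow> s \<in> {0..1} \<Longrightarrow> s' \<in> {0..1} \<Longrightarrow>
    c (x, s) = c (y, s') \<longleftrightarrow> x = y \<and> s = s'"
  by (subst inj_on_eq_iff[OF smooth_emb_inj[OF collar_smooth_emb[OF c]]]) auto

lemma outer_inner_disjoint: "to_outer ` BM M c \<inter> to_inner ` BM M c = {}"
proof -
  have "to_outer p \<noteq> to_inner q" if "p \<in> BM M c" "q \<in> BM M c" for p q
    using that by (auto elim!: BM_E simp: collar_rescale_apply[OF c] c_inj)
  then show ?thesis by blast
qed

lemma outer_push_off_disjoint: "to_outer ` BM M c \<inter> push_off M c ` M = {}"
proof -
  have "push_off M c p \<notin> to_outer ` BM M c" if "p \<in> M" for p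
    using push_off_notin_outer[OF cpt c that] outer_image by blast
  then show ?thesis unfolding disjoint_iff by (metis imageE)
qed

lemma stack_supports:
  assumes "is_link (BM M c) K" "is_link (BM M c) L"
  shows "is_link (BM M c) (link_image to_outer K)" "is_link (BM M c) (link_image to_inner L)"
    "supp (link_image to_outer K) \<inter> supp (link_image to_inner L) = {}"
    "is_link (BM M c) (stack M c K L)"
proof -
  show 1: "is_link (BM M c) (link_image to_outer K)" "is_link (BM M c) (link_image to_inner L)"
    using assms by (auto intro: is_link_image outer_emb inner_emb)
  show 2: "supp (link_image to_outer K) \<inter> supp (link_image to_inner L) = {}"
    using outer_inner_disjoint assms[THEN is_link_supp] by auto
  show "is_link (BM M c) (stack M c K L)"
    unfolding stack_link_union by (intro is_link_union 1 2)
qed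

lemma stack_free_links:
  assumes "x \<in> free_links (BM M c)" "y \<in> free_links (BM M c)"
  shows "stack_free M c x y \<in> free_links (BM M c)"
  unfolding stack_free_fext
  by (intro free_links_fext free_links_single stack_supports(4))
     (use assms in \<open>auto simp: free_links_def\<close>)

lemma stack_free_right_relations:
  assumes "x \<in> free_links (BM M c)" "y \<in> skein_relations (BM M c) A t"
  shows "stack_free M c x y \<in> skein_relations (BM M c) A t"
  unfolding stack_free_fext
proof (rule fext_skein)
  fix K assume "K \<in> Poly_Mapping.keys x"
  then have K: "is_link (BM M c) K" using assms(1) by (simp add: free_links_def)
  show "fext (\<lambda>L. Poly_Mapping.single (stack M c K L) 1) y \<in> skein_relations (BM M c) A t"
    unfolding stack_link_union
    by (rule skein_relations_push[OF assms(2) inner_emb inner_balls stack_supports(1)[OF K K]])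
       (use outer_inner_disjoint is_link_supp[OF K] in auto)
qed

text \<open>\<open>skein_relations_push\<close> puts the fixed link first, but here it is the second
  factor; uniting in the other order is an isotopy.\<close>

lemma stack_free_left_relations:
  assumes "x \<in> skein_relations (BM M c) A t" "y \<in> free_links (BM M c)"
  shows "stack_free M c x y \<in> skein_relations (BM M c) A t"
  unfolding stack_free_swap
proof (rule fext_skein)
  fix L assume "L \<in> Poly_Mapping.keys y"
  then have L: "is_link (BM M c) L" using assms(2) by (simp add: free_links_def)
  show "fext (\<lambda>K. Poly_Mapping.single (stack M c K L) 1) x \<in> skein_relations (BM M c) A t"
  proof (rule fext_skein_cong)
    show "fext (\<lambda>K. Poly_Mapping.single (link_union (link_image to_inner L) (link_image to_outer K)) 1) x
        \<in> skein_relations (BM M c) A t"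
      by (rule skein_relations_push[OF assms(1) outer_emb outer_balls stack_supports(2)[OF L L]])
         (use outer_inner_disjoint is_link_supp[OF L] in auto)
    fix K assume "K \<in> Poly_Mapping.keys x"
    then have K: "is_link (BM M c) K"
      using skein_relations_free_links[OF assms(1)] by (simp add: free_links_def)
    note s = stack_supports[OF K L]
    have "is_link (BM M c) (link_union (link_image to_inner L) (link_image to_outer K))"
      using s by (intro is_link_union) auto
    then show "Poly_Mapping.single (stack M c K L) 1 -
        Poly_Mapping.single (link_union (link_image to_inner L) (link_image to_outer K)) 1
        \<in> skein_relations (BM M c) A t"
      unfolding stack_link_union
      by (intro skein_relations.isotopy isotopic_union_commute s s(4)[unfolded stack_link_union])
  qed
qed

text \<open>On the unit interval \<open>push_fun\<close> and \<open>(s + 2) / 3\<close> both exceed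
  1/3, hence so do their convex combinations. The narrow region in the statement is what lets a link
  in the outer third stay fixed during the isotopy.\<close>

lemma push_off_isotopic_inner:
  assumes "is_link (BM M c) L"
  shows "isotopic (c ` (bdry M \<times> {1/3<..1})) (link_image (push_off M c) L) (link_image to_inner L)"
proof -
  obtain n e where L: "L = (n, e)" by fastforce
  have e: "smooth_emb (annuli n) (BM M c) e" using assms by (simp add: L is_link_def)
  have eB: "e x \<in> BM M c" if "x \<in> annuli n" for x using smooth_emb_into[OF e] that by auto
  let ?H = "rescale_homotopy M c push_fun (\<lambda>s. (s + 2) / 3) e"
  show ?thesis
    unfolding L link_image_def prod.case
  proof (rule isotopicI[where H = ?H and \<rho> = "\<lambda>x. x"])
    show "smooth_map ({0..1} \<times> annuli n) ?H"
      by (rule rescale_homotopy_smooth[OF c rescaling_push_fun rescaling_inner e])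
    show "smooth_emb (annuli n) (c ` (bdry M \<times> {1/3<..1})) (\<lambda>x. ?H (s, x))" if s: "s \<in> {0..1}" for s
    proof (rule smooth_emb_into_subset[OF rescale_homotopy_slice[OF c rescaling_push_fun rescaling_inner e s]])
      show "(\<lambda>x. ?H (s, x)) ` annuli n \<subseteq> c ` (bdry M \<times> {1/3<..1})"
      proof (rule image_subsetI)
        fix x assume "x \<in> annuli n"
        from eB[OF this] obtain p r where p: "p \<in> bdry M" "r \<in> {0..1}" "e x = c (p, r)" by (rule BM_E)
        let ?u = "\<lambda>x. (1 - s) * push_fun x + s * ((x + 2) / 3)"
        \<comment> \<open>Strictness comes from a summand with nonzero weight: for
          \<open>s = 0\<close> from \<open>push_fun\<close>, otherwise from
          \<open>(r + 2) / 3\<close>, which is at least 2/3.\<close>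
        have "(1 - s) * (1/3) + s * (1/3) < ?u r"
        proof (cases "s = 0")
          case True
          then show ?thesis using push_fun_gt[of r] p by simp
        next
          case False
          then have "s * (1/3) < s * ((r + 2) / 3)" using s p by simp
          moreover have "(1 - s) * (1/3) \<le> (1 - s) * push_fun r"
            using s p push_fun_gt[of r] by (intro mult_left_mono) auto
          ultimately show ?thesis by linarith
        qed
        then have "1/3 < ?u r" by argo
        moreover have "?u r \<in> {0..1}"
          using rescaling_in[OF rescaling_convex[OF rescaling_push_fun rescaling_inner s] p(2)] .
        ultimately show "?H (s, x) \<in> c ` (bdry M \<times> {1/3<..1})"
          using p by (auto simp: rescale_homotopy_def collar_rescale_apply[OF c])
      qed
    qed
    show "?H (0, x) = (push_off M c \<circ> e) x" if "x \<in> annuli n" for x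
      using eB[OF that] by (simp add: rescale_homotopy_ends push_off_def)
  qed (auto simp: rescale_homotopy_ends orient_pres_at_id intro: smooth_emb_id)
qed

text \<open>The links of \<open>y\<close> lie in the collar, but the relation witnessing
  \<open>y\<close> may pass through all of \<open>M\<close>. So the relation is moved by
  \<open>push_off\<close>, and the links of \<open>y\<close>, one at a time, are then compared with
  the position that \<open>stack\<close> prescribes.\<close>

lemma stack_free_kernel:
  assumes x: "x \<in> free_links (BM M c)" and y: "y \<in> free_links (BM M c)" "y \<in> skein_relations M A t"
  shows "stack_free M c x y \<in> skein_relations M A t"
  unfolding stack_free_fext
proof (rule fext_skein)
  fix K assume "K \<in> Poly_Mapping.keys x"
  then have K: "is_link (BM M c) K" using x by (simp add: free_links_def)
  note oK = is_link_mono[OF stack_supports(1)[OF K K] BM_sub]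
  have oKs: "supp (link_image to_outer K) \<subseteq> to_outer ` BM M c" using is_link_supp[OF K] by auto
  show "fext (\<lambda>L. Poly_Mapping.single (stack M c K L) 1) y \<in> skein_relations M A t"
  proof (rule fext_skein_cong)
    show "fext (\<lambda>L. Poly_Mapping.single (link_union (link_image to_outer K) (link_image (push_off M c) L)) 1) y
        \<in> skein_relations M A t"
      by (rule skein_relations_push[OF y(2) push_off_smooth_emb[OF cpt c]
            push_off_preserves_balls[OF cpt c M] oK])
         (use oKs outer_push_off_disjoint in auto)
    fix L assume "L \<in> Poly_Mapping.keys y"
    then have L: "is_link (BM M c) L" using y(1) by (simp add: free_links_def)
    let ?N = "c ` (bdry M \<times> {1/3<..1})"
    have N: "?N \<subseteq> M" using BM_sub by (force simp: BM_def)
    have "c ` (bdry M \<times> {0..1/3}) \<inter> ?N = {}" by (auto simp: c_inj)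
    then have disj: "supp (link_image to_outer K) \<inter> ?N = {}"
      using oKs outer_image by blast
    have pL: "is_link M (link_image (push_off M c) L)"
      using is_link_image[OF is_link_mono[OF L BM_sub] push_off_smooth_emb[OF cpt c]] .
    have "supp (link_image (push_off M c) L) \<subseteq> push_off M c ` M"
      using is_link_supp[OF L] BM_sub by auto
    then have uL: "is_link M (link_union (link_image to_outer K) (link_image (push_off M c) L))"
      using oKs outer_push_off_disjoint by (intro is_link_union oK pL) blast
    have "isotopic M (link_union (link_image to_outer K) (link_image (push_off M c) L)) (stack M c K L)"
      unfolding stack_link_union
      by (rule isotopic_union[OF push_off_isotopic_inner[OF L] N oK disj])
    from skein_minus[OF skein_relations.isotopy[OF uL is_link_mono[OF stack_supports(4)[OF K L] BM_sub] this]]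
    show "Poly_Mapping.single (stack M c K L) 1 -
        Poly_Mapping.single (link_union (link_image to_outer K) (link_image (push_off M c) L)) 1
        \<in> skein_relations M A t"
      by simp
  qed
qed

section \<open>The skein algebra of the collar and the kernel of the inclusion\<close>

abbreviation "cls t x \<equiv> skein_class (BM M c) A t x"
abbreviation "\<F> \<equiv> free_links (BM M c)"
abbreviation "\<S> t \<equiv> skein_collar M A c t"

lemma collar_carrier: "carrier (\<S> t) = cls t ` \<F>"
  and collar_zero: "\<zero>\<^bsub>\<S> t\<^esub> = cls t 0"
  by (simp_all add: skein_collar_def skein_module_def)

lemma cls_closed: "x \<in> \<F> \<Longrightarrow> cls t x \<in> carrier (\<S> t)"
  by (simp add: collar_carrier)

lemma cls_E:
  assumes "X \<in> carrier (\<S> t)" obtains x where "x \<in> \<F>" "X = cls t x"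
  using assms by (auto simp: collar_carrier)

lemma collar_add: "x \<in> \<F> \<Longrightarrow> y \<in> \<F> \<Longrightarrow> cls t x \<oplus>\<^bsub>\<S> t\<^esub> cls t y = cls t (x + y)"
  using skein_module_add[of x "BM M c" y A t] by (simp add: skein_collar_def)

lemma collar_smult: "x \<in> \<F> \<Longrightarrow> r \<odot>\<^bsub>\<S> t\<^esub> cls t x = cls t (fsmult r x)"
  using skein_module_smult[of x "BM M c" A t r] by (simp add: skein_collar_def)

lemma collar_mult:
  assumes "x \<in> \<F>" "y \<in> \<F>"
  shows "cls t x \<otimes>\<^bsub>\<S> t\<^esub> cls t y = cls t (stack_free M c x y)"
proof -
  have "(\<Union>v\<in>cls t y. cls t (stack_free M c u v)) = cls t (stack_free M c u y)" if "u \<in> \<F>" for u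
    using assms(2)
  proof (rule skein_class_UN)
    fix v assume "v - y \<in> skein_relations (BM M c) A t"
    from stack_free_right_relations[OF that this]
    show "cls t (stack_free M c u v) = cls t (stack_free M c u y)"
      by (intro skein_class_cong) (simp add: stack_free_diff_right)
  qed
  moreover have "(\<Union>u\<in>cls t x. cls t (stack_free M c u y)) = cls t (stack_free M c x y)"
    using assms(1)
  proof (rule skein_class_UN)
    fix u assume "u - x \<in> skein_relations (BM M c) A t"
    from stack_free_left_relations[OF this assms(2)]
    show "cls t (stack_free M c u y) = cls t (stack_free M c x y)"
      by (intro skein_class_cong) (simp add: stack_free_diff_left)
  qed
  moreover have "cls t x \<subseteq> \<F>" by (auto simp: skein_class_def)
  ultimately have "(\<Union>u\<in>cls t x. \<Union>v\<in>cls t y. cls t (stack_free M c u v)) = cls t (stack_free M c x y)"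
    by (metis (no_types, lifting) SUP_cong subsetD)
  then show ?thesis by (simp add: skein_collar_def skein_module_def)
qed

lemma cls_eq_iff: "x \<in> \<F> \<Longrightarrow> cls t x = cls t y \<longleftrightarrow> x - y \<in> skein_relations (BM M c) A t"
  by (rule skein_class_eq_iff)

lemma collar_abelian_group: "abelian_group (\<S> t)"
proof (rule abelian_groupI)
  fix X Y Z assume "X \<in> carrier (\<S> t)" "Y \<in> carrier (\<S> t)" "Z \<in> carrier (\<S> t)"
  then show "(X \<oplus>\<^bsub>\<S> t\<^esub> Y) \<oplus>\<^bsub>\<S> t\<^esub> Z = X \<oplus>\<^bsub>\<S> t\<^esub> (Y \<oplus>\<^bsub>\<S> t\<^esub> Z)"
    by (auto elim!: cls_E simp: collar_add free_links_add add.assoc)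
next
  fix X assume "X \<in> carrier (\<S> t)"
  then obtain x where x: "x \<in> \<F>" "X = cls t x" by (rule cls_E)
  have "- x \<in> \<F>" using free_links_diff[OF free_links_0 x(1)] by simp
  then show "\<exists>Y\<in>carrier (\<S> t). Y \<oplus>\<^bsub>\<S> t\<^esub> X = \<zero>\<^bsub>\<S> t\<^esub>"
    using x by (intro bexI[of _ "cls t (- x)"]) (auto simp: collar_add collar_zero cls_closed)
qed (auto elim!: cls_E simp: collar_add collar_zero free_links_0 free_links_add cls_closed add.commute)

text \<open>Membership can be tested on one representative, because relations in the collar are
  relations in \<open>M\<close>.\<close>

lemma kernel_iff:
  assumes "x \<in> \<F>"
  shows "cls t x \<in> skein_kernel M A c t \<longleftrightarrow> x \<in> skein_relations M A t"
proof -
  have "(\<Union>u\<in>cls t x. skein_class M A t u) = skein_class M A t x"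
    using assms by (rule skein_class_UN) (rule skein_class_cong, rule skein_relations_mono[OF _ BM_sub])
  moreover have "x \<in> free_links M" using assms free_links_mono[OF BM_sub] by blast
  ultimately show ?thesis
    using cls_closed[OF assms, of t] skein_class_eq_iff[of x M A t 0]
    by (simp add: skein_kernel_def a_kernel_def' skein_module_zero)
qed

lemma kernel_E:
  assumes "X \<in> skein_kernel M A c t"
  obtains x where "x \<in> \<F>" "X = cls t x" "x \<in> skein_relations M A t"
proof -
  have "X \<in> carrier (\<S> t)" using assms by (simp add: skein_kernel_def a_kernel_def')
  then obtain x where "x \<in> \<F>" "X = cls t x" by (rule cls_E)
  then show thesis using that kernel_iff assms by blast
qed

lemma kernel_additive_subgroup: "additive_subgroup (skein_kernel M A c t) (\<S> t)"
proof (rule additive_subgroupI)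
  interpret abelian_group "\<S> t" by (rule collar_abelian_group)
  show "subgroup (skein_kernel M A c t) (add_monoid (\<S> t))"
  proof (rule add.subgroupI)
    show "skein_kernel M A c t \<subseteq> carrier (\<S> t)" by (auto elim!: kernel_E simp: cls_closed)
    have "cls t 0 \<in> skein_kernel M A c t" using kernel_iff[OF free_links_0] skein_relations.zero by blast
    then show "skein_kernel M A c t \<noteq> {}" by blast
    fix X assume "X \<in> skein_kernel M A c t"
    then obtain x where x: "x \<in> \<F>" "X = cls t x" "x \<in> skein_relations M A t" by (rule kernel_E)
    have mx: "- x \<in> \<F>" using free_links_diff[OF free_links_0 x(1)] by simp
    then have "cls t (- x) \<oplus>\<^bsub>\<S> t\<^esub> X = \<zero>\<^bsub>\<S> t\<^esub>" using x by (simp add: collar_add collar_zero)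
    then have "\<ominus>\<^bsub>\<S> t\<^esub> X = cls t (- x)" using x mx by (intro minus_equality) (auto simp: cls_closed)
    then show "\<ominus>\<^bsub>\<S> t\<^esub> X \<in> skein_kernel M A c t"
      using kernel_iff[OF mx] skein_minus[OF x(3)] by simp
    fix Y assume "Y \<in> skein_kernel M A c t"
    then obtain y where y: "y \<in> \<F>" "Y = cls t y" "y \<in> skein_relations M A t" by (rule kernel_E)
    show "X \<oplus>\<^bsub>\<S> t\<^esub> Y \<in> skein_kernel M A c t"
      using kernel_iff[OF free_links_add[OF x(1) y(1)]] skein_relations.add[OF x(3) y(3)] x y
      by (simp add: collar_add)
  qed
qed

lemma kernel_left_ideal:
  assumes "G \<in> carrier (\<S> t)" "F \<in> skein_kernel M A c t"
  shows "G \<otimes>\<^bsub>\<S> t\<^esub> F \<in> skein_kernel M A c t"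
proof -
  obtain g where g: "g \<in> \<F>" "G = cls t g" using assms(1) by (rule cls_E)
  obtain f where f: "f \<in> \<F>" "F = cls t f" "f \<in> skein_relations M A t" using assms(2) by (rule kernel_E)
  show ?thesis
    using kernel_iff[OF stack_free_links[OF g(1) f(1)]] stack_free_kernel[OF g(1) f(1,3)]
    by (simp add: g f collar_mult)
qed

end

section \<open>First-order deformation\<close>

lemma dual_simps [simp]:
  "std_part 0 = 0" "eps_part 0 = 0" "std_part 1 = 1" "eps_part 1 = 0"
  "std_part (x + y) = std_part x + std_part y" "eps_part (x + y) = eps_part x + eps_part y"
  "std_part (- x) = - std_part x" "eps_part (- x) = - eps_part x"
  "std_part (x - y) = std_part x - std_part y" "eps_part (x - y) = eps_part x - eps_part y"
  "std_part (x * y) = std_part x * std_part y"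
  "eps_part (x * y) = std_part x * eps_part y + eps_part x * std_part y"
  "std_part dual_eps = 0" "eps_part dual_eps = 1"
  by (simp_all add: zero_dual_def one_dual_def plus_dual_def uminus_dual_def minus_dual_def
      times_dual_def dual_eps_def)

lemma unit_inverse_eq: "t * s = 1 \<Longrightarrow> unit_inverse t = (s :: 'r::comm_ring_1)"
  unfolding unit_inverse_def by (rule the_equality) (auto, metis mult.assoc mult.commute mult_1)

lemma unit_inverse_minus_one: "unit_inverse (- 1 :: complex) = - 1"
  by (rule unit_inverse_eq) simp

text \<open>The product is 1 minus the square of \<epsilon>. \<open>dual_eps - 1\<close> is the
  simplified form of the parameter \<open>- 1 + dual_eps\<close>.\<close>

lemma unit_inverse_deformed: "unit_inverse (dual_eps - 1) = - 1 - dual_eps"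
  by (rule unit_inverse_eq) (rule dual.expand, simp)

lemma keys_map: "Poly_Mapping.keys (Poly_Mapping.map f x) \<subseteq> Poly_Mapping.keys x"
  by transfer auto

abbreviation reduce :: "('k \<Rightarrow>\<^sub>0 dual) \<Rightarrow> ('k \<Rightarrow>\<^sub>0 complex)" where
  "reduce \<equiv> Poly_Mapping.map std_part"

lemma reduce_simps [simp]:
  "reduce (x + y) = reduce x + reduce y" "reduce (x - y) = reduce x - reduce y"
  "reduce (fsmult r x) = fsmult (std_part r) (reduce x)" "reduce 0 = 0"
  "reduce (Poly_Mapping.single k r) = Poly_Mapping.single k (std_part r)"
  by (auto intro!: poly_mapping_eqI simp: lookup_map0 lookup_add lookup_minus lookup_single when_def)

lemma reduce_sum: "reduce (\<Sum>i\<in>I. f i) = (\<Sum>i\<in>I. reduce (f i))"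
  by (induction I rule: infinite_finite_induct) auto

lemma reduce_fext: "reduce (fext F x) = fext (\<lambda>k. reduce (F k)) (reduce x)"
proof -
  \<comment> \<open>Reduction may annihilate coefficients, so the sum is compared over the possibly
    larger support of \<open>x\<close>.\<close>
  have "fext (\<lambda>k. reduce (F k)) (reduce x) =
      (\<Sum>k\<in>Poly_Mapping.keys x. fsmult (Poly_Mapping.lookup (reduce x) k) (reduce (F k)))"
    by (rule fext_superset[OF finite_keys keys_map])
  then show ?thesis by (simp add: fext_def reduce_sum lookup_map0)
qed

lemma reduce_stack_free: "reduce (stack_free M c x y) = stack_free M c (reduce x) (reduce y)"
  by (simp add: stack_free_fext reduce_fext)

lemma reduce_free_links: "x \<in> free_links N \<Longrightarrow> reduce x \<in> free_links N"
  unfolding free_links_def using keys_map[of std_part x] by blast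

text \<open>Reduction sends the parameter and its inverse to -1, so each defining relation becomes
  the corresponding one there; isotopies and Kauffman triples do not involve the parameter.\<close>

lemma reduce_skein_relations:
  assumes "x \<in> skein_relations N A (dual_eps - 1)"
  shows "reduce x \<in> skein_relations N A (- 1)"
  using assms
proof (induction rule: skein_relations.induct)
  case (crossing L Linf L0)
  from skein_relations.crossing[OF this, of "- 1 :: complex"]
  show ?case by (simp add: unit_inverse_minus_one unit_inverse_deformed)
next
  case (unknot L \<phi>)
  from skein_relations.unknot[OF this, of "- 1 :: complex"]
  show ?case by (simp add: unit_inverse_minus_one unit_inverse_deformed power2_eq_square)
qed (auto intro: skein_relations.intros)

abbreviation const_part :: "('k \<Rightarrow>\<^sub>0 complex) \<Rightarrow> ('k \<Rightarrow>\<^sub>0 dual)" where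
  "const_part \<equiv> Poly_Mapping.map (\<lambda>z. Dual z 0)"

lemma lookup_const_part [simp]: "Poly_Mapping.lookup (const_part a) k = Dual (Poly_Mapping.lookup a k) 0"
  by (simp add: lookup_map0 zero_dual_def)

lemma map_eps_part: "Poly_Mapping.map (\<lambda>z. Dual 0 z) a = fsmult dual_eps (const_part a)"
  by (rule poly_mapping_eqI)
     (simp add: lookup_map0 zero_dual_def, simp add: dual_eps_def times_dual_def)

lemma const_part_add: "const_part (a + b) = const_part a + const_part b"
  by (rule poly_mapping_eqI) (simp add: lookup_add plus_dual_def)

lemma reduce_const_part [simp]: "reduce (const_part a) = a"
  by (rule poly_mapping_eqI) (simp add: lookup_map0)

lemma dual_decompose:
  "d = const_part (reduce d) + fsmult dual_eps (const_part (Poly_Mapping.map eps_part d))"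
  by (rule poly_mapping_eqI) (auto intro: dual.expand simp: lookup_add lookup_map0)

lemma dual_decompose_unique:
  assumes "const_part a + fsmult dual_eps (const_part b) = const_part a' + fsmult dual_eps (const_part b')"
  shows "a = a'" "b = b'"
proof -
  have "Dual (Poly_Mapping.lookup a k) 0 + dual_eps * Dual (Poly_Mapping.lookup b k) 0 =
      Dual (Poly_Mapping.lookup a' k) 0 + dual_eps * Dual (Poly_Mapping.lookup b' k) 0" for k
    using arg_cong[OF assms, of "\<lambda>x. Poly_Mapping.lookup x k"] by (simp add: lookup_add)
  then have "Poly_Mapping.lookup a k = Poly_Mapping.lookup a' k \<and>
      Poly_Mapping.lookup b k = Poly_Mapping.lookup b' k" for k
    by (simp add: dual_eps_def times_dual_def plus_dual_def)
  then show "a = a'" "b = b'" by (auto intro: poly_mapping_eqI)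
qed

section \<open>Coordinates in the multicurve basis\<close>

definition multicurve_sum :: "('a::euclidean_space link set \<Rightarrow>\<^sub>0 'r::comm_ring_1) \<Rightarrow> ('a link \<Rightarrow>\<^sub>0 'r)" where
  "multicurve_sum a = fext (\<lambda>K. Poly_Mapping.single (SOME L. L \<in> K) 1) a"

lemma multicurve_sum_add: "multicurve_sum (a + b) = multicurve_sum a + multicurve_sum b"
  and multicurve_sum_fsmult: "multicurve_sum (fsmult r a) = fsmult r (multicurve_sum a)"
  by (simp_all add: multicurve_sum_def fext_add fext_fsmult)

lemma reduce_multicurve_sum: "reduce (multicurve_sum a) = multicurve_sum (reduce a)"
  by (simp add: multicurve_sum_def reduce_fext)

lemma from_multicurves_sum:
  "from_multicurves M A c t = (\<lambda>a. skein_class (BM M c) A t (multicurve_sum a))"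
  by (rule ext) (simp add: from_multicurves_def multicurve_sum_def fext_def)

lemma multicurve_combs_add:
  "a \<in> multicurve_combs M c \<Longrightarrow> b \<in> multicurve_combs M c \<Longrightarrow> a + b \<in> multicurve_combs M c"
  unfolding multicurve_combs_def using keys_add[of a b] by blast

lemma multicurve_combs_fsmult: "a \<in> multicurve_combs M c \<Longrightarrow> fsmult r a \<in> multicurve_combs M c"
  unfolding multicurve_combs_def using keys_fsmult[of r a] by blast

lemma multicurve_combs_map:
  "a \<in> multicurve_combs M c \<Longrightarrow> Poly_Mapping.map f a \<in> multicurve_combs M c"
  unfolding multicurve_combs_def using keys_map[of f a] by blast

locale multicurve_basis = collared_manifold +
  assumes basis: "multicurves_form_basis M A c (- 1 :: complex)"
    and basis': "multicurves_form_basis M A c (- 1 + dual_eps)"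
begin

abbreviation "S \<equiv> SB M A c"
abbreviation "S' \<equiv> SB' M A c"
abbreviation "cls0 \<equiv> skein_class (BM M c) A (- 1 :: complex)"
abbreviation "cls1 \<equiv> skein_class (BM M c) A (dual_eps - 1)"

lemma multicurve_is_link:
  assumes "multicurve M c L" shows "is_link (BM M c) L"
proof -
  obtain n a where L: "L = (n, \<lambda>x. c (a x, 1/2))" and a: "smooth_emb (annuli n) (bdry M) a"
    using assms by (auto simp: multicurve_def)
  have cB: "smooth_emb (bdry M \<times> {0..1}) (BM M c) c"
    using smooth_emb_into_subset[OF collar_smooth_emb[OF c]] by (simp add: BM_def)
  have half: "smooth_emb (bdry M) (bdry M \<times> {0..1}) (\<lambda>p. (p, 1/2 :: real))"
    by (rule smooth_embI[where g = fst])
       (auto intro: smooth_map_Pair smooth_map_id smooth_map_const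
         smooth_map_bounded_linear bounded_linear_fst)
  show ?thesis
    using smooth_emb_compose[OF a smooth_emb_compose[OF half cB]]
    by (simp add: is_link_def L comp_def)
qed

lemma multicurve_sum_free: "a \<in> multicurve_combs M c \<Longrightarrow> multicurve_sum a \<in> \<F>"
  unfolding multicurve_sum_def
proof (rule free_links_fext, rule free_links_single)
  fix K assume "a \<in> multicurve_combs M c" "K \<in> Poly_Mapping.keys a"
  then have "K \<in> multicurve_classes M c" by (auto simp: multicurve_combs_def)
  then obtain L where L: "multicurve M c L" "K = {L'. multicurve M c L' \<and> isotopic (BM M c) L L'}"
    by (auto simp: multicurve_classes_def)
  \<comment> \<open>Reflexivity of isotopy puts \<open>L\<close> in its own class, so
    \<open>SOME\<close> picks a genuine multicurve.\<close>
  then have "L \<in> K" using isotopic_refl[OF multicurve_is_link] by blast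
  then have "(SOME L. L \<in> K) \<in> K" by (rule someI)
  then show "is_link (BM M c) (SOME L. L \<in> K)" using L by (auto intro: multicurve_is_link)
qed

abbreviation "coords \<equiv> multicurve_coords M A c"

lemma basis_bij: "bij_betw (\<lambda>a. cls0 (multicurve_sum a)) (multicurve_combs M c) (carrier S)"
  and basis_bij': "bij_betw (\<lambda>a. cls1 (multicurve_sum a)) (multicurve_combs M c) (carrier S')"
  using basis basis'
  by (simp_all add: multicurves_form_basis_def SB_def SB'_def from_multicurves_sum)

lemma coords:
  assumes "f \<in> carrier S"
  shows "coords f \<in> multicurve_combs M c" "cls0 (multicurve_sum (coords f)) = f"
proof -
  have im: "f \<in> (\<lambda>a. cls0 (multicurve_sum a)) ` multicurve_combs M c"
    using assms bij_betw_imp_surj_on[OF basis_bij] by simp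
  show "coords f \<in> multicurve_combs M c" "cls0 (multicurve_sum (coords f)) = f"
    using inv_into_into[OF im] f_inv_into_f[OF im]
    unfolding multicurve_coords_def from_multicurves_sum by simp_all
qed

lemma coords_eq:
  assumes "a \<in> multicurve_combs M c" shows "coords (cls0 (multicurve_sum a)) = a"
  using inv_into_f_f[OF bij_betw_imp_inj_on[OF basis_bij] assms]
  unfolding multicurve_coords_def from_multicurves_sum .

text \<open>A representative of \<open>f\<close> with zero \<epsilon>-part: its multicurve
  coordinates read as dual numbers. It is exactly additive, but multiplicative only up to an
  \<epsilon>-term, which is half the Goldman bracket.\<close>

definition lift where
  "lift f = multicurve_sum (const_part (coords f))"

lemma lift_free: "f \<in> carrier S \<Longrightarrow> lift f \<in> \<F>"
  unfolding lift_def by (intro multicurve_sum_free multicurve_combs_map coords(1))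

lemma reduce_lift: "f \<in> carrier S \<Longrightarrow> cls0 (reduce (lift f)) = f"
  by (simp add: lift_def reduce_multicurve_sum coords(2))

lemma plus_eps_lift: "plus_eps M A c f f' = cls1 (lift f + fsmult dual_eps (lift f'))"
  by (simp add: plus_eps_def from_multicurves_sum map_eps_part lift_def multicurve_sum_add
      multicurve_sum_fsmult)

section \<open>Arithmetic of pairs in the multicurve basis\<close>

lemma S_add: "x \<in> \<F> \<Longrightarrow> y \<in> \<F> \<Longrightarrow> cls0 x \<oplus>\<^bsub>S\<^esub> cls0 y = cls0 (x + y)"
  and S_mult: "x \<in> \<F> \<Longrightarrow> y \<in> \<F> \<Longrightarrow> cls0 x \<otimes>\<^bsub>S\<^esub> cls0 y = cls0 (stack_free M c x y)"
  and S_smult: "x \<in> \<F> \<Longrightarrow> r \<odot>\<^bsub>S\<^esub> cls0 x = cls0 (fsmult r x)"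
  and S_closed: "x \<in> \<F> \<Longrightarrow> cls0 x \<in> carrier S"
  and S_zero: "\<zero>\<^bsub>S\<^esub> = cls0 0"
  by (simp_all add: SB_def collar_add collar_mult collar_smult cls_closed collar_zero)

lemma S_E:
  assumes "f \<in> carrier S" obtains x where "x \<in> \<F>" "f = cls0 x"
  using assms by (auto simp: SB_def elim: cls_E)

lemma S'_add: "x \<in> \<F> \<Longrightarrow> y \<in> \<F> \<Longrightarrow> cls1 x \<oplus>\<^bsub>S'\<^esub> cls1 y = cls1 (x + y)"
  and S'_mult: "x \<in> \<F> \<Longrightarrow> y \<in> \<F> \<Longrightarrow> cls1 x \<otimes>\<^bsub>S'\<^esub> cls1 y = cls1 (stack_free M c x y)"
  and S'_closed: "x \<in> \<F> \<Longrightarrow> cls1 x \<in> carrier S'"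
  by (simp_all add: SB'_def collar_add collar_mult cls_closed)

sublocale S: abelian_group S
  unfolding SB_def by (rule collar_abelian_group)

sublocale S': abelian_group S'
  unfolding SB'_def by (rule collar_abelian_group)

lemma S_mult_closed: "f \<in> carrier S \<Longrightarrow> g \<in> carrier S \<Longrightarrow> f \<otimes>\<^bsub>S\<^esub> g \<in> carrier S"
  by (auto elim!: S_E simp: S_mult S_closed stack_free_links)

lemma S_smult_closed: "f \<in> carrier S \<Longrightarrow> r \<odot>\<^bsub>S\<^esub> f \<in> carrier S"
  by (auto elim!: S_E simp: S_smult S_closed free_links_fsmult)

lemma S_smult_smult: "f \<in> carrier S \<Longrightarrow> r \<odot>\<^bsub>S\<^esub> (s \<odot>\<^bsub>S\<^esub> f) = (r * s) \<odot>\<^bsub>S\<^esub> f"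
  by (auto elim!: S_E simp: S_smult S_closed free_links_fsmult)

lemma S_smult_one: "f \<in> carrier S \<Longrightarrow> 1 \<odot>\<^bsub>S\<^esub> f = f"
  by (auto elim!: S_E simp: S_smult)

lemma S_distrib_right:
  "f \<in> carrier S \<Longrightarrow> g \<in> carrier S \<Longrightarrow> h \<in> carrier S \<Longrightarrow>
    h \<otimes>\<^bsub>S\<^esub> (f \<oplus>\<^bsub>S\<^esub> g) = h \<otimes>\<^bsub>S\<^esub> f \<oplus>\<^bsub>S\<^esub> h \<otimes>\<^bsub>S\<^esub> g"
  by (auto elim!: S_E simp: S_add S_mult free_links_add stack_free_links stack_free_add_right)

lemma S_zero_mult: "f \<in> carrier S \<Longrightarrow> \<zero>\<^bsub>S\<^esub> \<otimes>\<^bsub>S\<^esub> f = \<zero>\<^bsub>S\<^esub>"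
  by (auto elim!: S_E simp: S_zero S_mult free_links_0 stack_free_fext)

lemma lift_add:
  assumes "f \<in> carrier S" "g \<in> carrier S" shows "lift (f \<oplus>\<^bsub>S\<^esub> g) = lift f + lift g"
proof -
  have "f \<oplus>\<^bsub>S\<^esub> g = cls0 (multicurve_sum (coords f + coords g))"
    using S_add[of "multicurve_sum (coords f)" "multicurve_sum (coords g)"] assms[THEN coords(1)]
    by (simp add: coords(2) assms multicurve_sum_free multicurve_sum_add)
  then have "coords (f \<oplus>\<^bsub>S\<^esub> g) = coords f + coords g"
    using coords_eq assms[THEN coords(1)] by (simp add: multicurve_combs_add)
  then show ?thesis by (simp add: lift_def const_part_add multicurve_sum_add)
qed

lemma plus_eps_closed: "f \<in> carrier S \<Longrightarrow> f' \<in> carrier S \<Longrightarrow> plus_eps M A c f f' \<in> carrier S'"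
  by (simp add: plus_eps_lift S'_closed free_links_add free_links_fsmult lift_free)

lemma plus_eps_add:
  assumes "f \<in> carrier S" "f' \<in> carrier S" "g \<in> carrier S" "g' \<in> carrier S"
  shows "plus_eps M A c f f' \<oplus>\<^bsub>S'\<^esub> plus_eps M A c g g' = plus_eps M A c (f \<oplus>\<^bsub>S\<^esub> g) (f' \<oplus>\<^bsub>S\<^esub> g')"
  using assms
  by (simp add: plus_eps_lift S'_add free_links_add free_links_fsmult lift_free lift_add algebra_simps)

text \<open>Multicurves are independent over the dual numbers, and a dual coefficient determines
  both of its parts.\<close>

lemma plus_eps_inject:
  assumes "f \<in> carrier S" "f' \<in> carrier S" "g \<in> carrier S" "g' \<in> carrier S"
    and eq: "plus_eps M A c f f' = plus_eps M A c g g'"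
  shows "f = g" "f' = g'"
proof -
  let ?d = "\<lambda>f f'. const_part (coords f) + fsmult dual_eps (const_part (coords f'))"
  have "?d f f' \<in> multicurve_combs M c" "?d g g' \<in> multicurve_combs M c"
    using assms(1-4)[THEN coords(1)]
    by (auto intro!: multicurve_combs_add multicurve_combs_fsmult multicurve_combs_map)
  moreover have "cls1 (multicurve_sum (?d f f')) = cls1 (multicurve_sum (?d g g'))"
    using eq by (simp add: plus_eps_lift lift_def multicurve_sum_add multicurve_sum_fsmult)
  ultimately have "?d f f' = ?d g g'"
    using basis_bij' by (auto simp: bij_betw_def dest: inj_onD)
  from dual_decompose_unique[OF this] show "f = g" "f' = g'"
    using coords(2) assms(1-4) by metis+
qed

lemma plus_eps_surj:
  assumes "F \<in> carrier S'"
  obtains f f' where "f \<in> carrier S" "f' \<in> carrier S" "F = plus_eps M A c f f'"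
proof -
  obtain d where d: "d \<in> multicurve_combs M c" "F = cls1 (multicurve_sum d)"
    using assms basis_bij' by (auto simp: bij_betw_def)
  let ?f = "cls0 (multicurve_sum (reduce d))"
  let ?f' = "cls0 (multicurve_sum (Poly_Mapping.map eps_part d))"
  have "multicurve_sum d = lift ?f + fsmult dual_eps (lift ?f')"
    using arg_cong[OF dual_decompose[of d], of multicurve_sum]
    by (simp add: lift_def coords_eq multicurve_combs_map d(1) multicurve_sum_add multicurve_sum_fsmult)
  then have "F = plus_eps M A c ?f ?f'" using d(2) by (simp add: plus_eps_lift)
  then show thesis
    by (rule that[rotated 2]) (simp_all add: S_closed multicurve_sum_free multicurve_combs_map d(1))
qed

lemma mod_eps_plus_eps:
  assumes "f \<in> carrier S" "f' \<in> carrier S" shows "mod_eps M A c (plus_eps M A c f f') = f"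
  unfolding mod_eps_def
  by (rule the_equality) (use assms plus_eps_inject(1) in blast)+

text \<open>Expansion in the deformed basis gives classes \<open>p\<close> and \<open>q\<close>;
  reducing modulo \<epsilon> identifies \<open>p\<close> with the class of \<open>reduce x\<close>,
  so that only \<open>q\<close> remains unspecified.\<close>

lemma lift_decompose:
  assumes "x \<in> \<F>"
  obtains q where "q \<in> carrier S"
    "x - (lift (cls0 (reduce x)) + fsmult dual_eps (lift q)) \<in> skein_relations (BM M c) A (dual_eps - 1)"
proof -
  obtain p q where pq: "p \<in> carrier S" "q \<in> carrier S" "cls1 x = plus_eps M A c p q"
    using plus_eps_surj[OF S'_closed[OF assms]] .
  then have R: "x - (lift p + fsmult dual_eps (lift q)) \<in> skein_relations (BM M c) A (dual_eps - 1)"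
    using assms by (simp add: plus_eps_lift cls_eq_iff)
  from reduce_skein_relations[OF this] have "cls0 (reduce x) = cls0 (reduce (lift p))"
    by (intro skein_class_cong) simp
  then have "cls0 (reduce x) = p" using pq(1) by (simp add: reduce_lift)
  then show thesis using that pq(2) R by simp
qed

text \<open>Multiplication by \<epsilon> kills the \<epsilon>-part, so \<epsilon> times a class is
  determined by its reduction.\<close>

lemma eps_lift:
  assumes "x \<in> \<F>"
  shows "fsmult dual_eps x - fsmult dual_eps (lift (cls0 (reduce x)))
    \<in> skein_relations (BM M c) A (dual_eps - 1)"
proof -
  obtain q where "q \<in> carrier S" and
    R: "x - (lift (cls0 (reduce x)) + fsmult dual_eps (lift q)) \<in> skein_relations (BM M c) A (dual_eps - 1)"
    using lift_decompose[OF assms] .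
  have "dual_eps * dual_eps = 0" by (rule dual.expand) simp
  then show ?thesis using skein_relations.scale[OF R, of dual_eps] by simp
qed

text \<open>The term \<open>b\<close> measures the failure of \<open>lift\<close> to be
  multiplicative on \<open>f\<close> and \<open>g\<close>. The other products carry a factor
  \<epsilon> and are determined by their reductions, so \<open>b\<close> can be chosen before
  \<open>f'\<close> and \<open>g'\<close>.\<close>

lemma plus_eps_mult:
  assumes f: "f \<in> carrier S" and g: "g \<in> carrier S"
  shows "\<exists>b\<in>carrier S. \<forall>f'\<in>carrier S. \<forall>g'\<in>carrier S.
      plus_eps M A c f f' \<otimes>\<^bsub>S'\<^esub> plus_eps M A c g g' =
      plus_eps M A c (f \<otimes>\<^bsub>S\<^esub> g) ((f \<otimes>\<^bsub>S\<^esub> g' \<oplus>\<^bsub>S\<^esub> f' \<otimes>\<^bsub>S\<^esub> g) \<oplus>\<^bsub>S\<^esub> b)"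
proof -
  let ?R = "skein_relations (BM M c) A (dual_eps - 1)"
  let ?st = "\<lambda>f g. stack_free M c (lift f) (lift g)"
  have st: "?st f g \<in> \<F>" "cls0 (reduce (?st f g)) = f \<otimes>\<^bsub>S\<^esub> g"
    if "f \<in> carrier S" "g \<in> carrier S" for f g
    using that S_mult[of "reduce (lift f)" "reduce (lift g)"]
    by (simp_all add: stack_free_links lift_free reduce_stack_free reduce_free_links reduce_lift)
  have eps: "fsmult dual_eps (?st f g) - fsmult dual_eps (lift (f \<otimes>\<^bsub>S\<^esub> g)) \<in> ?R"
    if "f \<in> carrier S" "g \<in> carrier S" for f g
    using eps_lift[OF st(1)[OF that]] by (simp add: st(2)[OF that])
  obtain b where b: "b \<in> carrier S" "?st f g - (lift (f \<otimes>\<^bsub>S\<^esub> g) + fsmult dual_eps (lift b)) \<in> ?R"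
    using lift_decompose[OF st(1)[OF f g]] unfolding st(2)[OF f g] .
  show ?thesis
  proof (rule bexI[OF _ b(1)], intro ballI)
    fix f' g' assume f': "f' \<in> carrier S" and g': "g' \<in> carrier S"
    have e2: "dual_eps * dual_eps = 0" by (rule dual.expand) simp
    let ?x = "lift f + fsmult dual_eps (lift f')" and ?y = "lift g + fsmult dual_eps (lift g')"
    let ?z = "(f \<otimes>\<^bsub>S\<^esub> g' \<oplus>\<^bsub>S\<^esub> f' \<otimes>\<^bsub>S\<^esub> g) \<oplus>\<^bsub>S\<^esub> b"
    have z: "lift ?z = lift (f \<otimes>\<^bsub>S\<^esub> g') + lift (f' \<otimes>\<^bsub>S\<^esub> g) + lift b"
      using f g f' g' b(1) by (simp add: lift_add S_mult_closed)
    have "stack_free M c ?x ?y = ?st f g + fsmult dual_eps (?st f g') + fsmult dual_eps (?st f' g)"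
      by (simp add: stack_free_add_left stack_free_add_right stack_free_fsmult_left
          stack_free_fsmult_right e2)
    \<comment> \<open>Regrouped as three differences: the defining relation of \<open>b\<close> and
      one instance of \<open>eps\<close> for each mixed term. The product of the two
      \<epsilon>-parts has vanished by \<open>e2\<close>.\<close>
    then have "stack_free M c ?x ?y - (lift (f \<otimes>\<^bsub>S\<^esub> g) + fsmult dual_eps (lift ?z)) =
        (?st f g - (lift (f \<otimes>\<^bsub>S\<^esub> g) + fsmult dual_eps (lift b))) +
        ((fsmult dual_eps (?st f g') - fsmult dual_eps (lift (f \<otimes>\<^bsub>S\<^esub> g'))) +
         (fsmult dual_eps (?st f' g) - fsmult dual_eps (lift (f' \<otimes>\<^bsub>S\<^esub> g))))"
      by (simp add: z)
    also have "\<dots> \<in> ?R"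
      by (intro skein_relations.add b(2) eps f g f' g')
    finally have "cls1 (stack_free M c ?x ?y) = plus_eps M A c (f \<otimes>\<^bsub>S\<^esub> g) ?z"
      unfolding plus_eps_lift by (rule skein_class_cong)
    moreover have "?x \<in> \<F>" "?y \<in> \<F>"
      using f g f' g' by (auto intro!: free_links_add free_links_fsmult lift_free)
    ultimately show "plus_eps M A c f f' \<otimes>\<^bsub>S'\<^esub> plus_eps M A c g g' = plus_eps M A c (f \<otimes>\<^bsub>S\<^esub> g) ?z"
      by (simp add: plus_eps_lift[of f f'] plus_eps_lift[of g g'] S'_mult)
  qed
qed

text \<open>The description is met by twice the \<open>b\<close> of \<open>plus_eps_mult\<close>,
  because the bracket enters with coefficient 1/2; uniqueness comes from comparing
  \<epsilon>-parts.\<close>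

lemma goldman_bracket:
  assumes f: "f \<in> carrier S" and g: "g \<in> carrier S"
  shows "goldman_bracket M A c f g \<in> carrier S"
    "\<lbrakk>f' \<in> carrier S; g' \<in> carrier S\<rbrakk> \<Longrightarrow>
      plus_eps M A c f f' \<otimes>\<^bsub>S'\<^esub> plus_eps M A c g g' =
      plus_eps M A c (f \<otimes>\<^bsub>S\<^esub> g)
        ((f \<otimes>\<^bsub>S\<^esub> g' \<oplus>\<^bsub>S\<^esub> f' \<otimes>\<^bsub>S\<^esub> g) \<oplus>\<^bsub>S\<^esub> (1/2) \<odot>\<^bsub>S\<^esub> goldman_bracket M A c f g)"
proof -
  let ?P = "\<lambda>h. h \<in> carrier S \<and> (\<forall>f'\<in>carrier S. \<forall>g'\<in>carrier S.
      plus_eps M A c f f' \<otimes>\<^bsub>S'\<^esub> plus_eps M A c g g' = plus_eps M A c (f \<otimes>\<^bsub>S\<^esub> g)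
        ((f \<otimes>\<^bsub>S\<^esub> g' \<oplus>\<^bsub>S\<^esub> f' \<otimes>\<^bsub>S\<^esub> g) \<oplus>\<^bsub>S\<^esub> (1/2) \<odot>\<^bsub>S\<^esub> h))"
  obtain b where b: "b \<in> carrier S" "\<And>f' g'. f' \<in> carrier S \<Longrightarrow> g' \<in> carrier S \<Longrightarrow>
      plus_eps M A c f f' \<otimes>\<^bsub>S'\<^esub> plus_eps M A c g g' =
      plus_eps M A c (f \<otimes>\<^bsub>S\<^esub> g) ((f \<otimes>\<^bsub>S\<^esub> g' \<oplus>\<^bsub>S\<^esub> f' \<otimes>\<^bsub>S\<^esub> g) \<oplus>\<^bsub>S\<^esub> b)"
    using plus_eps_mult[OF f g] by auto
  have half: "(1/2) \<odot>\<^bsub>S\<^esub> (2 \<odot>\<^bsub>S\<^esub> x) = x" "2 \<odot>\<^bsub>S\<^esub> ((1/2) \<odot>\<^bsub>S\<^esub> x) = x" if "x \<in> carrier S" for x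
    using that by (simp_all add: S_smult_smult S_smult_one)
  have ex: "?P (2 \<odot>\<^bsub>S\<^esub> b)" using b by (simp add: half S_smult_closed)
  have "h = 2 \<odot>\<^bsub>S\<^esub> b" if h: "?P h" for h
  proof -
    \<comment> \<open>One test decides uniqueness, at \<open>f'\<close> and \<open>g'\<close> both
      zero; \<open>?u\<close> is the resulting mixed term, which is then cancelled.\<close>
    let ?u = "f \<otimes>\<^bsub>S\<^esub> \<zero>\<^bsub>S\<^esub> \<oplus>\<^bsub>S\<^esub> \<zero>\<^bsub>S\<^esub> \<otimes>\<^bsub>S\<^esub> g"
    have u: "?u \<in> carrier S" using f g by (intro S.a_closed S_mult_closed S.zero_closed)
    have hh: "(1/2) \<odot>\<^bsub>S\<^esub> h \<in> carrier S" using h by (intro S_smult_closed) blast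
    have "plus_eps M A c (f \<otimes>\<^bsub>S\<^esub> g) (?u \<oplus>\<^bsub>S\<^esub> (1/2) \<odot>\<^bsub>S\<^esub> h) =
        plus_eps M A c (f \<otimes>\<^bsub>S\<^esub> g) (?u \<oplus>\<^bsub>S\<^esub> b)"
      using h b(2)[OF S.zero_closed S.zero_closed] S.zero_closed by metis
    then have "?u \<oplus>\<^bsub>S\<^esub> (1/2) \<odot>\<^bsub>S\<^esub> h = ?u \<oplus>\<^bsub>S\<^esub> b"
      by (rule plus_eps_inject(2)[rotated 4]) (auto intro!: S.a_closed u hh b(1) S_mult_closed f g)
    then have "(1/2) \<odot>\<^bsub>S\<^esub> h = b" using u hh b(1) by simp
    then show "h = 2 \<odot>\<^bsub>S\<^esub> b" using half(2)[of h] h by simp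
  qed
  with ex have "?P (THE h. ?P h)" by (rule theI)
  also have "(THE h. ?P h) = goldman_bracket M A c f g" unfolding goldman_bracket_def Let_def ..
  finally have "?P (goldman_bracket M A c f g)" .
  then show "goldman_bracket M A c f g \<in> carrier S"
    "\<lbrakk>f' \<in> carrier S; g' \<in> carrier S\<rbrakk> \<Longrightarrow>
      plus_eps M A c f f' \<otimes>\<^bsub>S'\<^esub> plus_eps M A c g g' =
      plus_eps M A c (f \<otimes>\<^bsub>S\<^esub> g)
        ((f \<otimes>\<^bsub>S\<^esub> g' \<oplus>\<^bsub>S\<^esub> f' \<otimes>\<^bsub>S\<^esub> g) \<oplus>\<^bsub>S\<^esub> (1/2) \<odot>\<^bsub>S\<^esub> goldman_bracket M A c f g)"
    by blast+
qed

section \<open>The kernels as ideals, and cosets of \<open>P\<close>\<close>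

abbreviation "P \<equiv> PB M A c"
abbreviation "P' \<equiv> PB' M A c"

sublocale P: abelian_subgroup P S
  unfolding PB_def SB_def
  by (rule abelian_subgroupI3[OF kernel_additive_subgroup collar_abelian_group])

sublocale P': additive_subgroup P' S'
  unfolding PB'_def SB'_def by (rule kernel_additive_subgroup)

lemma P_left_ideal: "g \<in> carrier S \<Longrightarrow> f \<in> P \<Longrightarrow> g \<otimes>\<^bsub>S\<^esub> f \<in> P"
  unfolding PB_def SB_def by (rule kernel_left_ideal)

lemma P'_left_ideal: "G \<in> carrier S' \<Longrightarrow> F \<in> P' \<Longrightarrow> G \<otimes>\<^bsub>S'\<^esub> F \<in> P'"
  unfolding PB'_def SB'_def by (rule kernel_left_ideal)

lemma coset_eqI:
  assumes "x \<in> carrier S" "y \<in> carrier S" "x \<ominus>\<^bsub>S\<^esub> y \<in> P"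
  shows "P +>\<^bsub>S\<^esub> x = P +>\<^bsub>S\<^esub> y"
proof -
  have "x = (x \<ominus>\<^bsub>S\<^esub> y) \<oplus>\<^bsub>S\<^esub> y"
    using assms(1,2) by (simp add: a_minus_def S.a_assoc S.l_neg)
  then have "x \<in> P +>\<^bsub>S\<^esub> y" using assms(3) unfolding a_r_coset_def' by blast
  then show ?thesis
    using S.add.repr_independence[OF _ _ P.a_subgroup, of x y] assms(2) by (simp add: a_r_coset_def)
qed

text \<open>\<open>coset_act\<close> is a union over a coset; it collapses to one coset because
  multiplication by \<open>g\<close> maps \<open>P\<close> into itself.\<close>

lemma coset_act:
  assumes "g \<in> carrier S" "x \<in> carrier S"
  shows "coset_act M A c g (P +>\<^bsub>S\<^esub> x) = P +>\<^bsub>S\<^esub> (g \<otimes>\<^bsub>S\<^esub> x)"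
  unfolding coset_act_def
proof (rule SUP_eq_const)
  show "P +>\<^bsub>S\<^esub> x \<noteq> {}" using P.zero_closed unfolding a_r_coset_def' by blast
  fix q assume "q \<in> P +>\<^bsub>S\<^esub> x"
  then obtain p where p: "p \<in> P" "q = p \<oplus>\<^bsub>S\<^esub> x" unfolding a_r_coset_def' by blast
  have pS: "p \<in> carrier S" using P.a_subset p(1) by blast
  have gp: "g \<otimes>\<^bsub>S\<^esub> p \<in> P" by (rule P_left_ideal[OF assms(1) p(1)])
  note closed = S_mult_closed[OF assms(1) pS] S_mult_closed[OF assms]
  have q: "g \<otimes>\<^bsub>S\<^esub> q = g \<otimes>\<^bsub>S\<^esub> p \<oplus>\<^bsub>S\<^esub> g \<otimes>\<^bsub>S\<^esub> x"
    unfolding p(2) by (rule S_distrib_right[OF pS assms(2,1)])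
  have "g \<otimes>\<^bsub>S\<^esub> q \<ominus>\<^bsub>S\<^esub> g \<otimes>\<^bsub>S\<^esub> x = g \<otimes>\<^bsub>S\<^esub> p"
    using closed by (simp add: q a_minus_def S.a_assoc S.r_neg)
  then show "P +>\<^bsub>S\<^esub> (g \<otimes>\<^bsub>S\<^esub> q) = P +>\<^bsub>S\<^esub> (g \<otimes>\<^bsub>S\<^esub> x)"
    using gp closed by (intro coset_eqI) (auto simp: q)
qed

end

section \<open>Lifts to the deformed kernel and the map \<open>Upsilon\<close>\<close>

locale regular_collar = multicurve_basis +
  assumes regular: "regular_kernel M A c"
begin

text \<open>Surjectivity in the exact sequence yields an element of \<open>P'\<close> above
  \<open>f\<close>, and the multicurve basis splits it.\<close>

lemma lift_to_P':
  assumes "f \<in> P" obtains f' where "f' \<in> carrier S" "plus_eps M A c f f' \<in> P'"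
proof -
  have "f \<in> mod_eps M A c ` P'" using regular assms by (simp add: regular_kernel_def)
  then obtain F where F: "F \<in> P'" "f = mod_eps M A c F" by blast
  then have "F \<in> carrier S'" using P'.a_subset by blast
  then obtain g f' where "g \<in> carrier S" "f' \<in> carrier S" "F = plus_eps M A c g f'"
    by (rule plus_eps_surj)
  then show thesis using that F mod_eps_plus_eps by simp
qed

lemma lift_to_P'_unique:
  assumes f: "f \<in> P" and x: "x \<in> carrier S" "plus_eps M A c f x \<in> P'"
    and y: "y \<in> carrier S" "plus_eps M A c f y \<in> P'"
  shows "P +>\<^bsub>S\<^esub> x = P +>\<^bsub>S\<^esub> y"
proof (rule coset_eqI[OF x(1) y(1)])
  have fS: "f \<in> carrier S" using f P.a_subset by blast
  have xy: "x \<ominus>\<^bsub>S\<^esub> y \<in> carrier S" using x y by (simp add: S.minus_closed)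
  \<comment> \<open>The two lifts share the part \<open>f\<close>, so their difference is \<epsilon>
    times the difference of \<open>x\<close> and \<open>y\<close>.\<close>
  have eq: "plus_eps M A c \<zero>\<^bsub>S\<^esub> (x \<ominus>\<^bsub>S\<^esub> y) \<oplus>\<^bsub>S'\<^esub> plus_eps M A c f y = plus_eps M A c f x"
    using fS x y xy by (simp add: plus_eps_add S.zero_closed) (simp add: a_minus_def S.a_assoc S.l_neg)
  have "plus_eps M A c \<zero>\<^bsub>S\<^esub> (x \<ominus>\<^bsub>S\<^esub> y) = plus_eps M A c f x \<ominus>\<^bsub>S'\<^esub> plus_eps M A c f y"
    unfolding eq[symmetric] using plus_eps_closed[OF fS y(1)] plus_eps_closed[OF S.zero_closed xy]
    by (simp add: a_minus_def S'.a_assoc S'.r_neg)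
  also have "\<dots> \<in> P'" using x(2) y(2) by (simp add: a_minus_def P'.a_closed P'.a_inv_closed)
  finally have "plus_eps M A c \<zero>\<^bsub>S\<^esub> (x \<ominus>\<^bsub>S\<^esub> y) \<in> {F \<in> P'. mod_eps M A c F = \<zero>\<^bsub>S\<^esub>}"
    using mod_eps_plus_eps[OF S.zero_closed xy] by simp
  \<comment> \<open>Exactness in the middle: an element of \<open>P'\<close> that vanishes modulo
    \<epsilon> is \<epsilon> times an element of \<open>P\<close>.\<close>
  moreover have "plus_eps M A c \<zero>\<^bsub>S\<^esub> ` P = {F \<in> P'. mod_eps M A c F = \<zero>\<^bsub>S\<^esub>}"
    using regular by (simp add: regular_kernel_def)
  ultimately have "plus_eps M A c \<zero>\<^bsub>S\<^esub> (x \<ominus>\<^bsub>S\<^esub> y) \<in> plus_eps M A c \<zero>\<^bsub>S\<^esub> ` P"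
    by simp
  then obtain p where p: "p \<in> P" "plus_eps M A c \<zero>\<^bsub>S\<^esub> (x \<ominus>\<^bsub>S\<^esub> y) = plus_eps M A c \<zero>\<^bsub>S\<^esub> p"
    by blast
  have "p \<in> carrier S" using p(1) P.a_subset by blast
  then have "x \<ominus>\<^bsub>S\<^esub> y = p"
    using plus_eps_inject(2)[OF S.zero_closed xy S.zero_closed _ p(2)] by blast
  then show "x \<ominus>\<^bsub>S\<^esub> y \<in> P" using p(1) by simp
qed

text \<open>The value chosen in \<open>Upsilon\<close> is itself admissible, and any two admissible
  values lie in one coset.\<close>

lemma Upsilon_eq:
  assumes "f \<in> P" "f' \<in> carrier S" "plus_eps M A c f f' \<in> P'"
  shows "Upsilon M A c f = P +>\<^bsub>S\<^esub> f'"
proof -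
  let ?Q = "\<lambda>f'. f' \<in> carrier S \<and> plus_eps M A c f f' \<in> P'"
  have "?Q (SOME f'. ?Q f')" using assms(2,3) by (intro someI[of ?Q f']) blast
  then show ?thesis
    unfolding Upsilon_def using lift_to_P'_unique[OF assms(1)] assms(2,3) by blast
qed

lemma Upsilon_mult:
  assumes f: "f \<in> P" and g: "g \<in> carrier S"
  shows "Upsilon M A c (g \<otimes>\<^bsub>S\<^esub> f) =
    coset_act M A c g (Upsilon M A c f) <+>\<^bsub>S\<^esub> (P +>\<^bsub>S\<^esub> ((1/2) \<odot>\<^bsub>S\<^esub> goldman_bracket M A c g f))"
proof -
  have fS: "f \<in> carrier S" using f P.a_subset by blast
  obtain f' where f': "f' \<in> carrier S" "plus_eps M A c f f' \<in> P'" using lift_to_P'[OF f] .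
  let ?h = "(1/2) \<odot>\<^bsub>S\<^esub> goldman_bracket M A c g f"
  have h: "?h \<in> carrier S" by (intro S_smult_closed goldman_bracket(1) fS g)
  have gf': "g \<otimes>\<^bsub>S\<^esub> f' \<in> carrier S" using g f'(1) by (rule S_mult_closed)
  \<comment> \<open>\<open>g\<close> is lifted with zero \<epsilon>-part, so of the two mixed terms
    only the product of \<open>g\<close> and \<open>f'\<close> survives, next to half the
    bracket.\<close>
  have "plus_eps M A c g \<zero>\<^bsub>S\<^esub> \<otimes>\<^bsub>S'\<^esub> plus_eps M A c f f' =
      plus_eps M A c (g \<otimes>\<^bsub>S\<^esub> f) (g \<otimes>\<^bsub>S\<^esub> f' \<oplus>\<^bsub>S\<^esub> ?h)"
    using goldman_bracket(2)[OF g fS S.zero_closed f'(1)] gf' by (simp add: S_zero_mult[OF fS])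
  then have "plus_eps M A c (g \<otimes>\<^bsub>S\<^esub> f) (g \<otimes>\<^bsub>S\<^esub> f' \<oplus>\<^bsub>S\<^esub> ?h) \<in> P'"
    using P'_left_ideal[OF plus_eps_closed[OF g S.zero_closed] f'(2)] by simp
  then have "Upsilon M A c (g \<otimes>\<^bsub>S\<^esub> f) = P +>\<^bsub>S\<^esub> (g \<otimes>\<^bsub>S\<^esub> f' \<oplus>\<^bsub>S\<^esub> ?h)"
    using gf' h by (intro Upsilon_eq P_left_ideal[OF g f] S.a_closed)
  also have "\<dots> = (P +>\<^bsub>S\<^esub> (g \<otimes>\<^bsub>S\<^esub> f')) <+>\<^bsub>S\<^esub> (P +>\<^bsub>S\<^esub> ?h)"
    using P.a_rcos_sum[OF gf' h] by simp
  also have "P +>\<^bsub>S\<^esub> (g \<otimes>\<^bsub>S\<^esub> f') = coset_act M A c g (Upsilon M A c f)"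
    by (simp add: Upsilon_eq[OF f f'] coset_act[OF g f'(1)])
  finally show ?thesis .
qed

end

theorem lemma2p2:
  fixes M :: "'a::euclidean_space set"
    and A :: "'a chart set"
    and c :: "'a \<times> real \<Rightarrow> 'a"
  assumes "oriented_3manifold M A" and "compact M" and "connected M"
    and "collar M c"
    and "multicurves_form_basis M A c (- 1 :: complex)"
    and "multicurves_form_basis M A c (- 1 + dual_eps)"
    and "regular_kernel M A c"
  shows "(\<forall>f\<in>PB M A c.
            (\<exists>f'\<in>carrier (SB M A c). plus_eps M A c f f' \<in> PB' M A c) \<and>
            (\<forall>f'\<in>carrier (SB M A c). plus_eps M A c f f' \<in> PB' M A c \<longrightarrow>
               Upsilon M A c f = PB M A c +>\<^bsub>SB M A c\<^esub> f')) \<and>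
         (\<forall>f\<in>PB M A c. \<forall>g\<in>carrier (SB M A c).
            g \<otimes>\<^bsub>SB M A c\<^esub> f \<in> PB M A c \<and>
            Upsilon M A c (g \<otimes>\<^bsub>SB M A c\<^esub> f) =
              coset_act M A c g (Upsilon M A c f) <+>\<^bsub>SB M A c\<^esub>
              (PB M A c +>\<^bsub>SB M A c\<^esub> ((1/2) \<odot>\<^bsub>SB M A c\<^esub> goldman_bracket M A c g f)))"
proof -
  interpret regular_collar M A c
    using assms by unfold_locales
  show ?thesis
  proof (intro conjI ballI impI)
    show "\<exists>f'\<in>carrier (SB M A c). plus_eps M A c f f' \<in> PB' M A c" if "f \<in> PB M A c" for f
      using lift_to_P'[OF that] by blast
  qed (rule Upsilon_eq P_left_ideal Upsilon_mult; assumption)+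
qed

end
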